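(* Let $X\subset\mathbb{R}^n\setminus\{0\}$ be a finite multiset of full rank $n$ equipped with an arbitrary fixed total order $\prec$, and let $\lambda\in\mathbb{R}^X$ be generic. Then: (1) $\dim\mathcal{P}_-(X)=\dim\mathcal{D}_-(X)=\#\mathbb{B}_-(X)$. (2) The map $p\mapsto\langle p,\cdot\rangle$ is a bijection between $\mathcal{D}_-(X)$ and the dual space $\mathcal{P}_-(X)'$. (3) $\mathcal{D}_-(X)=\Pi(V_-(X,\lambda))=\ker\mathcal{J}_-(X)$. (4) The vertex set $V_-(X,\lambda)$ is correct for $\mathcal{D}_-(X)$ as well as for $\mathcal{P}_-(X)$. (5) $\mathcal{P}_-(X)=\ker\mathcal{I}_-(X)$. (6) $\mathcal{P}_-(X)\oplus\mathcal{J}_-(X)=\Pi$.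
   Context: Repeated vectors of $X$ are treated as distinct elements; subsets, set differences and cardinalities are taken with multiplicity. $\Pi=\mathbb{C}[t_1,\dots,t_n]$; $p(D)=p(\partial/\partial t_1,\dots,\partial/\partial t_n)$; for a polynomial $p$ and a polynomial or power series $f$, $\langle p,f\rangle=(p(D)f)(0)$. For $y\in\mathbb{R}^n$, $p_y(t)=y\cdot t$, and $p_Y=\prod_{y\in Y}p_y$ (with $p_\emptyset=1$). For a homogeneous ideal $I$, $\ker I=\{p\in\Pi:q(D)p=0\ \forall q\in I\}$. Internal bases: $\mathbb{B}(X)$ is the set of $B\subset X$ that are bases of $\mathbb{R}^n$. For $B\in\mathbb{B}(X)$, an element $b\in B$ is internally active in $B$ if $b$ is the $\prec$-maximal element of $X\setminus\mathrm{span}(B\setminus b)$. $\mathbb{B}_-(X)$ is the set of $B\in\mathbb{B}(X)$ with no internally active element. Spaces and ideals: $L_-(X)=\{Y\subset X:Y\cap B\ne\emptyset\ \forall B\in\mathbb{B}_-(X)\}$; $\mathcal{J}_-(X)$ is the ideal generated by $\{p_Y:Y\in L_-(X)\}$; $\mathcal{D}_-(X)=\ker\mathcal{J}_-(X)$. For a multisubset $W\subset X$, $\mathcal{P}(W)=\mathrm{span}_{\mathbb{C}}\{p_Y:Y\subset W,\ \mathrm{rank}(W\setminus Y)=n\}$ (which is $\{0\}$ if $\mathrm{rank}\,W<n$), and $\mathcal{P}_-(X)=\bigcap_{x\in X}\mathcal{P}(X\setminus x)$, where $X\setminus x$ is $X$ with the single element $x$ removed. $\mathcal{F}(X)$ is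 the set of linear subspaces $H\subset\mathbb{R}^n$ with $\dim H=n-1$ and $\mathrm{span}(X\cap H)=H$; $\eta_H$ is a nonzero normal to $H$, $m(H)=\#(X\setminus H)$, and $\mathcal{I}_-(X)$ is the ideal generated by $p_{\eta_H}^{m(H)-1}$, $H\in\mathcal{F}(X)$. Vertices: $\lambda\in\mathbb{R}^{X}$ is generic if the intersection of any $n+1$ of the hyperplanes $H_{x,\lambda}=\{t\in\mathbb{R}^n:x\cdot t=\lambda_x\}$, $x\in X$, is empty. For $B\in\mathbb{B}(X)$, $v_B$ is the unique point of $\bigcap_{b\in B}H_{b,\lambda}$; $V_-(X,\lambda)=\{v_B:B\in\mathbb{B}_-(X)\}$. Least map: for a nonzero power series $f=f_0+f_1+\cdots$ with $f_j$ homogeneous of degree $j$, $f_\downarrow$ is the nonzero $f_j$ of smallest $j$; $0_\downarrow=0$. For finite $\sigma\subset\mathbb{R}^n$, $\mathrm{Exp}(\sigma)=\mathrm{span}_{\mathbb{C}}\{t\mapsto e^{\alpha\cdot t}:\alpha\in\sigma\}$ and $\Pi(\sigma)=\mathrm{span}\{f_\downarrow:f\in\mathrm{Exp}(\sigma)\}$. The set $\sigma$ is correct for a subspace $P\subset\Pi$ if the restriction map $P\to\mathbb{C}^\sigma$, $p\mapsto p|_\sigma$, is bijective. *)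

theory Defs
  imports "HOL-Analysis.Analysis" "HOL-Library.Poly_Mapping"
begin

section \<open>Complex polynomials in the variables indexed by a finite type\<close>

text \<open>A polynomial is the finitely supported map from exponent vectors to coefficients.
  The finite type \<open>'n\<close> indexes the variables \<open>t\<^sub>i\<close> as well as the coordinates of \<open>real ^ 'n\<close>.\<close>

type_synonym 'n cpoly = "('n \<Rightarrow>\<^sub>0 nat) \<Rightarrow>\<^sub>0 complex"

definition cscale :: "complex \<Rightarrow> 'n cpoly \<Rightarrow> 'n cpoly" where
  "cscale c p = Poly_Mapping.single 0 c * p"

interpretation cpoly: vector_space "cscale :: complex \<Rightarrow> 'n cpoly \<Rightarrow> 'n cpoly"
  by standard
    (simp_all add: cscale_def algebra_simps single_add mult_single flip: mult.assoc)

text \<open>A commutative ring as a module over itself; \<open>ideal.span S\<close> is the ideal generated by \<open>S\<close>.\<close>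

interpretation ideal: module "(*) :: 'r::comm_ring_1 \<Rightarrow> 'r \<Rightarrow> 'r"
  by standard (simp_all add: algebra_simps)

definition peval :: "('n::finite) cpoly \<Rightarrow> real ^ 'n \<Rightarrow> complex" where
  "peval p t =
    (\<Sum>m\<in>Poly_Mapping.keys p. Poly_Mapping.lookup p m * (\<Prod>i\<in>UNIV. complex_of_real (t $ i) ^ Poly_Mapping.lookup m i))"

definition homog :: "nat \<Rightarrow> ('n::finite) cpoly \<Rightarrow> bool" where
  "homog d p \<longleftrightarrow> (\<forall>m\<in>Poly_Mapping.keys p. (\<Sum>i\<in>UNIV. Poly_Mapping.lookup m i) = d)"

definition var :: "'n \<Rightarrow> 'n cpoly" where
  "var i = Poly_Mapping.single (Poly_Mapping.single i 1) 1"

definition fin_dim :: "'n cpoly set \<Rightarrow> bool" where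
  "fin_dim V \<longleftrightarrow> (\<exists>S. finite S \<and> V \<subseteq> cpoly.span S)"


section \<open>Differential operators with constant coefficients\<close>

text \<open>\<open>mderiv m\<close> is the iterated partial derivative of multi-order \<open>m\<close>. A monomial \<open>t\<^sup>k\<close> is sent to
  the product of the falling factorials \<open>k\<^sub>i (k\<^sub>i - 1) \<dots> (k\<^sub>i - m\<^sub>i + 1)\<close> times \<open>t\<^sup>k\<^sup>-\<^sup>m\<close>; as
  subtraction is truncated, the falling factorial vanishes when \<open>k\<^sub>i < m\<^sub>i\<close>, where the exponent
  \<open>k - m\<close> is meaningless.\<close>

definition mderiv :: "('n::finite \<Rightarrow>\<^sub>0 nat) \<Rightarrow> 'n cpoly \<Rightarrow> 'n cpoly" where
  "mderiv m p =
    (\<Sum>k\<in>Poly_Mapping.keys p. Poly_Mapping.single (k - m)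
       (Poly_Mapping.lookup p k * of_nat (\<Prod>i\<in>UNIV. \<Prod>j<Poly_Mapping.lookup m i. Poly_Mapping.lookup k i - j)))"

definition pdiff :: "('n::finite) cpoly \<Rightarrow> 'n cpoly \<Rightarrow> 'n cpoly" where
  "pdiff p f = (\<Sum>m\<in>Poly_Mapping.keys p. cscale (Poly_Mapping.lookup p m) (mderiv m f))"

definition pairing :: "('n::finite) cpoly \<Rightarrow> 'n cpoly \<Rightarrow> complex" where
  "pairing p f = peval (pdiff p f) 0"

definition pker :: "('n::finite) cpoly set \<Rightarrow> 'n cpoly set" where
  "pker I = {p. \<forall>q\<in>I. pdiff q p = 0}"

definition dual :: "'n cpoly set \<Rightarrow> ('n cpoly \<Rightarrow> complex) set" where
  "dual P = {\<phi> \<in> extensional P.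
     (\<forall>p\<in>P. \<forall>q\<in>P. \<phi> (p + q) = \<phi> p + \<phi> q) \<and> (\<forall>c. \<forall>p\<in>P. \<phi> (cscale c p) = c * \<phi> p)}"


section \<open>The multiset \<open>X\<close> and its bases\<close>

text \<open>The multiset is a family of vectors \<open>x i\<close> indexed by a finite set \<open>X\<close>, so that repeated vectors
  are distinct elements. A relation \<open>r\<close> totally orders \<open>X\<close>, where \<open>(i, j) \<in> r\<close> means that
  \<open>i\<close> is below or equal to \<open>j\<close>.\<close>

definition lin_form :: "real ^ 'n \<Rightarrow> ('n::finite) cpoly" where
  "lin_form y = (\<Sum>i\<in>UNIV. cscale (complex_of_real (y $ i)) (var i))"

definition prod_form :: "('a \<Rightarrow> real ^ 'n) \<Rightarrow> 'a set \<Rightarrow> ('n::finite) cpoly" where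
  "prod_form x Y = (\<Prod>i\<in>Y. lin_form (x i))"

definition bases :: "'a set \<Rightarrow> ('a \<Rightarrow> real ^ 'n) \<Rightarrow> 'a set set" where
  "bases X x = {B. B \<subseteq> X \<and> inj_on x B \<and> independent (x ` B) \<and> span (x ` B) = UNIV}"

definition int_active ::
    "'a rel \<Rightarrow> 'a set \<Rightarrow> ('a \<Rightarrow> real ^ 'n) \<Rightarrow> 'a set \<Rightarrow> 'a \<Rightarrow> bool" where
  "int_active r X x B b \<longleftrightarrow>
    (let C = {i \<in> X. x i \<notin> span (x ` (B - {b}))} in b \<in> C \<and> (\<forall>i\<in>C. (i, b) \<in> r))"

definition int_bases :: "'a rel \<Rightarrow> 'a set \<Rightarrow> ('a \<Rightarrow> real ^ 'n) \<Rightarrow> 'a set set" where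
  "int_bases r X x = {B \<in> bases X x. \<not> (\<exists>b\<in>B. int_active r X x B b)}"


section \<open>The internal spaces and ideals\<close>

definition int_long :: "'a rel \<Rightarrow> 'a set \<Rightarrow> ('a \<Rightarrow> real ^ 'n) \<Rightarrow> 'a set set" where
  "int_long r X x = {Y. Y \<subseteq> X \<and> (\<forall>B\<in>int_bases r X x. Y \<inter> B \<noteq> {})}"

definition J_int :: "'a rel \<Rightarrow> 'a set \<Rightarrow> ('a \<Rightarrow> real ^ 'n) \<Rightarrow> ('n::finite) cpoly set" where
  "J_int r X x = ideal.span (prod_form x ` int_long r X x)"

definition D_int :: "'a rel \<Rightarrow> 'a set \<Rightarrow> ('a \<Rightarrow> real ^ 'n) \<Rightarrow> ('n::finite) cpoly set" where
  "D_int r X x = pker (J_int r X x)"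

definition P_central :: "'a set \<Rightarrow> ('a \<Rightarrow> real ^ 'n) \<Rightarrow> ('n::finite) cpoly set" where
  "P_central W x = cpoly.span {prod_form x Y | Y. Y \<subseteq> W \<and> dim (x ` (W - Y)) = CARD('n)}"

definition P_int :: "'a set \<Rightarrow> ('a \<Rightarrow> real ^ 'n) \<Rightarrow> ('n::finite) cpoly set" where
  "P_int X x = (\<Inter>i\<in>X. P_central (X - {i}) x)"

definition facets :: "'a set \<Rightarrow> ('a \<Rightarrow> real ^ 'n) \<Rightarrow> (real ^ 'n) set set" where
  "facets X x = {H. subspace H \<and> dim H = CARD('n) - 1 \<and> span (x ` X \<inter> H) = H}"

definition is_normal :: "real ^ 'n \<Rightarrow> (real ^ 'n) set \<Rightarrow> bool" where
  "is_normal v H \<longleftrightarrow> v \<noteq> 0 \<and> (\<forall>h\<in>H. v \<bullet> h = 0)"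

text \<open>\<open>\<eta>\<close> is a choice of normals. The truncated subtraction in the exponent is harmless: a full-rank
  family has an element outside every \<open>H \<in> facets X x\<close>.\<close>

definition I_int ::
    "((real ^ 'n) set \<Rightarrow> real ^ 'n) \<Rightarrow> 'a set \<Rightarrow> ('a \<Rightarrow> real ^ 'n) \<Rightarrow> ('n::finite) cpoly set" where
  "I_int \<eta> X x =
    ideal.span ((\<lambda>H. lin_form (\<eta> H) ^ (card {i \<in> X. x i \<notin> H} - 1)) ` facets X x)"


section \<open>Vertices of the hyperplane arrangement\<close>

definition hyperplane :: "('a \<Rightarrow> real ^ 'n) \<Rightarrow> ('a \<Rightarrow> real) \<Rightarrow> 'a \<Rightarrow> (real ^ 'n) set" where
  "hyperplane x l i = {t. x i \<bullet> t = l i}"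

text \<open>The \<open>n + 1\<close> hyperplanes are counted by their indices: two elements of \<open>X\<close> that happen to give the
  same hyperplane count twice.\<close>

definition generic :: "'a set \<Rightarrow> ('a \<Rightarrow> real ^ 'n) \<Rightarrow> ('a \<Rightarrow> real) \<Rightarrow> bool" where
  "generic X x l \<longleftrightarrow>
    (\<forall>S. S \<subseteq> X \<and> card S = CARD('n) + 1 \<longrightarrow> (\<Inter>i\<in>S. hyperplane x l i) = {})"

definition vertex :: "('a \<Rightarrow> real ^ 'n) \<Rightarrow> ('a \<Rightarrow> real) \<Rightarrow> 'a set \<Rightarrow> real ^ 'n" where
  "vertex x l B = (THE v. v \<in> (\<Inter>b\<in>B. hyperplane x l b))"

definition int_vertices ::
    "'a rel \<Rightarrow> 'a set \<Rightarrow> ('a \<Rightarrow> real ^ 'n) \<Rightarrow> ('a \<Rightarrow> real) \<Rightarrow> (real ^ 'n) set" where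
  "int_vertices r X x l = vertex x l ` int_bases r X x"


section \<open>The least map and correct point sets\<close>

text \<open>The linear span of the exponentials \<open>t \<mapsto> exp (\<alpha> \<bullet> t)\<close> for \<open>\<alpha> \<in> \<sigma>\<close>, as a space of functions; only
  used for finite \<open>\<sigma>\<close>.\<close>

definition Exp_space :: "(real ^ 'n) set \<Rightarrow> (real ^ 'n \<Rightarrow> complex) set" where
  "Exp_space \<sigma> =
    {\<lambda>t. \<Sum>\<alpha>\<in>\<sigma>. c \<alpha> * exp (complex_of_real (\<alpha> \<bullet> t)) | c. True}"

definition homog_expansion :: "(real ^ 'n \<Rightarrow> complex) \<Rightarrow> (nat \<Rightarrow> ('n::finite) cpoly) \<Rightarrow> bool" where
  "homog_expansion f g \<longleftrightarrow>
    (\<forall>j. homog j (g j)) \<and> (\<forall>t. (\<lambda>j. peval (g j) t) sums f t)"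

text \<open>\<open>is_least f p\<close> says that \<open>f\<close> is an everywhere convergent power series and \<open>p\<close> its nonzero
  homogeneous component of smallest degree, or that both vanish.\<close>

definition is_least :: "(real ^ 'n \<Rightarrow> complex) \<Rightarrow> ('n::finite) cpoly \<Rightarrow> bool" where
  "is_least f p \<longleftrightarrow>
    (\<exists>g. homog_expansion f g \<and>
      ((\<forall>j. g j = 0) \<and> p = 0 \<or> (\<exists>j. g j \<noteq> 0 \<and> (\<forall>i<j. g i = 0) \<and> p = g j)))"

definition least_space :: "(real ^ 'n) set \<Rightarrow> ('n::finite) cpoly set" where
  "least_space \<sigma> = cpoly.span {p. \<exists>f\<in>Exp_space \<sigma>. is_least f p}"

definition correct :: "(real ^ 'n) set \<Rightarrow> ('n::finite) cpoly set \<Rightarrow> bool" where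
  "correct \<sigma> P \<longleftrightarrow> bij_betw (\<lambda>p. restrict (peval p) \<sigma>) P (\<sigma> \<rightarrow>\<^sub>E UNIV)"

end

theory Submission
  imports Defs
begin

text \<open>
  The inequalities \<open>dim \<D>\<^sub>- \<le> dim \<P>\<^sub>- \<le> #V\<^sub>-\<close> come from deletion and contraction of the smallest
  element \<open>y\<close>, where a contraction is a restriction of polynomials to the flat \<open>y \<cdot> t = \<lambda>\<^sub>y\<close>.

  A polynomial in \<open>ker \<I>\<^sub>-\<close> that vanishes on \<open>V\<^sub>-\<close> vanishes on this flat by the contraction, so it is
  \<open>(p\<^sub>y - \<lambda>\<^sub>y) h\<close>, and \<open>h = 0\<close> by the deletion; hence \<open>dim \<P>\<^sub>- \<le> #V\<^sub>-\<close>. The same division, without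
  the vertices, gives \<open>\<P>(W) = ker \<I>(W)\<close> and from it \<open>\<P>\<^sub>- = ker \<I>\<^sub>-\<close>.

  For \<open>B \<in> \<B>\<^sub>-\<close> remove from each \<open>x \<in> X \<setminus> B\<close> its coordinates along those \<open>b \<in> B\<close> for which \<open>x\<close> is
  the maximal element of \<open>X \<setminus> span (B \<setminus> b)\<close>. Products of the resulting linear forms lie in
  \<open>ker \<I>\<^sub>-\<close>, they survive deletion and contraction, and an element of \<open>\<D>\<^sub>-\<close> that is orthogonal to all of
  them is zero; hence \<open>dim \<D>\<^sub>- \<le> dim \<P>\<^sub>-\<close>. This only uses the generators \<open>p\<^sub>Y\<close> of \<open>\<J>\<^sub>-\<close> with
  \<open>Y = (X \<setminus> H) \<setminus> max (X \<setminus> H)\<close> for a facet hyperplane \<open>H\<close>.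

  Finally \<open>\<Pi>(V\<^sub>-) \<subseteq> \<D>\<^sub>-\<close>, because \<open>\<Prod>\<^sub>y\<^sub>\<in>\<^sub>Y (p\<^sub>y(D) - \<lambda>\<^sub>y)\<close> annihilates the exponentials of all vertices,
  and evaluation maps \<open>\<Pi>(V\<^sub>-)\<close> onto the functions on \<open>V\<^sub>-\<close>: a functional \<open>\<langle>\<cdot>, f\<rangle>\<close> with \<open>f\<close> in the span of the
  exponentials is nonzero at the complex conjugate of the least term of \<open>f\<close>. So all the dimensions
  agree, and the remaining claims follow by linear algebra.
\<close>

section \<open>Polynomials and constant coefficient differential operators\<close>

declare ideal.scale_scale [simp del] \<comment> \<open>loops with \<open>mult.assoc\<close>\<close>

lemma monom_expansion: "p = (\<Sum>m\<in>Poly_Mapping.keys p. Poly_Mapping.single m (Poly_Mapping.lookup p m))"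
proof (rule poly_mapping_eqI)
  fix k
  show "Poly_Mapping.lookup p k
      = Poly_Mapping.lookup (\<Sum>m\<in>Poly_Mapping.keys p. Poly_Mapping.single m (Poly_Mapping.lookup p m)) k"
    by (simp add: lookup_sum lookup_single when_def in_keys_iff sum.delta)
qed

lemma monom_induct:
  assumes "\<And>m c. P (Poly_Mapping.single m c)" and "\<And>p q. P p \<Longrightarrow> P q \<Longrightarrow> P (p + q)"
  shows "P (p :: 'b \<Rightarrow>\<^sub>0 'c::comm_monoid_add)"
proof -
  have "P (\<Sum>m\<in>S. Poly_Mapping.single m (Poly_Mapping.lookup p m))" if "finite S" for S
    using that
  proof induction
    case empty
    show ?case using assms(1)[of undefined 0] by simp
  next
    case (insert a S)
    then show ?case using assms by simp
  qed
  then show ?thesis by (subst monom_expansion) simp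
qed

lemma cscale_single: "cscale c (Poly_Mapping.single m d) = Poly_Mapping.single m (c * d)"
  by (simp add: cscale_def mult_single)

lemma lookup_cscale [simp]: "Poly_Mapping.lookup (cscale c p) m = c * Poly_Mapping.lookup p m"
  by (induction p rule: monom_induct)
    (auto simp: cscale_single lookup_single when_def cpoly.scale_right_distrib lookup_add algebra_simps)

lemma cscale_mult_left: "cscale c p * q = cscale c (p * q)"
  unfolding cscale_def by (rule mult.assoc)

lemma cscale_mult_right: "p * cscale c q = cscale c (p * q)"
  unfolding cscale_def by (rule mult.left_commute)

text \<open>Strips one variable at a time from a monomial. This form suits directional derivatives,
  where the product rule for a factor \<open>var i\<close> is all that is required.\<close>

lemma cpoly_induct [case_names const add var]:
  fixes p :: "('n::finite) cpoly"
  assumes const: "\<And>c. P (Poly_Mapping.single 0 c)"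
    and add: "\<And>p q. P p \<Longrightarrow> P q \<Longrightarrow> P (p + q)"
    and var: "\<And>i p. P p \<Longrightarrow> P (var i * p)"
  shows "P p"
proof (rule monom_induct)
  fix m :: "'n \<Rightarrow>\<^sub>0 nat" and c
  show "P (Poly_Mapping.single m c)"
  proof (induction "\<Sum>i\<in>UNIV. Poly_Mapping.lookup m i" arbitrary: m)
    case 0
    then have "m = 0" by (auto intro!: poly_mapping_eqI)
    then show ?case using const by simp
  next
    case (Suc d)
    then obtain i where i: "Poly_Mapping.lookup m i \<noteq> 0"
      by (metis nat.distinct(1) sum.neutral)
    define m' where "m' = m - Poly_Mapping.single i 1"
    have m: "m = Poly_Mapping.single i 1 + m'"
      using i by (auto intro!: poly_mapping_eqI simp: m'_def lookup_add lookup_minus lookup_single when_def)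
    have "(\<Sum>j\<in>UNIV. Poly_Mapping.lookup m j) = 1 + (\<Sum>j\<in>UNIV. Poly_Mapping.lookup m' j)"
      by (subst m) (simp add: lookup_add sum.distrib lookup_single when_def)
    then have "P (var i * Poly_Mapping.single m' c)" using Suc by (intro var) simp
    then show ?case by (simp add: var_def mult_single m)
  qed
qed (fact add)

section \<open>Evaluation at real points\<close>

text \<open>The supports of two summands and of their sum differ; a common finite index set allows
  termwise addition. The analogous facts for \<open>mderiv\<close> and \<open>pdiff\<close> serve
  the same purpose.\<close>

lemma peval_superset:
  assumes "finite S" "Poly_Mapping.keys p \<subseteq> S"
  shows "peval p t = (\<Sum>m\<in>S. Poly_Mapping.lookup p m * (\<Prod>i\<in>UNIV. complex_of_real (t $ i) ^ Poly_Mapping.lookup m i))"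
  unfolding peval_def using assms
  by (intro sum.mono_neutral_left) (auto simp: in_keys_iff)

lemma peval_add [simp]: "peval (p + q) t = peval p t + peval q t"
proof -
  let ?S = "Poly_Mapping.keys p \<union> Poly_Mapping.keys q"
  show ?thesis
    using peval_superset[of ?S "p + q" t] peval_superset[of ?S p t] peval_superset[of ?S q t] keys_add[of p q]
    by (simp add: lookup_add algebra_simps sum.distrib)
qed

lemma peval_single:
  "peval (Poly_Mapping.single m c) t = c * (\<Prod>i\<in>UNIV. complex_of_real (t $ i) ^ Poly_Mapping.lookup m i)"
  by (simp add: peval_def)

lemma peval_const [simp]: "peval (Poly_Mapping.single 0 c) t = c"
  by (simp add: peval_single)

lemma peval_0 [simp]: "peval 0 t = 0"
  by (simp add: peval_def)

lemma peval_1 [simp]: "peval 1 t = 1"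
  by (metis peval_const single_one)

lemma peval_var [simp]: "peval (var i) t = complex_of_real (t $ i)"
proof -
  have "(\<Prod>j\<in>UNIV. complex_of_real (t $ j) ^ Poly_Mapping.lookup (Poly_Mapping.single i 1) j)
      = (\<Prod>j\<in>UNIV. if i = j then complex_of_real (t $ j) else 1)"
    by (intro prod.cong) (auto simp: lookup_single when_def)
  then show ?thesis by (simp add: var_def peval_single)
qed

lemma peval_mult [simp]: "peval (p * q) t = peval p t * peval q t"
proof (induction p rule: monom_induct)
  case (1 m c)
  show ?case
    by (induction q rule: monom_induct)
      (auto simp: mult_single peval_single lookup_add power_add prod.distrib distrib_left distrib_right)
next
  case (2 p p')
  then show ?case by (simp add: algebra_simps)
qed

lemma peval_cscale [simp]: "peval (cscale c p) t = c * peval p t"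
  by (simp add: cscale_def)

lemma peval_minus [simp]: "peval (- p) t = - peval p t"
  by (metis add.right_inverse add_eq_0_iff peval_0 peval_add)

lemma peval_diff [simp]: "peval (p - q) t = peval p t - peval q t"
  by (metis add_uminus_conv_diff peval_add peval_minus)

lemma peval_sum [simp]: "peval (\<Sum>i\<in>K. p i) t = (\<Sum>i\<in>K. peval (p i) t)"
  by (induction K rule: infinite_finite_induct) auto

lemma peval_prod [simp]: "peval (\<Prod>i\<in>K. p i) t = (\<Prod>i\<in>K. peval (p i) t)"
  by (induction K rule: infinite_finite_induct) auto

lemma peval_power [simp]: "peval (p ^ k) t = peval p t ^ k"
  by (induction k) auto

lemma peval_lin_form [simp]: "peval (lin_form y) t = complex_of_real (y \<bullet> t)"
  by (simp add: lin_form_def inner_vec_def)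

lemma lin_form_add: "lin_form (y + z) = lin_form y + lin_form z"
  by (simp add: lin_form_def sum.distrib cpoly.scale_left_distrib)

lemma lin_form_scale: "lin_form (c *\<^sub>R y) = cscale (complex_of_real c) (lin_form y)"
  by (simp add: lin_form_def cpoly.scale_sum_right)

lemma lin_form_0 [simp]: "lin_form 0 = 0"
  by (simp add: lin_form_def)

section \<open>Iterated partial derivatives and the operators built from them\<close>

lemma mderiv_superset:
  assumes "finite S" "Poly_Mapping.keys p \<subseteq> S"
  shows "mderiv m p = (\<Sum>k\<in>S. Poly_Mapping.single (k - m)
       (Poly_Mapping.lookup p k * of_nat (\<Prod>i\<in>UNIV. \<Prod>j<Poly_Mapping.lookup m i. Poly_Mapping.lookup k i - j)))"
  unfolding mderiv_def using assms
  by (intro sum.mono_neutral_left) (auto simp: in_keys_iff)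

lemma mderiv_add [simp]: "mderiv m (p + q) = mderiv m p + mderiv m q"
proof -
  let ?S = "Poly_Mapping.keys p \<union> Poly_Mapping.keys q"
  show ?thesis
    using mderiv_superset[of ?S "p + q" m] mderiv_superset[of ?S p m] mderiv_superset[of ?S q m] keys_add[of p q]
    by (simp only: lookup_add single_add distrib_right sum.distrib) auto
qed

text \<open>For \<open>k = m\<close> this is the multi-index factorial m!, the weight of the
  monomial with exponent \<open>m\<close> in the pairing.\<close>

definition ffact_vec :: "('n::finite \<Rightarrow>\<^sub>0 nat) \<Rightarrow> ('n \<Rightarrow>\<^sub>0 nat) \<Rightarrow> nat" where
  "ffact_vec k m = (\<Prod>i\<in>UNIV. \<Prod>j<Poly_Mapping.lookup m i. Poly_Mapping.lookup k i - j)"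

lemma mderiv_single:
  "mderiv m (Poly_Mapping.single k c) = Poly_Mapping.single (k - m) (c * of_nat (ffact_vec k m))"
  by (auto simp: mderiv_def ffact_vec_def)

lemma ffact_vec_add: "ffact_vec k (m + m') = ffact_vec k m * ffact_vec (k - m) m'"
proof -
  \<comment> \<open>The last \<open>b\<close> factors of a falling factorial again form one,
    starting at \<open>n - a\<close>; truncation is harmless since both sides subtract the same
    total.\<close>
  have *: "(\<Prod>j<a + b. n - j) = (\<Prod>j<a. n - j) * (\<Prod>j<b. n - a - j)" for a b n :: nat
    by (induction b) (auto simp: algebra_simps)
  show ?thesis
    by (simp add: ffact_vec_def lookup_add lookup_minus * prod.distrib)
qed

lemma ffact_vec_0 [simp]: "ffact_vec k 0 = 1"
  by (simp add: ffact_vec_def)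

lemma ffact_vec_single: "ffact_vec k (Poly_Mapping.single i 1) = Poly_Mapping.lookup k i"
proof -
  have "ffact_vec k (Poly_Mapping.single i 1) = (\<Prod>j\<in>UNIV. if i = j then Poly_Mapping.lookup k j else 1)"
    unfolding ffact_vec_def by (intro prod.cong) (auto simp: lookup_single when_def)
  then show ?thesis by simp
qed

lemma mderiv_mderiv: "mderiv m' (mderiv m p) = mderiv (m + m') p"
  by (induction p rule: monom_induct)
    (simp_all add: mderiv_single ffact_vec_add diff_diff_eq mult.assoc)

lemma mderiv_zero [simp]: "mderiv m 0 = 0"
  by (simp add: mderiv_def)

lemma mderiv_0 [simp]: "mderiv 0 p = p"
  by (induction p rule: monom_induct) (simp_all add: mderiv_single)

lemma mderiv_cscale [simp]: "mderiv m (cscale c p) = cscale c (mderiv m p)"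
  by (induction p rule: monom_induct)
    (simp_all add: mderiv_single cscale_single cpoly.scale_right_distrib mult.assoc)

lemma pdiff_superset:
  assumes "finite S" "Poly_Mapping.keys p \<subseteq> S"
  shows "pdiff p f = (\<Sum>m\<in>S. cscale (Poly_Mapping.lookup p m) (mderiv m f))"
  unfolding pdiff_def using assms
  by (intro sum.mono_neutral_left) (auto simp: in_keys_iff)

lemma pdiff_add_left [simp]: "pdiff (p + q) f = pdiff p f + pdiff q f"
proof -
  let ?S = "Poly_Mapping.keys p \<union> Poly_Mapping.keys q"
  show ?thesis
    using pdiff_superset[of ?S "p + q" f] pdiff_superset[of ?S p f] pdiff_superset[of ?S q f] keys_add[of p q]
    by (simp add: lookup_add cpoly.scale_left_distrib sum.distrib)
qed

lemma pdiff_add_right [simp]: "pdiff p (f + g) = pdiff p f + pdiff p g"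
  by (simp add: pdiff_def sum.distrib cpoly.scale_right_distrib)

lemma pdiff_single: "pdiff (Poly_Mapping.single m c) f = cscale c (mderiv m f)"
  by (simp add: pdiff_def)

lemma pdiff_zero_left [simp]: "pdiff 0 f = 0"
  by (simp add: pdiff_def)

lemma pdiff_zero_right [simp]: "pdiff p 0 = 0"
  by (simp add: pdiff_def)

lemma pdiff_const [simp]: "pdiff (Poly_Mapping.single 0 c) f = cscale c f"
  by (simp add: pdiff_single)

lemma pdiff_one [simp]: "pdiff 1 f = f"
  by (metis cpoly.scale_one pdiff_const single_one)

lemma pdiff_cscale_right [simp]: "pdiff p (cscale c f) = cscale c (pdiff p f)"
  by (simp add: pdiff_def cpoly.scale_sum_right mult.commute)

text \<open>Monomial operators compose by adding orders, so polynomials act as a commutative ring.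
  All commutation of derivatives comes from here.\<close>

lemma pdiff_mult: "pdiff (p * q) f = pdiff p (pdiff q f)"
proof (induction p rule: monom_induct)
  case (1 m c)
  show ?case
    by (induction q rule: monom_induct)
      (auto simp: mult_single pdiff_single mderiv_mderiv cpoly.scale_right_distrib distrib_left add.commute)
next
  case (2 p p')
  then show ?case by (simp add: distrib_right)
qed

lemma pdiff_cscale_left [simp]: "pdiff (cscale c p) f = cscale c (pdiff p f)"
  by (simp add: cscale_def pdiff_mult)

lemma pdiff_commute: "pdiff p (pdiff q f) = pdiff q (pdiff p f)"
  by (metis mult.commute pdiff_mult)

lemma pdiff_minus_right [simp]: "pdiff p (- f) = - pdiff p f"
  by (metis add.right_inverse add_eq_0_iff pdiff_add_right pdiff_zero_right)

lemma pdiff_diff_right [simp]: "pdiff p (f - g) = pdiff p f - pdiff p g"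
  by (metis add_uminus_conv_diff pdiff_add_right pdiff_minus_right)

lemma pdiff_minus_left [simp]: "pdiff (- p) f = - pdiff p f"
  by (metis add.right_inverse add_eq_0_iff pdiff_add_left pdiff_zero_left)

lemma pdiff_diff_left [simp]: "pdiff (p - q) f = pdiff p f - pdiff q f"
  by (metis add_uminus_conv_diff pdiff_add_left pdiff_minus_left)

lemma pdiff_sum_left [simp]: "pdiff (\<Sum>i\<in>K. p i) f = (\<Sum>i\<in>K. pdiff (p i) f)"
  by (induction K rule: infinite_finite_induct) auto

lemma pdiff_sum_right [simp]: "pdiff p (\<Sum>i\<in>K. f i) = (\<Sum>i\<in>K. pdiff p (f i))"
  by (induction K rule: infinite_finite_induct) auto

lemma pdiff_var: "pdiff (var i) f = mderiv (Poly_Mapping.single i 1) f"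
  by (simp add: var_def pdiff_single)

section \<open>The product rule for first order operators\<close>

lemma pdiff_var_mult: "pdiff (var i) (f * g) = pdiff (var i) f * g + f * pdiff (var i) g"
proof (induction f rule: monom_induct)
  case (1 m c)
  show ?case
  proof (induction g rule: monom_induct)
    case (1 k d)
    let ?e = "Poly_Mapping.single i (1::nat)"
    \<comment> \<open>Truncated subtraction makes the two exponents differ only if the variable is
      absent from \<open>m\<close>, and then the coefficient is zero. The next fact is the same for
      \<open>k\<close>.\<close>
    have 1: "Poly_Mapping.single (m + k - ?e) (c * d * of_nat (Poly_Mapping.lookup m i))
        = Poly_Mapping.single (m - ?e + k) (c * d * of_nat (Poly_Mapping.lookup m i))"
    proof (cases "Poly_Mapping.lookup m i = 0")
      case False
      then have "m + k - ?e = m - ?e + k"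
        by (intro poly_mapping_eqI) (auto simp: lookup_add lookup_minus lookup_single when_def)
      then show ?thesis by simp
    qed simp
    have 2: "Poly_Mapping.single (m + k - ?e) (c * d * of_nat (Poly_Mapping.lookup k i))
        = Poly_Mapping.single (m + (k - ?e)) (c * d * of_nat (Poly_Mapping.lookup k i))"
    proof (cases "Poly_Mapping.lookup k i = 0")
      case False
      then have "m + k - ?e = m + (k - ?e)"
        by (intro poly_mapping_eqI) (auto simp: lookup_add lookup_minus lookup_single when_def)
      then show ?thesis by simp
    qed simp
    show ?case
      by (simp only: pdiff_var mult_single mderiv_single ffact_vec_single lookup_add of_nat_add
          distrib_left single_add 1 2) (simp add: algebra_simps)
  next
    case (2 p q)
    then show ?case by (simp add: algebra_simps)
  qed
next
  case (2 p q)
  then show ?case by (simp add: algebra_simps)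
qed

lemma pdiff_lin_form: "pdiff (lin_form y) f = (\<Sum>i\<in>UNIV. cscale (complex_of_real (y $ i)) (pdiff (var i) f))"
  by (simp add: lin_form_def)

lemma pdiff_lin_form_mult:
  "pdiff (lin_form y) (f * g) = pdiff (lin_form y) f * g + f * pdiff (lin_form y) g"
  by (simp add: pdiff_lin_form pdiff_var_mult cpoly.scale_right_distrib sum.distrib
      sum_distrib_left sum_distrib_right cscale_mult_left cscale_mult_right)

lemma pdiff_var_const [simp]: "pdiff (var i) (Poly_Mapping.single 0 c) = 0"
  by (simp add: pdiff_var mderiv_single ffact_vec_single[unfolded One_nat_def])

lemma pdiff_var_var: "pdiff (var i) (var j) = (if i = j then 1 else 0)"
  by (simp add: pdiff_var, simp add: var_def mderiv_single ffact_vec_single[unfolded One_nat_def] lookup_single when_def)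

lemma pdiff_lin_const [simp]: "pdiff (lin_form y) (Poly_Mapping.single 0 c) = 0"
  by (simp add: pdiff_lin_form)

lemma cscale_one_eq: "cscale c 1 = Poly_Mapping.single 0 c"
  by (simp add: cscale_def)

lemma pdiff_lin_var: "pdiff (lin_form y) (var i) = Poly_Mapping.single 0 (complex_of_real (y $ i))"
  by (simp add: pdiff_lin_form pdiff_var_var if_distrib cscale_one_eq sum.delta cong: if_cong)

lemma single_sum: "(\<Sum>i\<in>K. Poly_Mapping.single m (c i)) = Poly_Mapping.single m (\<Sum>i\<in>K. c i)"
  by (induction K rule: infinite_finite_induct) (auto simp: single_add)

lemma pdiff_lin_lin: "pdiff (lin_form y) (lin_form z) = Poly_Mapping.single 0 (complex_of_real (y \<bullet> z))"
proof -
  have "pdiff (lin_form y) (lin_form z)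
      = (\<Sum>i\<in>UNIV. cscale (complex_of_real (z $ i)) (pdiff (lin_form y) (var i)))"
    unfolding lin_form_def[of z] by simp
  then show ?thesis
    by (simp add: pdiff_lin_var cscale_single single_sum inner_vec_def mult.commute)
qed

section \<open>Degrees along directions\<close>

text \<open>Connects the formal operator with the analytic derivative along a line, so that
  vanishing on a line passes to derivatives.\<close>

lemma has_vector_derivative_peval:
  "((\<lambda>s. peval f (t + s *\<^sub>R v)) has_vector_derivative peval (pdiff (lin_form v) f) (t + s *\<^sub>R v)) (at s)"
proof (induction f rule: cpoly_induct)
  case (const c)
  show ?case by simp
next
  case (add p q)
  then show ?case by (auto intro: derivative_intros)
next
  case (var i p)
  have 1: "((\<lambda>s. complex_of_real ((t + s *\<^sub>R v) $ i)) has_vector_derivative complex_of_real (v $ i)) (at s)"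
    by (auto intro!: derivative_eq_intros simp flip: has_real_derivative_iff_has_vector_derivative)
  show ?case
    using has_vector_derivative_mult[OF 1 var] by (simp add: pdiff_lin_form_mult pdiff_lin_var algebra_simps)
qed

lemma peval_pdiff_eq_0:
  assumes "\<And>s. peval f (t + s *\<^sub>R v) = 0"
  shows "peval (pdiff (lin_form v) f) t = 0"
proof -
  have "((\<lambda>s. 0) has_vector_derivative peval (pdiff (lin_form v) f) (t + 0 *\<^sub>R v)) (at 0)"
    using has_vector_derivative_peval[of f t v 0] by (simp add: assms)
  from vector_derivative_unique_at[OF this has_vector_derivative_const] show ?thesis by simp
qed

text \<open>The affine subspace on which polynomials of the contraction by \<open>Z\<close> live; it
  is the whole space for \<open>Z = {}\<close>.\<close>

definition flat :: "('a \<Rightarrow> real ^ 'n) \<Rightarrow> ('a \<Rightarrow> real) \<Rightarrow> 'a set \<Rightarrow> (real ^ 'n) set" where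
  "flat x l Z = {t. \<forall>z\<in>Z. x z \<bullet> t = l z}"

lemma flat_shift:
  assumes "t \<in> flat x l Z" "\<And>z. z \<in> Z \<Longrightarrow> v \<bullet> x z = 0"
  shows "t + s *\<^sub>R v \<in> flat x l Z"
  using assms by (auto simp: flat_def inner_add_right inner_commute)

text \<open>The direction \<open>v\<close> is tangent to the flat, so derivatives along it depend
  only on the restriction to the flat.\<close>

lemma pdiff_vanish_on_flat:
  assumes "\<And>t. t \<in> flat x l Z \<Longrightarrow> peval f t = 0" "\<And>z. z \<in> Z \<Longrightarrow> v \<bullet> x z = 0" "t \<in> flat x l Z"
  shows "peval (pdiff (lin_form v ^ k) f) t = 0"
  using assms(3)
proof (induction k arbitrary: t)
  case (Suc k)
  have "peval (pdiff (lin_form v ^ k) f) (t + s *\<^sub>R v) = 0" for s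
    using Suc.IH flat_shift[OF Suc.prems] assms(2) by blast
  then show ?case
    by (simp add: pdiff_mult peval_pdiff_eq_0)
qed (simp add: assms)

lemma pdiff_cong_on_flat:
  assumes "\<And>t. t \<in> flat x l Z \<Longrightarrow> peval f t = peval g t" "\<And>z. z \<in> Z \<Longrightarrow> v \<bullet> x z = 0" "t \<in> flat x l Z"
  shows "peval (pdiff (lin_form v ^ k) f) t = peval (pdiff (lin_form v ^ k) g) t"
  using pdiff_vanish_on_flat[of x l Z "f - g" v t k] assms by simp

text \<open>The higher product rule stops after two terms because the second derivative of
  \<open>q\<close> along \<open>v\<close> is zero.\<close>

lemma pdiff_power_mult:
  assumes "pdiff (lin_form v) q = Poly_Mapping.single 0 c"
  shows "pdiff (lin_form v ^ Suc k) (q * h)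
      = q * pdiff (lin_form v ^ Suc k) h + cscale (of_nat (Suc k) * c) (pdiff (lin_form v ^ k) h)"
proof (induction k)
  case 0
  show ?case by (simp add: pdiff_lin_form_mult assms cscale_def)
next
  case (Suc k)
  have *: "pdiff (lin_form v ^ Suc (Suc k)) g = pdiff (lin_form v) (pdiff (lin_form v ^ Suc k) g)" for g
    by (simp add: pdiff_mult)
  have **: "cscale c A + cscale (of_nat (Suc k) * c) A = cscale (of_nat (Suc (Suc k)) * c) A" for A
    by (simp add: algebra_simps flip: cpoly.scale_left_distrib)
  show ?case
    unfolding *[of "q * h"] Suc pdiff_add_right pdiff_lin_form_mult assms pdiff_cscale_right
    using **[of "pdiff (lin_form v ^ Suc k) h"]
    by (simp add: pdiff_mult distrib_right ac_simps flip: cscale_def)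
qed

text \<open>A factor \<open>var i\<close> raises the number of derivatives needed by at most
  one.\<close>

lemma pdiff_nilpotent: "\<exists>k. pdiff (lin_form v ^ k) f = 0"
proof (induction f rule: cpoly_induct)
  case (const c)
  then show ?case by (intro exI[of _ 1]) simp
next
  case (add p q)
  then obtain j k where "pdiff (lin_form v ^ j) p = 0" "pdiff (lin_form v ^ k) q = 0" by auto
  then have "pdiff (lin_form v ^ (j + k)) (p + q) = 0"
    by (simp add: power_add pdiff_mult) (metis pdiff_commute pdiff_zero_right add_0)
  then show ?case ..
next
  case (var i p)
  then obtain k where "pdiff (lin_form v ^ k) p = 0" by auto
  then have "pdiff (lin_form v ^ Suc k) (var i * p) = 0"
    by (subst pdiff_power_mult[OF pdiff_lin_var]) (simp add: pdiff_mult)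
  then show ?case ..
qed

text \<open>On the line through \<open>t\<close> in direction \<open>u\<close>, which stays in the
  flat, the linear factor has a single zero. If \<open>g\<close> were nonzero at \<open>t\<close>,
  it would be nonzero nearby by continuity, and the product would be nonzero at some nearby
  point.\<close>

lemma cancel_linear_on_flat:
  assumes u: "x y \<bullet> u \<noteq> 0" "\<And>z. z \<in> Z \<Longrightarrow> u \<bullet> x z = 0"
    and 0: "\<And>t. t \<in> flat x l Z \<Longrightarrow> complex_of_real (x y \<bullet> t - c) * peval g t = 0"
    and t: "t \<in> flat x l Z"
  shows "peval g t = 0"
proof (rule ccontr)
  assume "peval g t \<noteq> 0"
  have "continuous (at 0) (\<lambda>s. peval g (t + s *\<^sub>R u))"
    by (rule has_vector_derivative_continuous[OF has_vector_derivative_peval])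
  then have "((\<lambda>s. peval g (t + s *\<^sub>R u)) \<longlongrightarrow> peval g t) (at 0)"
    by (simp add: isCont_def)
  then have "\<forall>\<^sub>F s in at 0. peval g (t + s *\<^sub>R u) \<noteq> 0"
    using \<open>peval g t \<noteq> 0\<close> tendsto_imp_eventually_ne by blast
  moreover have "\<forall>\<^sub>F s in at (0::real). s \<noteq> (c - x y \<bullet> t) / (x y \<bullet> u)"
    by (metis eventually_at_filter eventually_neq_at_within)
  ultimately have "\<forall>\<^sub>F s in at (0::real). False"
  proof eventually_elim
    case (elim s)
    then have "complex_of_real (x y \<bullet> (t + s *\<^sub>R u) - c) = 0"
      using 0[OF flat_shift[OF t u(2)], of s] by simp
    then have "x y \<bullet> t + s * (x y \<bullet> u) - c = 0"
      by (metis inner_add_right inner_scaleR_right of_real_eq_0_iff)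
    then have "s = (c - x y \<bullet> t) / (x y \<bullet> u)" using u(1) by (simp add: field_simps)
    then show False using elim by simp
  qed
  then show False by (simp add: trivial_limit_at)
qed

text \<open>Dividing by \<open>p\<^sub>y - c\<close> lowers the degree in the direction \<open>v\<close> by one, unless \<open>v\<close> is orthogonal
  to \<open>y\<close>.\<close>

lemma direction_degree_divide:
  assumes u: "x y \<bullet> u \<noteq> 0" "\<And>z. z \<in> Z \<Longrightarrow> u \<bullet> x z = 0"
    and v: "\<And>z. z \<in> Z \<Longrightarrow> v \<bullet> x z = 0"
    and f: "\<And>t. t \<in> flat x l Z \<Longrightarrow> peval f t = complex_of_real (x y \<bullet> t - c) * peval h t"
    and m: "\<And>t. t \<in> flat x l Z \<Longrightarrow> peval (pdiff (lin_form v ^ m) f) t = 0"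
    and t: "t \<in> flat x l Z"
  shows "peval (pdiff (lin_form v ^ (if v \<bullet> x y = 0 then m else m - 1)) h) t = 0"
proof -
  define q where "q = lin_form (x y) - Poly_Mapping.single 0 (complex_of_real c)"
  have q: "pdiff (lin_form v) q = Poly_Mapping.single 0 (complex_of_real (v \<bullet> x y))"
    by (simp add: q_def pdiff_lin_lin)
  have ev_q: "peval q t = complex_of_real (x y \<bullet> t - c)" for t
    by (simp add: q_def)
  \<comment> \<open>On the flat \<open>f\<close> and \<open>q * h\<close> agree, so the bound
    carries over to \<open>q * h\<close> and to all higher orders.\<close>
  have D: "peval (pdiff (lin_form v ^ k) (q * h)) t = 0" if "k \<ge> m" "t \<in> flat x l Z" for k t
  proof -
    obtain d where d: "k = d + m" using \<open>k \<ge> m\<close> by (metis add.commute le_Suc_ex)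
    have "peval (pdiff (lin_form v ^ m) (q * h)) t = 0" if "t \<in> flat x l Z" for t
      using pdiff_cong_on_flat[of x l Z f "q * h" v t m] f m v that by (simp add: ev_q)
    then show ?thesis
      using pdiff_vanish_on_flat[of x l Z "pdiff (lin_form v ^ m) (q * h)" v t d] v that
      by (simp add: d power_add pdiff_mult)
  qed
  have cancel: "peval (pdiff (lin_form v ^ k) h) t = 0"
    if "\<And>t. t \<in> flat x l Z \<Longrightarrow> peval (q * pdiff (lin_form v ^ k) h) t = 0" "t \<in> flat x l Z" for k t
    using cancel_linear_on_flat[of x y u Z l c "pdiff (lin_form v ^ k) h" t] u that by (simp add: ev_q)
  show ?thesis
  proof (cases "v \<bullet> x y = 0 \<or> m = 0")
    case True
    have "peval (q * pdiff (lin_form v ^ m) h) t = 0" if "t \<in> flat x l Z" for t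
    proof (cases m)
      case (Suc k)
      then show ?thesis
        using D[OF _ that, of m] True q pdiff_power_mult[of v q 0 k h] by simp
    qed (use D[OF _ that, of 0] in simp)
    then have "peval (pdiff (lin_form v ^ m) h) t = 0" by (rule cancel[OF _ t])
    then show ?thesis using True by auto
  next
    case False
    define K where "K k \<longleftrightarrow> (\<forall>t\<in>flat x l Z. peval (pdiff (lin_form v ^ k) h) t = 0)" for k
    \<comment> \<open>If this least order \<open>k\<close> were at least \<open>m\<close>, the
      two-term product rule at order \<open>k\<close> would leave only a nonzero multiple of the
      derivative of order \<open>k - 1\<close> of \<open>h\<close>, contradicting
      minimality.\<close>
    define k where "k = (LEAST k. K k)"
    obtain k0 where "pdiff (lin_form v ^ k0) h = 0" using pdiff_nilpotent by blast
    then have "K k0" by (simp add: K_def)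
    then have Kk: "K k" and least: "\<And>j. K j \<Longrightarrow> k \<le> j"
      unfolding k_def by (auto intro: LeastI Least_le)
    have "k < m"
    proof (rule ccontr)
      assume "\<not> k < m"
      with False obtain j where j: "k = Suc j" "k \<ge> m" by (cases k) auto
      have "K j"
        unfolding K_def
      proof
        fix t assume t: "t \<in> flat x l Z"
        have "complex_of_real (v \<bullet> x y) \<noteq> 0" using False by simp
        then show "peval (pdiff (lin_form v ^ j) h) t = 0"
          using D[OF j(2) t] Kk t unfolding j(1) pdiff_power_mult[OF q] K_def
          by (simp del: of_nat_Suc power_Suc)
      qed
      then show False using least[of j] j by simp
    qed
    then obtain d where "m - 1 = d + k" by (metis Suc_pred' add.commute less_Suc_eq_le less_nat_zero_code neq0_conv le_Suc_ex)
    then show ?thesis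
      using pdiff_vanish_on_flat[of x l Z "pdiff (lin_form v ^ k) h" v t d] Kk v t False
      by (simp add: K_def power_add pdiff_mult)
  qed
qed

section \<open>Division by an affine linear form\<close>

text \<open>If \<open>y \<bullet> u = 1\<close>, the shifted point is the projection of
  \<open>t\<close> along \<open>u\<close> onto the hyperplane \<open>y \<bullet> t = c\<close>. The
  identity itself holds for every \<open>u\<close>, by induction on the polynomial.\<close>

lemma linear_factor:
  "\<exists>h. \<forall>t. peval f t - peval f (t - (y \<bullet> t - c) *\<^sub>R u) = complex_of_real (y \<bullet> t - c) * peval h t"
proof (induction f rule: cpoly_induct)
  case (const c)
  show ?case by (intro exI[of _ 0]) simp
next
  case (add p q)
  then obtain h h' where
    "\<forall>t. peval p t - peval p (t - (y \<bullet> t - c) *\<^sub>R u) = complex_of_real (y \<bullet> t - c) * peval h t"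
    "\<forall>t. peval q t - peval q (t - (y \<bullet> t - c) *\<^sub>R u) = complex_of_real (y \<bullet> t - c) * peval h' t"
    by blast
  then show ?case
    by (intro exI[of _ "h + h'"]) (metis (no_types, lifting) add_diff_add distrib_left peval_add)
next
  case (var i p)
  then obtain h where h:
    "peval p t - peval p (t - (y \<bullet> t - c) *\<^sub>R u) = complex_of_real (y \<bullet> t - c) * peval h t" for t
    by blast
  \<comment> \<open>\<open>T\<close> evaluates to the \<open>i\<close>-th coordinate of the shifted
    point.\<close>
  define T where "T = var i - cscale (complex_of_real (u $ i)) (lin_form y - Poly_Mapping.single 0 (complex_of_real c))"
  have "peval (var i * p) t - peval (var i * p) (t - (y \<bullet> t - c) *\<^sub>R u)
      = complex_of_real (y \<bullet> t - c) * peval (cscale (complex_of_real (u $ i)) p + T * h) t" for t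
  proof -
    define L where "L = complex_of_real (y \<bullet> t - c)"
    have T: "peval T t = complex_of_real (t $ i) - L * complex_of_real (u $ i)"
      by (simp add: T_def L_def)
    have p': "peval p (t - (y \<bullet> t - c) *\<^sub>R u) = peval p t - L * peval h t"
      using h[of t] by (simp add: L_def algebra_simps)
    have i: "complex_of_real ((t - (y \<bullet> t - c) *\<^sub>R u) $ i) = complex_of_real (t $ i) - L * complex_of_real (u $ i)"
      by (simp add: L_def)
    show ?thesis
      unfolding peval_mult peval_add peval_var peval_cscale i T p' L_def[symmetric]
      by (simp add: algebra_simps)
  qed
  then show ?case by blast
qed

text \<open>The projection along \<open>u\<close> maps the flat of \<open>Z\<close> into the flat of
  \<open>insert y Z\<close>, where \<open>f\<close> vanishes, so the subtracted term in the
  preceding identity disappears.\<close>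

lemma divide_on_flat:
  assumes u: "x y \<bullet> u = 1" "\<And>z. z \<in> Z \<Longrightarrow> u \<bullet> x z = 0"
    and f: "\<And>t. t \<in> flat x l (insert y Z) \<Longrightarrow> peval f t = 0"
  obtains h where "\<And>t. t \<in> flat x l Z \<Longrightarrow> peval f t = complex_of_real (x y \<bullet> t - l y) * peval h t"
proof -
  obtain h where h: "\<And>t. peval f t - peval f (t - (x y \<bullet> t - l y) *\<^sub>R u) = complex_of_real (x y \<bullet> t - l y) * peval h t"
    using linear_factor[of f "x y" "l y" u] by blast
  have "t - (x y \<bullet> t - l y) *\<^sub>R u \<in> flat x l (insert y Z)" if "t \<in> flat x l Z" for t
    using that u by (auto simp: flat_def inner_diff_right inner_commute)
  with h f show thesis by (metis diff_zero that)
qed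

section \<open>The pairing and double annihilators\<close>

lemma ffact_vec_self_neq_0: "ffact_vec m m \<noteq> 0"
  by (auto simp: ffact_vec_def)

lemma peval_mderiv_0: "peval (mderiv m f) 0 = Poly_Mapping.lookup f m * of_nat (ffact_vec m m)"
proof (induction f rule: monom_induct)
  case (1 k c)
  \<comment> \<open>At the origin a monomial other than \<open>m\<close> contributes nothing: either
    a variable survives the derivative, or a falling factorial is zero.\<close>
  have *: "(\<Prod>i\<in>UNIV. complex_of_real ((0 :: real ^ 'a) $ i) ^ Poly_Mapping.lookup (k - m) i) * of_nat (ffact_vec k m) = 0"
    if "k \<noteq> m"
  proof (cases "\<exists>i. Poly_Mapping.lookup m i < Poly_Mapping.lookup k i")
    case True
    then show ?thesis by (auto simp: lookup_minus)
  next
    case False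
    with that obtain i where "Poly_Mapping.lookup k i < Poly_Mapping.lookup m i"
      by (metis linorder_neqE_nat poly_mapping_eqI)
    then have "ffact_vec k m = 0"
      unfolding ffact_vec_def by (auto intro!: bexI[of _ "Poly_Mapping.lookup k i"])
    then show ?thesis by simp
  qed
  show ?case
  proof (cases "k = m")
    case False
    then show ?thesis using *[OF False]
      by (simp only: mderiv_single peval_single lookup_single) (simp add: mult.assoc mult.commute)
  qed (simp add: mderiv_single)
next
  case (2 p q)
  then show ?case by (simp add: lookup_add algebra_simps)
qed

lemma pairing_add_left [simp]: "pairing (p + q) f = pairing p f + pairing q f"
  by (simp add: pairing_def)

lemma pairing_add_right [simp]: "pairing p (f + g) = pairing p f + pairing p g"
  by (simp add: pairing_def)

lemma pairing_cscale_left [simp]: "pairing (cscale c p) f = c * pairing p f"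
  by (simp add: pairing_def)

lemma pairing_cscale_right [simp]: "pairing p (cscale c f) = c * pairing p f"
  by (simp add: pairing_def)

lemma pairing_zero [simp]: "pairing 0 f = 0" "pairing p 0 = 0"
  by (simp_all add: pairing_def)

lemma pairing_diff [simp]:
  "pairing (p - q) f = pairing p f - pairing q f" "pairing p (f - g) = pairing p f - pairing p g"
  by (simp_all add: pairing_def)

lemma pairing_sum_left [simp]: "pairing (\<Sum>i\<in>K. p i) f = (\<Sum>i\<in>K. pairing (p i) f)"
  by (simp add: pairing_def)

lemma pairing_sum_right [simp]: "pairing p (\<Sum>i\<in>K. f i) = (\<Sum>i\<in>K. pairing p (f i))"
  by (simp add: pairing_def)

lemma pairing_mult: "pairing (p * q) f = pairing p (pdiff q f)"
  by (simp add: pairing_def pdiff_mult)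

lemma pairing_single:
  "pairing (Poly_Mapping.single m c) f = c * Poly_Mapping.lookup f m * of_nat (ffact_vec m m)"
  by (simp add: pairing_def pdiff_single peval_mderiv_0)

text \<open>Monomials are orthogonal with the weights \<open>ffact_vec m m\<close>, so the form is
  diagonal.\<close>

lemma pairing_commute: "pairing p f = pairing f p"
proof (induction p rule: monom_induct)
  case (1 m c)
  show ?case
    by (induction f rule: monom_induct)
      (auto simp: pairing_single lookup_add lookup_single when_def algebra_simps)
qed simp

lemma pairing_eq_0_imp_eq_0:
  assumes "\<And>s. pairing s f = 0"
  shows "f = 0"
proof (rule poly_mapping_eqI)
  fix m
  show "Poly_Mapping.lookup f m = Poly_Mapping.lookup 0 m"
    using assms[of "Poly_Mapping.single m 1"] ffact_vec_self_neq_0[of m] by (simp add: pairing_single)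
qed

lemma lin_form_axis: "lin_form (axis i 1) = var i"
  by (simp add: lin_form_def axis_def if_distrib[of complex_of_real] if_distrib[of "\<lambda>c. cscale c _"] cong: if_cong)

lemma peval_pdiff_vanish:
  assumes "\<And>t. peval f t = 0"
  shows "peval (pdiff q f) t = 0"
  by (induction q arbitrary: t rule: cpoly_induct)
    (auto simp: assms pdiff_mult peval_pdiff_eq_0 simp flip: lin_form_axis)

text \<open>A polynomial that vanishes at all real points has only zero derivatives at the origin,
  and these determine its coefficients.\<close>

lemma peval_eq_0_imp_eq_0:
  assumes "\<And>t. peval f t = 0"
  shows "f = 0"
  by (rule pairing_eq_0_imp_eq_0) (simp add: pairing_def peval_pdiff_vanish assms)

lemma peval_inject: "(\<And>t. peval f t = peval g t) \<Longrightarrow> f = g"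
  using peval_eq_0_imp_eq_0[of "f - g"] by simp

section \<open>Homogeneous components\<close>

definition mdeg :: "('n::finite \<Rightarrow>\<^sub>0 nat) \<Rightarrow> nat" where
  "mdeg m = (\<Sum>i\<in>UNIV. Poly_Mapping.lookup m i)"

lemma mdeg_add: "mdeg (m + k) = mdeg m + mdeg k"
  by (simp add: mdeg_def lookup_add sum.distrib)

lemma mdeg_0 [simp]: "mdeg 0 = 0"
  by (simp add: mdeg_def)

lemma mdeg_single [simp]: "mdeg (Poly_Mapping.single i k) = k"
  by (simp add: mdeg_def lookup_single when_def)

lemma finite_mdeg: "finite {m :: 'n::finite \<Rightarrow>\<^sub>0 nat. mdeg m = d}"
proof (rule finite_imageD)
  have "Poly_Mapping.lookup ` {m :: 'n \<Rightarrow>\<^sub>0 nat. mdeg m = d} \<subseteq> UNIV \<rightarrow>\<^sub>E {..d}"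
    unfolding mdeg_def by (auto intro: member_le_sum)
  then show "finite (Poly_Mapping.lookup ` {m :: 'n \<Rightarrow>\<^sub>0 nat. mdeg m = d})"
    by (rule finite_subset) (intro finite_PiE; simp)
qed (simp add: inj_on_def)

definition hom_part :: "nat \<Rightarrow> ('n::finite) cpoly \<Rightarrow> 'n cpoly" where
  "hom_part d p = (\<Sum>m\<in>{m. mdeg m = d}. Poly_Mapping.single m (Poly_Mapping.lookup p m))"

lemma lookup_hom_part: "Poly_Mapping.lookup (hom_part d p) m = (if mdeg m = d then Poly_Mapping.lookup p m else 0)"
  by (simp add: hom_part_def lookup_sum lookup_single when_def finite_mdeg sum.delta)

lemma hom_part_add [simp]: "hom_part d (p + q) = hom_part d p + hom_part d q"
  by (rule poly_mapping_eqI) (simp add: lookup_hom_part lookup_add)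

lemma hom_part_zero [simp]: "hom_part d 0 = 0"
  by (rule poly_mapping_eqI) (simp add: lookup_hom_part)

lemma hom_part_cscale [simp]: "hom_part d (cscale c p) = cscale c (hom_part d p)"
  by (rule poly_mapping_eqI) (simp add: lookup_hom_part)

lemma hom_part_single:
  "hom_part d (Poly_Mapping.single m c) = (if mdeg m = d then Poly_Mapping.single m c else 0)"
  by (rule poly_mapping_eqI) (auto simp: lookup_hom_part lookup_single when_def)

lemma hom_part_eq: "homog d p \<Longrightarrow> hom_part d p = p"
  by (rule poly_mapping_eqI) (auto simp: lookup_hom_part homog_def mdeg_def in_keys_iff)

lemma hom_part_other: "homog d p \<Longrightarrow> e \<noteq> d \<Longrightarrow> hom_part e p = 0"
  by (rule poly_mapping_eqI) (auto simp: lookup_hom_part homog_def mdeg_def in_keys_iff)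

lemma homog_hom_part: "homog d (hom_part d p)"
  by (auto simp: homog_def lookup_hom_part in_keys_iff mdeg_def split: if_splits)

lemma homog_iff: "homog d p \<longleftrightarrow> hom_part d p = p"
  by (metis hom_part_eq homog_hom_part)

lemma hom_part_mult_single:
  "hom_part d (Poly_Mapping.single m c * q)
     = (if mdeg m \<le> d then Poly_Mapping.single m c * hom_part (d - mdeg m) q else 0)"
  by (induction q rule: monom_induct)
    (auto simp: mult_single hom_part_single mdeg_add distrib_left)

lemma sum_hom_part: "\<exists>N. \<forall>n\<ge>N. p = (\<Sum>d<n. hom_part d p)"
proof (intro exI allI impI poly_mapping_eqI)
  \<comment> \<open>The added \<open>0\<close> keeps the maximum defined for the zero
    polynomial.\<close>
  fix n m assume n: "Suc (Max (insert 0 (mdeg ` Poly_Mapping.keys p))) \<le> n"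
  have "mdeg m < n" if "Poly_Mapping.lookup p m \<noteq> 0"
  proof -
    have "mdeg m \<le> Max (insert 0 (mdeg ` Poly_Mapping.keys p))"
      using that by (intro Max_ge) (auto simp: in_keys_iff)
    then show ?thesis using n by simp
  qed
  then show "Poly_Mapping.lookup p m = Poly_Mapping.lookup (\<Sum>d<n. hom_part d p) m"
    by (auto simp: lookup_sum lookup_hom_part)
qed

lemma homog_mult: "homog d p \<Longrightarrow> homog e q \<Longrightarrow> homog (d + e) (p * q)"
  unfolding homog_def using keys_mult[of p q] by (fastforce simp: lookup_add sum.distrib)

lemma homog_one: "homog 0 1"
  by (simp add: homog_def)

lemma homog_add: "homog d p \<Longrightarrow> homog d q \<Longrightarrow> homog d (p + q)"
  by (simp add: homog_iff)

lemma homog_zero: "homog d 0"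
  by (simp add: homog_iff)

lemma homog_cscale: "homog d p \<Longrightarrow> homog d (cscale c p)"
  by (simp add: homog_iff)

lemma homog_sum: "(\<And>i. i \<in> K \<Longrightarrow> homog d (p i)) \<Longrightarrow> homog d (\<Sum>i\<in>K. p i)"
  by (induction K rule: infinite_finite_induct) (auto intro: homog_add homog_zero)

lemma homog_lin_form: "homog 1 (lin_form y)"
  unfolding lin_form_def
  by (intro homog_sum homog_cscale) (simp add: homog_def var_def lookup_single when_def)

lemma homog_lin_form_power: "homog k (lin_form y ^ k)"
  by (induction k) (use homog_mult[OF homog_lin_form] homog_one in auto)

lemma homog_prod_form: "finite Y \<Longrightarrow> homog (card Y) (prod_form x Y)"
  unfolding prod_form_def
  by (induction Y rule: finite_induct) (use homog_mult[OF homog_lin_form] homog_one in auto)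

lemma peval_homog_scale:
  assumes "homog d p"
  shows "peval p (s *\<^sub>R t) = complex_of_real s ^ d * peval p t"
proof -
  have "(\<Prod>i\<in>UNIV. complex_of_real ((s *\<^sub>R t) $ i) ^ Poly_Mapping.lookup m i)
      = complex_of_real s ^ d * (\<Prod>i\<in>UNIV. complex_of_real (t $ i) ^ Poly_Mapping.lookup m i)"
    if "m \<in> Poly_Mapping.keys p" for m
    using assms that by (auto simp: homog_def power_mult_distrib prod.distrib power_sum)
  then show ?thesis
    by (auto simp: peval_def sum_distrib_left mult.left_commute intro!: sum.cong)
qed

section \<open>Kernels of homogeneous ideals\<close>

lemma ideal_span_mult: "q \<in> ideal.span G \<Longrightarrow> s * q \<in> ideal.span G"
  by (rule ideal.span_scale)

lemma subspace_ideal: "cpoly.subspace (ideal.span G)"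
  by (rule cpoly.subspaceI)
    (auto simp: cscale_def ideal.span_zero intro: ideal.span_add ideal_span_mult)

lemma pker_span_iff: "f \<in> pker (ideal.span G) \<longleftrightarrow> (\<forall>q\<in>G. pdiff q f = 0)"
proof
  assume *: "\<forall>q\<in>G. pdiff q f = 0"
  have "pdiff q f = 0" if "q \<in> ideal.span G" for q
    using that by (induction rule: ideal.span_induct_alt) (auto simp: pdiff_mult *)
  then show "f \<in> pker (ideal.span G)" by (simp add: pker_def)
qed (auto simp: pker_def ideal.span_base)

text \<open>The derivatives of \<open>pdiff q f\<close> at the origin are pairings of
  \<open>f\<close> with multiples of \<open>q\<close>, and these multiples stay in the
  ideal.\<close>

lemma pker_span_iff_pairing: "f \<in> pker (ideal.span G) \<longleftrightarrow> (\<forall>q\<in>ideal.span G. pairing q f = 0)"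
proof
  assume *: "\<forall>q\<in>ideal.span G. pairing q f = 0"
  have "pdiff q f = 0" if "q \<in> G" for q
  proof (rule pairing_eq_0_imp_eq_0)
    show "pairing s (pdiff q f) = 0" for s
      using * that by (simp add: ideal.span_base ideal_span_mult flip: pairing_mult)
  qed
  then show "f \<in> pker (ideal.span G)" by (simp add: pker_span_iff)
qed (auto simp: pker_def pairing_def)

lemma subspace_pker: "cpoly.subspace (pker I)"
  by (rule cpoly.subspaceI) (auto simp: pker_def)

lemma hom_part_ideal:
  assumes "\<And>g. g \<in> G \<Longrightarrow> \<exists>d. homog d g" and "q \<in> ideal.span G"
  shows "hom_part d q \<in> ideal.span G"
  using assms(2)
proof (induction arbitrary: d rule: ideal.span_induct_alt)
  case base
  show ?case by (simp add: ideal.span_zero)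
next
  case (step r g p)
  have "hom_part d (r * g) \<in> ideal.span G"
  proof (induction r rule: monom_induct)
    case (1 m c)
    have "hom_part e g \<in> ideal.span G" for e
      using assms(1)[OF step.hyps(1)] step.hyps(1)
      by (metis hom_part_eq hom_part_other ideal.span_base ideal.span_zero)
    then show ?case by (simp add: hom_part_mult_single ideal_span_mult ideal.span_zero)
  next
    case (2 p q)
    then show ?case by (simp add: distrib_right ideal.span_add)
  qed
  then show ?case using step.IH by (simp add: ideal.span_add)
qed

interpretation cpoly_functional: vector_space_pair "cscale :: complex \<Rightarrow> 'n cpoly \<Rightarrow> 'n cpoly" "(*) :: complex \<Rightarrow> complex \<Rightarrow> complex"
  by unfold_locales (simp_all add: algebra_simps)

text \<open>A basis of \<open>V\<close> stays independent after adding \<open>q\<close>, so values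
  on it can be prescribed freely.\<close>

lemma separating_functional:
  assumes V: "cpoly.subspace V" and "q \<notin> V"
  obtains \<phi> where "Vector_Spaces.linear cscale (*) \<phi>" "\<And>v. v \<in> V \<Longrightarrow> \<phi> v = 0" "\<phi> q = 1"
proof -
  obtain B where B: "B \<subseteq> V" "cpoly.independent B" "V \<subseteq> cpoly.span B"
    by (rule cpoly.basis_exists)
  then have span_B: "cpoly.span B = V"
    using V by (metis cpoly.span_subspace)
  then have "cpoly.independent (insert q B)"
    using B \<open>q \<notin> V\<close> by (simp add: cpoly.independent_insert)
  from cpoly_functional.linear_independent_extend[OF this, of "\<lambda>b. if b = q then 1 else 0"]
  obtain \<phi> where \<phi>: "Vector_Spaces.linear cscale (*) \<phi>" "\<forall>b\<in>insert q B. \<phi> b = (if b = q then 1 else 0)" by blast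
  have "\<phi> b = 0" if "b \<in> B" for b
    using \<phi>(2) that B(1) \<open>q \<notin> V\<close> by auto
  then have "\<phi> v = 0" if "v \<in> V" for v
    using cpoly_functional.linear_eq_0_on_span[OF \<phi>(1), of B v] that B(3) by blast
  then show thesis using that \<phi> by simp
qed

text \<open>A functional on all polynomials need not come from a polynomial. Homogeneous generators
  allow a reduction to one degree \<open>d\<close>, whose component is finite-dimensional, and there
  a separating functional is the pairing with a polynomial.\<close>

lemma double_annihilator:
  assumes G: "\<And>g. g \<in> G \<Longrightarrow> \<exists>d. homog d g"
    and q: "\<And>f. f \<in> pker (ideal.span G) \<Longrightarrow> pairing q f = 0"
  shows "q \<in> ideal.span G"
proof (rule ccontr)
  assume "q \<notin> ideal.span G"
  obtain n where n: "q = (\<Sum>d<n. hom_part d q)" using sum_hom_part[of q] by blast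
  have "\<exists>d. hom_part d q \<notin> ideal.span G"
    using \<open>q \<notin> _\<close> by (metis (no_types, lifting) n ideal.span_sum)
  then obtain d where "hom_part d q \<notin> ideal.span G" by blast
  then obtain \<phi> where \<phi>: "Vector_Spaces.linear cscale (*) \<phi>" "\<And>v. v \<in> ideal.span G \<Longrightarrow> \<phi> v = 0" "\<phi> (hom_part d q) = 1"
    using separating_functional[OF subspace_ideal] by metis
  interpret \<phi>: Vector_Spaces.linear cscale "(*)" \<phi> by (fact \<phi>(1))
  \<comment> \<open>Dividing by the weight of the monomial turns the values of \<open>\<phi>\<close>
    into coefficients that reproduce them under the pairing.\<close>
  define f where "f = (\<Sum>m\<in>{m. mdeg m = d}. Poly_Mapping.single m (\<phi> (Poly_Mapping.single m 1) / of_nat (ffact_vec m m)))"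
  have lookup_f: "Poly_Mapping.lookup f k
      = (if mdeg k = d then \<phi> (Poly_Mapping.single k 1) / of_nat (ffact_vec k k) else 0)" for k
    unfolding f_def lookup_sum lookup_single when_def by (subst sum.delta) (auto simp: finite_mdeg)
  have pairing_f: "pairing g f = \<phi> (hom_part d g)" for g
  proof (induction g rule: monom_induct)
    case (1 m c)
    have "\<phi> (Poly_Mapping.single m c) = c * \<phi> (Poly_Mapping.single m 1)"
      using \<phi>.scale[of c "Poly_Mapping.single m 1"] by (simp add: cscale_single)
    then show ?case
      by (simp add: pairing_single lookup_f hom_part_single \<phi>.zero ffact_vec_self_neq_0)
  qed (simp add: \<phi>.add)
  have "f \<in> pker (ideal.span G)"
    by (simp add: pker_span_iff_pairing pairing_f \<phi>(2) hom_part_ideal G)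
  then have "pairing q f = 0" by (rule q)
  then show False using \<phi>(3) pairing_f by simp
qed

section \<open>Taylor components of exponentials\<close>

text \<open>The degree \<open>j\<close> part of the power series of the exponential with frequency
  \<open>a\<close>.\<close>

definition exp_part :: "real ^ 'n \<Rightarrow> nat \<Rightarrow> ('n::finite) cpoly" where
  "exp_part a j = cscale (1 / fact j) (lin_form a ^ j)"

lemma homog_exp_part: "homog j (exp_part a j)"
  by (simp add: exp_part_def homog_cscale homog_lin_form_power)

lemma pdiff_var_exp_part: "pdiff (var i) (exp_part a (Suc j)) = cscale (complex_of_real (a $ i)) (exp_part a j)"
proof -
  have "pdiff (lin_form v) (lin_form a ^ Suc j) = cscale (of_nat (Suc j) * complex_of_real (v \<bullet> a)) (lin_form a ^ j)" for v
  proof (induction j)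
    case 0
    then show ?case by (simp add: pdiff_lin_lin cscale_one_eq)
  next
    case (Suc j)
    have "pdiff (lin_form v) (lin_form a ^ Suc (Suc j))
        = cscale (complex_of_real (v \<bullet> a)) (lin_form a ^ Suc j)
          + cscale (of_nat (Suc j) * complex_of_real (v \<bullet> a)) (lin_form a ^ Suc j)"
      unfolding power_Suc[of _ "Suc j"] pdiff_lin_form_mult Suc pdiff_lin_lin
      by (simp add: cscale_mult_right flip: cscale_def)
    also have "\<dots> = cscale (of_nat (Suc (Suc j)) * complex_of_real (v \<bullet> a)) (lin_form a ^ Suc j)"
      unfolding cpoly.scale_left_distrib[symmetric] by (simp add: algebra_simps)
    finally show ?case .
  qed
  from this[of "axis i 1"] show ?thesis
    by (simp add: exp_part_def lin_form_axis inner_axis' field_simps del: power_Suc of_nat_Suc)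
qed

text \<open>Pairing with the exponential of frequency \<open>a\<close> is evaluation at
  \<open>a\<close>. Each variable of a monomial differentiates the exponential once and yields a
  factor \<open>a $ i\<close>.\<close>

lemma pairing_exp_part: "pairing p (exp_part a j) = peval (hom_part j p) a"
proof (induction p rule: monom_induct)
  case (1 m c)
  show ?case
  proof (induction "mdeg m" arbitrary: m j)
    case 0
    then have "m = 0" by (auto simp: mdeg_def intro!: poly_mapping_eqI)
    then show ?case
      by (cases j) (auto simp: pairing_def hom_part_single exp_part_def)
  next
    case (Suc d)
    then obtain i where i: "Poly_Mapping.lookup m i \<noteq> 0"
      by (metis nat.distinct(1) sum.neutral mdeg_def)
    define m' where "m' = m - Poly_Mapping.single i 1"
    have m: "m = Poly_Mapping.single i 1 + m'"
      using i by (auto intro!: poly_mapping_eqI simp: m'_def lookup_add lookup_minus lookup_single when_def)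
    have d: "d = mdeg m'" using Suc(2) by (simp add: m mdeg_add)
    have eq: "Poly_Mapping.single m c = Poly_Mapping.single m' c * var i"
      by (simp add: var_def mult_single m add.commute)
    show ?case
    proof (cases j)
      case 0
      have "pdiff (var i) (exp_part a 0) = 0"
        using pdiff_var_const[of i 1] by (simp add: exp_part_def)
      then show ?thesis
        by (simp add: 0 eq pairing_mult) (simp add: m mdeg_add hom_part_single flip: eq)
    next
      case (Suc j')
      have "pairing (Poly_Mapping.single m c) (exp_part a j)
          = complex_of_real (a $ i) * peval (hom_part j' (Poly_Mapping.single m' c)) a"
        unfolding eq pairing_mult Suc pdiff_var_exp_part by (simp add: \<open>d = _ \<Longrightarrow> _\<close>[OF d] Suc(1))
      also have "\<dots> = peval (hom_part j (Poly_Mapping.single m c)) a"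
      proof -
        have "peval (Poly_Mapping.single m c) a = complex_of_real (a $ i) * peval (Poly_Mapping.single m' c) a"
          by (simp add: eq)
        then show ?thesis by (simp add: hom_part_single Suc) (simp add: m mdeg_add)
      qed
      finally show ?thesis .
    qed
  qed
qed simp

section \<open>Finitely many functionals and the least space\<close>

text \<open>Evaluation at points and pairing with fixed polynomials call for the same dimension
  counts, so these are carried out once.\<close>

locale linear_functionals =
  fixes \<phi> :: "'n cpoly \<Rightarrow> 'i \<Rightarrow> complex"
  assumes add: "\<phi> (f + g) s = \<phi> f s + \<phi> g s"
    and scale: "\<phi> (cscale c f) s = c * \<phi> f s"
begin

lemma zero: "\<phi> 0 s = 0"
  using scale[of 0 0 s] by simp

lemma diff: "\<phi> (f - g) s = \<phi> f s - \<phi> g s"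
  using add[of "f - g" g s] by simp

lemma sum: "\<phi> (\<Sum>i\<in>K. f i) s = (\<Sum>i\<in>K. \<phi> (f i) s)"
  by (induction K rule: infinite_finite_induct) (auto simp: add zero)

text \<open>The kernel of one functional has codimension at most one, so each functional costs at
  most one spanning vector.\<close>

lemma small_spanning_set:
  assumes "finite S" "cpoly.subspace V" "\<And>f. f \<in> V \<Longrightarrow> (\<And>s. s \<in> S \<Longrightarrow> \<phi> f s = 0) \<Longrightarrow> f = 0"
  shows "\<exists>T. finite T \<and> card T \<le> card S \<and> V \<subseteq> cpoly.span T"
  using assms
proof (induction S arbitrary: V rule: finite_induct)
  case empty
  then have "V \<subseteq> {0}" by auto
  then show ?case by (intro exI[of _ "{}"]) auto
next
  case (insert s S)
  define V' where "V' = {f \<in> V. \<phi> f s = 0}"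
  have V': "cpoly.subspace V'"
    using insert.prems(1) by (auto simp: V'_def cpoly.subspace_def add scale zero)
  have "\<exists>T. finite T \<and> card T \<le> card S \<and> V' \<subseteq> cpoly.span T"
    using insert.prems(2) by (intro insert.IH V') (auto simp: V'_def)
  then obtain T where T: "finite T" "card T \<le> card S" "V' \<subseteq> cpoly.span T" by blast
  show ?case
  proof (cases "V \<subseteq> V'")
    case True
    then show ?thesis using T insert.hyps by (intro exI[of _ T]) auto
  next
    case False
    then obtain f0 where f0: "f0 \<in> V" "\<phi> f0 s \<noteq> 0" by (auto simp: V'_def)
    have "f \<in> cpoly.span (insert f0 T)" if "f \<in> V" for f
    proof -
      have "f - cscale (\<phi> f s / \<phi> f0 s) f0 \<in> V'"
        using that f0 insert.prems(1)
        by (auto simp: V'_def diff scale intro!: cpoly.subspace_diff cpoly.subspace_scale)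
      then show ?thesis
        unfolding cpoly.span_insert using T(3) by blast
    qed
    moreover have "card (insert f0 T) \<le> card (insert s S)"
      using T insert.hyps by (simp add: card_insert_if)
    ultimately show ?thesis using T(1) by (intro exI[of _ "insert f0 T"]) auto
  qed
qed

text \<open>Finite dimension is recorded separately because \<open>dim\<close> is 0 on spaces of
  infinite dimension.\<close>

lemma dim_le_card:
  assumes "finite S" "cpoly.subspace V" "\<And>f. f \<in> V \<Longrightarrow> (\<And>s. s \<in> S \<Longrightarrow> \<phi> f s = 0) \<Longrightarrow> f = 0"
  shows "fin_dim V" "cpoly.dim V \<le> card S"
proof -
  obtain T where T: "finite T" "card T \<le> card S" "V \<subseteq> cpoly.span T"
    using small_spanning_set[OF assms] by auto
  then show "fin_dim V" by (auto simp: fin_dim_def)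
  show "cpoly.dim V \<le> card S"
    using cpoly.dim_le_card[OF T(3,1)] T(2) by simp
qed

lemma surj_if_no_annihilator:
  assumes "finite S" "cpoly.subspace V"
    "\<And>c. (\<And>f. f \<in> V \<Longrightarrow> (\<Sum>s\<in>S. c s * \<phi> f s) = 0) \<Longrightarrow> \<forall>s\<in>S. c s = 0"
  shows "\<exists>f\<in>V. \<forall>s\<in>S. \<phi> f s = g s"
  using assms
proof (induction S arbitrary: V g rule: finite_induct)
  case empty
  then show ?case using cpoly.subspace_0 by auto
next
  case (insert s S)
  have "\<exists>f0\<in>V. \<phi> f0 s \<noteq> 0"
  proof (rule ccontr)
    assume "\<not> ?thesis"
    then have "(\<Sum>i\<in>insert s S. (if i = s then 1 else 0) * \<phi> f i) = 0" if "f \<in> V" for f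
      using that insert.hyps by (auto intro!: sum.neutral)
    then show False
      using insert.prems(2)[of "\<lambda>i. if i = s then 1 else 0"] by auto
  qed
  then obtain f1 where f1: "f1 \<in> V" "\<phi> f1 s \<noteq> 0" by blast
  define f0 where "f0 = cscale (1 / \<phi> f1 s) f1"
  have f0: "f0 \<in> V" "\<phi> f0 s = 1"
    using f1 insert.prems(1) by (auto simp: f0_def scale cpoly.subspace_scale)
  define V' where "V' = {f \<in> V. \<phi> f s = 0}"
  have V': "cpoly.subspace V'"
    using insert.prems(1) by (auto simp: V'_def cpoly.subspace_def add scale zero)
  have "\<forall>i\<in>S. c i = 0" if c: "\<And>f. f \<in> V' \<Longrightarrow> (\<Sum>i\<in>S. c i * \<phi> f i) = 0" for c
  proof -
    \<comment> \<open>The coefficient at \<open>s\<close> makes the extended combination vanish at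
      \<open>f0\<close>, which together with \<open>V'\<close> spans \<open>V\<close>.\<close>
    define c' where "c' = c(s := - (\<Sum>i\<in>S. c i * \<phi> f0 i))"
    have c': "(\<Sum>i\<in>S. c' i * \<phi> f i) = (\<Sum>i\<in>S. c i * \<phi> f i)" for f
      using insert.hyps by (intro sum.cong) (auto simp: c'_def)
    have "(\<Sum>i\<in>insert s S. c' i * \<phi> f i) = 0" if "f \<in> V" for f
    proof -
      have "f - cscale (\<phi> f s) f0 \<in> V'"
        using that f0 insert.prems(1)
        by (auto simp: V'_def diff scale intro!: cpoly.subspace_diff cpoly.subspace_scale)
      from c[OF this] have "(\<Sum>i\<in>S. c i * \<phi> f i) = \<phi> f s * (\<Sum>i\<in>S. c i * \<phi> f0 i)"
        by (simp add: diff scale right_diff_distrib sum_subtractf sum_distrib_left mult.left_commute)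
      moreover have "c' s = - (\<Sum>i\<in>S. c i * \<phi> f0 i)" by (simp add: c'_def)
      ultimately show ?thesis
        using insert.hyps by (simp add: c' mult.commute)
    qed
    then have "\<forall>i\<in>insert s S. c' i = 0" by (rule insert.prems(2))
    then show ?thesis using insert.hyps by (auto simp: c'_def split: if_splits)
  qed
  then obtain f' where f': "f' \<in> V'" "\<forall>i\<in>S. \<phi> f' i = g i - g s * \<phi> f0 i"
    using insert.IH[OF V', of "\<lambda>i. g i - g s * \<phi> f0 i"] by blast
  then have "f' + cscale (g s) f0 \<in> V" "\<forall>i\<in>insert s S. \<phi> (f' + cscale (g s) f0) i = g i"
    using f0 insert.prems(1)
    by (auto simp: V'_def add scale intro!: cpoly.subspace_add cpoly.subspace_scale)
  then show ?case by blast
qed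

text \<open>In a nontrivial relation, a functional with nonzero coefficient is determined by the
  others. These would then separate the points of \<open>V\<close>, and the dimension would be less
  than \<open>card S\<close>.\<close>

lemma surj_if_inj:
  assumes "finite S" "cpoly.subspace V" "\<And>f. f \<in> V \<Longrightarrow> (\<And>s. s \<in> S \<Longrightarrow> \<phi> f s = 0) \<Longrightarrow> f = 0"
    and dim: "card S \<le> cpoly.dim V"
  shows "\<exists>f\<in>V. \<forall>s\<in>S. \<phi> f s = g s"
proof (rule surj_if_no_annihilator[OF assms(1,2)])
  fix c assume c: "\<And>f. f \<in> V \<Longrightarrow> (\<Sum>s\<in>S. c s * \<phi> f s) = 0"
  show "\<forall>s\<in>S. c s = 0"
  proof (rule ccontr)
    assume "\<not> ?thesis"
    then obtain s where s: "s \<in> S" "c s \<noteq> 0" by blast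
    have "\<phi> f s = 0" if "f \<in> V" "\<And>i. i \<in> S - {s} \<Longrightarrow> \<phi> f i = 0" for f
    proof -
      have "(\<Sum>i\<in>S. c i * \<phi> f i) = c s * \<phi> f s"
        using s(1) \<open>finite S\<close> that(2) by (simp add: sum.remove)
      then show ?thesis using c[OF that(1)] s(2) by simp
    qed
    then have "cpoly.dim V \<le> card (S - {s})"
      using assms by (intro dim_le_card) auto
    moreover have "card (S - {s}) < card S"
      by (intro card_Diff1_less assms(1) s(1))
    ultimately show False using dim by simp
  qed
qed

text \<open>Preimages of the unit vectors are independent, and a nonzero element of the common
  kernel would extend them to a larger independent set.\<close>

lemma surj_dim:
  assumes S: "finite S" and V: "cpoly.subspace V" "fin_dim V"
    and surj: "\<And>g. \<exists>f\<in>V. \<forall>s\<in>S. \<phi> f s = g s"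
  shows "card S \<le> cpoly.dim V"
    and "\<And>k. cpoly.dim V = card S \<Longrightarrow> k \<in> V \<Longrightarrow> (\<And>s. s \<in> S \<Longrightarrow> \<phi> k s = 0) \<Longrightarrow> k = 0"
proof -
  have "\<exists>f. f \<in> V \<and> (\<forall>s\<in>S. \<phi> f s = (if s = i then 1 else 0))" for i
    using surj[of "\<lambda>s. if s = i then 1 else 0"] by blast
  then obtain e where e: "\<And>i. e i \<in> V" "\<And>i s. s \<in> S \<Longrightarrow> \<phi> (e i) s = (if s = i then 1 else 0)"
    by metis
  have inj: "inj_on e S"
    by (rule inj_onI) (metis e(2) zero_neq_one)
  have coord: "u (e s) = \<phi> f s" if "(\<Sum>v\<in>e ` S. cscale (u v) v) = f" "s \<in> S" for u f s
  proof -
    have "\<phi> f s = (\<Sum>i\<in>S. u (e i) * \<phi> (e i) s)"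
      using that by (simp add: sum.reindex[OF inj] sum scale flip: that(1))
    also have "\<dots> = (\<Sum>i\<in>S. if s = i then u (e i) else 0)"
      using that by (intro sum.cong) (auto simp: e(2))
    finally show ?thesis using that S by simp
  qed
  have ind: "cpoly.independent (e ` S)"
    unfolding cpoly.dependent_finite[OF finite_imageI[OF S]]
    using coord[where f = 0] by (auto simp: zero)
  obtain B where B: "B \<subseteq> V" "cpoly.independent B" "V \<subseteq> cpoly.span B" "card B = cpoly.dim V"
    by (rule cpoly.basis_exists)
  obtain T where T: "finite T" "V \<subseteq> cpoly.span T"
    using V(2) by (auto simp: fin_dim_def)
  have "finite B"
    using cpoly.independent_span_bound[OF T(1) B(2)] B(1) T(2) by auto
  have bound: "card E \<le> cpoly.dim V" if "cpoly.independent E" "E \<subseteq> V" for E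
    using cpoly.independent_span_bound[OF \<open>finite B\<close> that(1)] that(2) B(3,4) by auto
  show "card S \<le> cpoly.dim V"
    using bound[OF ind] e(1) by (auto simp: card_image[OF inj])
  fix k assume k: "cpoly.dim V = card S" "k \<in> V" "\<And>s. s \<in> S \<Longrightarrow> \<phi> k s = 0"
  show "k = 0"
  proof (rule ccontr)
    assume "k \<noteq> 0"
    have "k \<notin> cpoly.span (e ` S)"
    proof
      assume "k \<in> cpoly.span (e ` S)"
      then obtain u where u: "(\<Sum>v\<in>e ` S. cscale (u v) v) = k"
        unfolding cpoly.span_finite[OF finite_imageI[OF S]] by auto
      then have "u v = 0" if "v \<in> e ` S" for v
        using coord[OF u] k(3) that by auto
      then show False using u \<open>k \<noteq> 0\<close> by simp
    qed
    then have "cpoly.independent (insert k (e ` S))"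
      using ind by (simp add: cpoly.independent_insert)
    moreover have "card (insert k (e ` S)) = Suc (card S)"
      using \<open>k \<notin> _\<close> S by (subst card_insert_disjoint) (auto simp: card_image[OF inj] intro: cpoly.span_base)
    ultimately show False
      using bound[of "insert k (e ` S)"] k(1,2) e(1) by auto
  qed
qed

end

interpretation peval: linear_functionals peval
  by unfold_locales auto

interpretation pairing: linear_functionals pairing
  by unfold_locales auto

section \<open>Exponential sums and their least terms\<close>

definition exp_sum :: "(real ^ 'n) set \<Rightarrow> (real ^ 'n \<Rightarrow> complex) \<Rightarrow> nat \<Rightarrow> ('n::finite) cpoly" where
  "exp_sum \<sigma> c j = (\<Sum>a\<in>\<sigma>. cscale (c a) (exp_part a j))"

lemma homog_exp_sum: "homog j (exp_sum \<sigma> c j)"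
  by (auto simp: exp_sum_def intro!: homog_sum homog_cscale homog_exp_part)

lemma pairing_exp_sum: "pairing q (exp_sum \<sigma> c j) = (\<Sum>a\<in>\<sigma>. c a * peval (hom_part j q) a)"
  by (simp add: exp_sum_def pairing_exp_part)

lemma homog_expansion_exp_sum:
  fixes \<sigma> :: "(real ^ 'n::finite) set"
  shows "homog_expansion (\<lambda>t. \<Sum>a\<in>\<sigma>. c a * exp (complex_of_real (a \<bullet> t))) (exp_sum \<sigma> c)"
  unfolding homog_expansion_def
proof (intro conjI allI)
  fix t :: "real ^ 'n"
  have "(\<lambda>j. peval (exp_part a j) t) sums exp (complex_of_real (a \<bullet> t))" for a
    using exp_converges[of "complex_of_real (a \<bullet> t)"] by (simp add: exp_part_def scaleR_conv_of_real field_simps)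
  then show "(\<lambda>j. peval (exp_sum \<sigma> c j) t) sums (\<Sum>a\<in>\<sigma>. c a * exp (complex_of_real (a \<bullet> t)))"
    unfolding exp_sum_def peval_sum peval_cscale by (intro sums_sum sums_mult)
qed (fact homog_exp_sum)

text \<open>Once the lower coefficients are zero, division by \<open>s ^ n\<close> leaves a series
  that tends to \<open>a n\<close> as \<open>s\<close> tends to 0.\<close>

lemma real_powser_eq_0:
  fixes a :: "nat \<Rightarrow> real"
  assumes "\<And>s. (\<lambda>n. a n * s ^ n) sums 0"
  shows "a n = 0"
proof (induction n rule: less_induct)
  case (less n)
  have "(\<lambda>k. a (k + n) * s ^ k) sums 0" if "s \<noteq> 0" for s
  proof -
    have "(\<lambda>k. a (k + n) * s ^ (k + n)) sums 0"
      using assms[of s] less by (subst sums_iff_shift) simp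
    then have "(\<lambda>k. a (k + n) * s ^ (k + n) / s ^ n) sums (0 / s ^ n)"
      by (rule sums_divide)
    then show ?thesis using that by (simp add: power_add)
  qed
  then have "((\<lambda>_. 0) \<longlongrightarrow> a (0 + n)) (at (0::real))"
    by (intro powser_limit_0_strong[of 1]) auto
  then show ?case
    using tendsto_unique[of "at (0::real)" "\<lambda>_. 0" "a n" 0] by simp
qed

text \<open>On a line through the origin the components become the coefficients of a power series in
  one variable. Uniqueness identifies the expansion whose existence \<open>is_least\<close>
  asserts.\<close>

lemma homog_expansion_unique:
  assumes "homog_expansion f g" "homog_expansion f g'"
  shows "g = g'"
proof (intro ext peval_inject)
  fix j t
  define a where "a j = peval (g j) t - peval (g' j) t" for j
  have sums: "(\<lambda>j. a j * complex_of_real s ^ j) sums 0" for s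
  proof -
    have "(\<lambda>j. peval (g j) (s *\<^sub>R t) - peval (g' j) (s *\<^sub>R t)) sums (f (s *\<^sub>R t) - f (s *\<^sub>R t))"
      using assms by (intro sums_diff) (auto simp: homog_expansion_def)
    moreover have "peval (g j) (s *\<^sub>R t) - peval (g' j) (s *\<^sub>R t) = a j * complex_of_real s ^ j" for j
      using assms peval_homog_scale[of j _ s t] by (simp add: homog_expansion_def a_def algebra_simps)
    ultimately show ?thesis by simp
  qed
  have "Re (a j) = 0"
    by (rule real_powser_eq_0[of "\<lambda>j. Re (a j)"]) (use sums_Re[OF sums] in \<open>simp flip: of_real_power\<close>)
  moreover have "Im (a j) = 0"
    by (rule real_powser_eq_0[of "\<lambda>j. Im (a j)"]) (use sums_Im[OF sums] in \<open>simp flip: of_real_power\<close>)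
  ultimately show "peval (g j) t = peval (g' j) t"
    using complex_eqI[of "a j" 0] by (simp add: a_def)
qed

text \<open>The points are real, so monomials take real values at them and conjugation reaches only
  the coefficients \<open>c\<close>.\<close>

lemma lookup_exp_sum_cnj:
  "Poly_Mapping.lookup (exp_sum \<sigma> (\<lambda>a. cnj (c a)) j) m = cnj (Poly_Mapping.lookup (exp_sum \<sigma> c j) m)"
proof -
  have eq: "Poly_Mapping.lookup f m = pairing (Poly_Mapping.single m 1) f / of_nat (ffact_vec m m)" for f
    using ffact_vec_self_neq_0[of m] by (simp add: pairing_single)
  have "cnj (peval (hom_part j (Poly_Mapping.single m 1)) a) = peval (hom_part j (Poly_Mapping.single m 1)) a" for a
    by (simp add: hom_part_single peval_single)
  then show ?thesis
    by (simp add: eq[of "exp_sum _ _ _"] pairing_exp_sum)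
qed

text \<open>The pairing is bilinear rather than Hermitian. With the conjugate on one side it becomes
  a weighted sum of squared absolute values.\<close>

lemma pairing_exp_sum_cnj:
  assumes "exp_sum \<sigma> c j \<noteq> 0"
  shows "pairing (exp_sum \<sigma> (\<lambda>a. cnj (c a)) j) (exp_sum \<sigma> c j) \<noteq> 0"
proof -
  define p where "p = exp_sum \<sigma> (\<lambda>a. cnj (c a)) j"
  define N where "N m = (cmod (Poly_Mapping.lookup p m))\<^sup>2 * of_nat (ffact_vec m m)" for m
  have lookup: "Poly_Mapping.lookup (exp_sum \<sigma> c j) m = cnj (Poly_Mapping.lookup p m)" for m
    by (simp add: p_def lookup_exp_sum_cnj)
  have "p \<noteq> 0"
    using assms lookup by (metis complex_cnj_zero_iff lookup_zero poly_mapping_eqI)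
  then obtain m where m: "m \<in> Poly_Mapping.keys p"
    by (metis equals0I keys_eq_empty)
  have "pairing p (exp_sum \<sigma> c j) = (\<Sum>m\<in>Poly_Mapping.keys p. pairing (Poly_Mapping.single m (Poly_Mapping.lookup p m)) (exp_sum \<sigma> c j))"
    by (subst monom_expansion[of p]) (rule pairing_sum_left)
  also have "\<dots> = complex_of_real (\<Sum>m\<in>Poly_Mapping.keys p. N m)"
    unfolding of_real_sum
    by (intro sum.cong) (simp_all add: pairing_single lookup N_def flip: complex_norm_square)
  also have "(\<Sum>m\<in>Poly_Mapping.keys p. N m) > 0"
    using m ffact_vec_self_neq_0
    by (intro sum_pos) (auto simp: N_def in_keys_iff intro!: mult_pos_pos)
  then have "complex_of_real (\<Sum>m\<in>Poly_Mapping.keys p. N m) \<noteq> 0"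
    by (metis of_real_eq_0_iff less_irrefl)
  finally show ?thesis by (simp add: p_def)
qed

lemma exp_sum_mem_least_space:
  assumes "\<And>i. i < j \<Longrightarrow> exp_sum \<sigma> c i = 0" "exp_sum \<sigma> c j \<noteq> 0"
  shows "exp_sum \<sigma> c j \<in> least_space \<sigma>"
proof -
  have "(\<lambda>t. \<Sum>a\<in>\<sigma>. c a * exp (complex_of_real (a \<bullet> t))) \<in> Exp_space \<sigma>"
    by (auto simp: Exp_space_def)
  moreover have "is_least (\<lambda>t. \<Sum>a\<in>\<sigma>. c a * exp (complex_of_real (a \<bullet> t))) (exp_sum \<sigma> c j)"
    unfolding is_least_def using homog_expansion_exp_sum assms by blast
  ultimately show ?thesis
    unfolding least_space_def by (intro cpoly.span_base) auto
qed

lemma interpolating_polynomial: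
  assumes "finite \<sigma>" "a \<in> \<sigma>"
  obtains q where "peval q a \<noteq> 0" "\<And>b. b \<in> \<sigma> \<Longrightarrow> b \<noteq> a \<Longrightarrow> peval q b = 0"
proof
  \<comment> \<open>The factor for \<open>b\<close> vanishes on the hyperplane through
    \<open>b\<close> with normal \<open>a - b\<close> and takes the squared distance of
    \<open>a\<close> and \<open>b\<close> as its value at \<open>a\<close>.\<close>
  define q where "q = (\<Prod>b\<in>\<sigma> - {a}. lin_form (a - b) - Poly_Mapping.single 0 (complex_of_real ((a - b) \<bullet> b)))"
  show "peval q a \<noteq> 0"
    using assms(1) by (auto simp: q_def inner_diff_right[symmetric] simp flip: of_real_diff)
  show "peval q b = 0" if "b \<in> \<sigma>" "b \<noteq> a" for b
    unfolding q_def peval_prod using that assms(1)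
    by (intro prod_zero) (auto intro!: bexI[of _ b])
qed

lemma exp_sum_neq_0:
  assumes "finite \<sigma>" "a \<in> \<sigma>" "c a \<noteq> 0"
  shows "\<exists>j. exp_sum \<sigma> c j \<noteq> 0"
proof (rule ccontr)
  assume "\<not> ?thesis"
  then have 0: "pairing q (exp_sum \<sigma> c j) = 0" for q j by simp
  obtain q where q: "peval q a \<noteq> 0" "\<And>b. b \<in> \<sigma> \<Longrightarrow> b \<noteq> a \<Longrightarrow> peval q b = 0"
    using interpolating_polynomial[OF assms(1,2)] by blast
  obtain n where n: "q = (\<Sum>d<n. hom_part d q)" using sum_hom_part[of q] by blast
  have "c a * peval q a = (\<Sum>b\<in>\<sigma>. c b * peval q b)"
    using q(2) assms(1,2) by (simp add: sum.remove[of \<sigma> a])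
  also have "\<dots> = (\<Sum>b\<in>\<sigma>. \<Sum>d<n. c b * peval (hom_part d q) b)"
    by (subst n) (simp add: sum_distrib_left)
  also have "\<dots> = (\<Sum>d<n. pairing q (exp_sum \<sigma> c d))"
    unfolding pairing_exp_sum by (rule sum.swap)
  finally show False using q(1) assms(3) by (simp add: 0)
qed

text \<open>A combination of evaluations with coefficients \<open>c\<close> is the pairing with the
  exponential sum of \<open>c\<close>. The conjugate of the least term of that sum lies in the least
  space, and the combination is nonzero there.\<close>

lemma peval_least_space_surj:
  assumes "finite \<sigma>"
  shows "\<exists>f\<in>least_space \<sigma>. \<forall>a\<in>\<sigma>. peval f a = g a"
proof (rule peval.surj_if_no_annihilator[OF assms])
  show "cpoly.subspace (least_space \<sigma>)" by (simp add: least_space_def cpoly.subspace_span)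
  fix c :: "real ^ 'a \<Rightarrow> complex"
  assume c: "\<And>f. f \<in> least_space \<sigma> \<Longrightarrow> (\<Sum>a\<in>\<sigma>. c a * peval f a) = 0"
  show "\<forall>a\<in>\<sigma>. c a = 0"
  proof (rule ccontr)
    assume "\<not> ?thesis"
    then obtain j where j: "exp_sum \<sigma> c j \<noteq> 0" "\<And>i. i < j \<Longrightarrow> exp_sum \<sigma> c i = 0"
      using exp_sum_neq_0[OF assms] exists_least_iff[of "\<lambda>j. exp_sum \<sigma> c j \<noteq> 0"] by metis
    define p where "p = exp_sum \<sigma> (\<lambda>a. cnj (c a)) j"
    have "exp_sum \<sigma> (\<lambda>a. cnj (c a)) i = 0" if "i < j" for i
      by (rule poly_mapping_eqI) (simp add: lookup_exp_sum_cnj j(2)[OF that])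
    moreover have nz: "pairing p (exp_sum \<sigma> c j) \<noteq> 0"
      unfolding p_def by (rule pairing_exp_sum_cnj[OF j(1)])
    moreover have "p \<noteq> 0" using nz by auto
    ultimately have "p \<in> least_space \<sigma>"
      unfolding p_def by (intro exp_sum_mem_least_space) auto
    then have "pairing p (exp_sum \<sigma> c j) = 0"
      using c by (simp add: pairing_exp_sum p_def hom_part_eq homog_exp_sum)
    then show False using nz by simp
  qed
qed

text \<open>The product of the shifted forms \<open>x y \<bullet> t - l y\<close> vanishes on
  \<sigma>, and its top degree part is \<open>prod_form x Y\<close>. Against a least term only the
  top degree part matters, as all lower degrees pair to zero.\<close>

lemma least_space_subset_pker:
  assumes L: "\<And>Y. Y \<in> L \<Longrightarrow> finite Y \<and> (\<forall>a\<in>\<sigma>. \<exists>y\<in>Y. x y \<bullet> a = l y)"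
  shows "least_space \<sigma> \<subseteq> pker (ideal.span (prod_form x ` L))"
  unfolding least_space_def
proof (rule cpoly.span_minimal[OF _ subspace_pker], rule subsetI)
  fix p assume "p \<in> {p. \<exists>f\<in>Exp_space \<sigma>. is_least f p}"
  then obtain c where "is_least (\<lambda>t. \<Sum>a\<in>\<sigma>. c a * exp (complex_of_real (a \<bullet> t))) p"
    by (auto simp: Exp_space_def)
  then have "p = 0 \<or> (\<exists>j. p = exp_sum \<sigma> c j \<and> (\<forall>i<j. exp_sum \<sigma> c i = 0))"
    unfolding is_least_def by (blast dest: homog_expansion_unique[OF homog_expansion_exp_sum])
  then show "p \<in> pker (ideal.span (prod_form x ` L))"
  proof
    assume "\<exists>j. p = exp_sum \<sigma> c j \<and> (\<forall>i<j. exp_sum \<sigma> c i = 0)"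
    then obtain j where p: "p = exp_sum \<sigma> c j" and j: "\<And>i. i < j \<Longrightarrow> exp_sum \<sigma> c i = 0" by blast
    define \<Lambda> where "\<Lambda> q = (\<Sum>a\<in>\<sigma>. c a * peval q a)" for q
    have \<Lambda>_homog: "\<Lambda> q = pairing q (exp_sum \<sigma> c d)" if "homog d q" for d q
      by (simp add: \<Lambda>_def pairing_exp_sum hom_part_eq[OF that])
    \<comment> \<open>\<open>\<Lambda>\<close> annihilates everything of degree below \<open>j\<close>, so it does not see the lower order terms of
      \<open>\<Prod>\<^sub>y (p\<^sub>y - l\<^sub>y)\<close>.\<close>
    have shift: "\<Lambda> (s * (\<Prod>y\<in>Y. lin_form (x y) - Poly_Mapping.single 0 (complex_of_real (l y)))) = \<Lambda> (s * prod_form x Y)"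
      if "finite Y" "homog e s" "e + card Y \<le> j" for Y s e
      using that
    proof (induction Y arbitrary: s e rule: finite_induct)
      case (insert y Y)
      let ?P = "\<Prod>y\<in>Y. lin_form (x y) - Poly_Mapping.single 0 (complex_of_real (l y))"
      have "\<Lambda> (s * ?P) = \<Lambda> (s * prod_form x Y)"
        using insert by simp
      also have "\<dots> = pairing (s * prod_form x Y) (exp_sum \<sigma> c (e + card Y))"
        by (intro \<Lambda>_homog homog_mult insert.prems homog_prod_form insert.hyps)
      also have "\<dots> = 0" using j[of "e + card Y"] insert by simp
      finally have 0: "\<Lambda> (s * ?P) = 0" .
      have "\<Lambda> (s * lin_form (x y) * ?P) = \<Lambda> (s * lin_form (x y) * prod_form x Y)"
        using insert by (intro insert.IH[of "e + 1"] homog_mult homog_lin_form) auto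
      moreover have "\<Lambda> (s * ((lin_form (x y) - Poly_Mapping.single 0 (complex_of_real (l y))) * ?P))
          = \<Lambda> (s * lin_form (x y) * ?P) - complex_of_real (l y) * \<Lambda> (s * ?P)"
      proof -
        have "s * ((lin_form (x y) - Poly_Mapping.single 0 (complex_of_real (l y))) * ?P)
            = s * lin_form (x y) * ?P - cscale (complex_of_real (l y)) (s * ?P)"
          by (simp only: left_diff_distrib right_diff_distrib cscale_def ac_simps)
        then show ?thesis
          by (simp add: \<Lambda>_def right_diff_distrib sum_subtractf sum_distrib_left mult.left_commute)
      qed
      ultimately show ?case
        using insert.hyps 0 by (simp add: prod_form_def ac_simps)
    qed (simp add: prod_form_def)
    have "pdiff (prod_form x Y) p = 0" if "Y \<in> L" for Y
    proof (rule pairing_eq_0_imp_eq_0)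
      fix s
      show "pairing s (pdiff (prod_form x Y) p) = 0"
      proof (induction s rule: monom_induct)
        case (1 m b)
        let ?s = "Poly_Mapping.single m b"
        have s: "homog (mdeg m) ?s"
          by (simp add: homog_iff hom_part_single)
        have h: "homog (mdeg m + card Y) (?s * prod_form x Y)"
          using L[OF that] by (intro homog_mult homog_prod_form s) auto
        show ?case
        proof (cases "mdeg m + card Y = j")
          case True
          have "pairing (?s * prod_form x Y) p = \<Lambda> (?s * prod_form x Y)"
            using \<Lambda>_homog[OF h] True p by simp
          also have "\<dots> = \<Lambda> (?s * (\<Prod>y\<in>Y. lin_form (x y) - Poly_Mapping.single 0 (complex_of_real (l y))))"
            using shift[OF _ s, of Y] L[OF that] True by simp
          also have "\<dots> = 0"
            unfolding \<Lambda>_def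
          proof (rule sum.neutral, rule ballI)
            fix a assume "a \<in> \<sigma>"
            then have "(\<Prod>y\<in>Y. complex_of_real (x y \<bullet> a) - complex_of_real (l y)) = 0"
              using L[OF that] by (intro prod_zero) auto
            then show "c a * peval (?s * (\<Prod>y\<in>Y. lin_form (x y) - Poly_Mapping.single 0 (complex_of_real (l y)))) a = 0"
              by simp
          qed
          finally show ?thesis by (simp add: pairing_mult)
        next
          case False
          then have "pairing (?s * prod_form x Y) p = 0"
            unfolding p pairing_exp_sum using hom_part_other[OF h, of j] by simp
          then show ?thesis by (simp add: pairing_mult)
        qed
      qed simp
    qed
    then show ?thesis by (simp add: pker_span_iff)
  qed (simp add: pker_def)
qed

section \<open>Minors and the central space\<close>

lemma orthogonal_span_eq_0:
  fixes v :: "real ^ 'n"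
  assumes "w \<in> span S" "\<And>s. s \<in> S \<Longrightarrow> v \<bullet> s = 0"
  shows "v \<bullet> w = 0"
  using orthogonal_to_span[OF assms(1), of v] assms(2) by (simp add: orthogonal_def)

lemma separating_vector:
  fixes S :: "(real ^ 'n) set"
  assumes "y \<notin> span S"
  obtains u where "y \<bullet> u = 1" "\<And>s. s \<in> S \<Longrightarrow> u \<bullet> s = 0"
proof -
  obtain a b where ab: "a \<in> span S" "\<And>w. w \<in> span S \<Longrightarrow> orthogonal b w" "y = a + b"
    using orthogonal_subspace_decomp_exists by blast
  then have "b \<bullet> b \<noteq> 0" using assms by auto
  moreover have "y \<bullet> b = b \<bullet> b"
    using ab(2)[OF ab(1)] by (simp add: ab(3) inner_add_left inner_add_right orthogonal_def inner_commute)
  ultimately show thesis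
    using ab(2) by (intro that[of "(1 / (b \<bullet> b)) *\<^sub>R b"]) (auto simp: orthogonal_def span_base)
qed

text \<open>Here \<open>S\<close> spans a hyperplane that misses \<open>y\<close>; the last
  conclusion says that the span is the full orthogonal complement of \<open>v\<close>.\<close>

lemma hyperplane_normal:
  fixes S :: "(real ^ 'n) set"
  assumes "span (insert y S) = UNIV" "span S \<noteq> UNIV"
  obtains v where "v \<noteq> 0" "y \<bullet> v \<noteq> 0" "\<And>s. s \<in> S \<Longrightarrow> v \<bullet> s = 0" "{h. v \<bullet> h = 0} \<subseteq> span S"
proof -
  have "y \<notin> span S" using assms by (metis span_redundant)
  then obtain v where v: "y \<bullet> v = 1" "\<And>s. s \<in> S \<Longrightarrow> v \<bullet> s = 0"
    using separating_vector by metis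
  have "h \<in> span S" if "v \<bullet> h = 0" for h
  proof -
    have "h \<in> span (insert y S)" using assms by simp
    then obtain k where k: "h - k *\<^sub>R y \<in> span S" by (auto simp: span_insert)
    have "v \<bullet> (h - k *\<^sub>R y) = 0" by (rule orthogonal_span_eq_0[OF k v(2)])
    then have "k = 0" using that v(1) by (simp add: inner_diff_right inner_commute)
    then show ?thesis using k by simp
  qed
  then show thesis using v by (intro that[of v]) auto
qed

lemma flat_unique:
  assumes "span (x ` Z) = (UNIV :: (real ^ 'n) set)" "t \<in> flat x l Z" "t' \<in> flat x l Z"
  shows "t = t'"
proof -
  have "(t - t') \<bullet> (t - t') = 0"
  proof (rule orthogonal_span_eq_0[of _ "x ` Z"])
    fix s assume "s \<in> x ` Z"
    then show "(t - t') \<bullet> s = 0"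
      using assms(2,3) by (auto simp: flat_def inner_diff_left inner_commute[of _ "x _"])
  qed (simp add: assms(1))
  then show ?thesis by simp
qed

text \<open>Each derivative along \<open>v\<close> has to hit a new factor that is not orthogonal to
  \<open>v\<close>, and there are fewer of these than derivatives.\<close>

lemma pdiff_prod_lin_form:
  assumes "finite K" "card {i \<in> K. v \<bullet> w i \<noteq> 0} < k"
  shows "pdiff (lin_form v ^ k) (\<Prod>i\<in>K. lin_form (w i)) = 0"
  using assms
proof (induction K arbitrary: k rule: finite_induct)
  case empty
  then show ?case using pdiff_lin_const[of v 1] by (cases k) (auto simp: mult.commute[of "lin_form v"] pdiff_mult)
next
  case (insert i K)
  then obtain k' where k: "k = Suc k'" by (cases k) auto
  have "{j \<in> insert i K. v \<bullet> w j \<noteq> 0} = (if v \<bullet> w i \<noteq> 0 then insert i {j \<in> K. v \<bullet> w j \<noteq> 0} else {j \<in> K. v \<bullet> w j \<noteq> 0})"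
    by auto
  then have "card {j \<in> K. v \<bullet> w j \<noteq> 0} < (if v \<bullet> w i \<noteq> 0 then k' else k)"
    using insert.prems insert.hyps k by (auto split: if_splits)
  then have "pdiff (lin_form v ^ k) (\<Prod>j\<in>K. lin_form (w j)) = 0"
    and "v \<bullet> w i \<noteq> 0 \<Longrightarrow> pdiff (lin_form v ^ k') (\<Prod>j\<in>K. lin_form (w j)) = 0"
    using insert.IH[of k] insert.IH[of k'] by (auto simp: k split: if_splits)
  then show ?case
    using insert.hyps unfolding k
    by (cases "v \<bullet> w i = 0") (simp_all add: pdiff_power_mult[OF pdiff_lin_lin] del: power_Suc of_nat_Suc)
qed

text \<open>The pair \<open>(Z, W)\<close> stands for the minor obtained by contracting the independent set \<open>Z\<close> and
  deleting everything outside \<open>Z \<union> W\<close>. Polynomials on the contraction are restrictions to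
  \<open>flat x l Z\<close>. The order on the family is given by the injective rank function \<open>\<rho>\<close>.\<close>

locale ranked_family =
  fixes x :: "'a \<Rightarrow> real ^ 'n::finite" and \<rho> :: "'a \<Rightarrow> nat"
begin

definition minor :: "'a set \<Rightarrow> 'a set \<Rightarrow> bool" where
  "minor Z W \<longleftrightarrow> finite Z \<and> finite W \<and> Z \<inter> W = {} \<and> inj_on x Z \<and> independent (x ` Z)
     \<and> span (x ` (Z \<union> W)) = UNIV \<and> inj_on \<rho> W"

text \<open>For a hyperplane \<open>H\<close> with normal \<open>v\<close> its cardinality is the
  multiplicity m(H).\<close>

definition off :: "real ^ 'n \<Rightarrow> 'a set \<Rightarrow> 'a set" where
  "off v W = {i \<in> W. v \<bullet> x i \<noteq> 0}"

text \<open>Normals of the facet hyperplanes of the minor, seen in the ambient space. The generators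
  are orthogonal to \<open>v\<close>, so the inclusion is an equality.\<close>

definition flat_normal :: "'a set \<Rightarrow> 'a set \<Rightarrow> real ^ 'n \<Rightarrow> bool" where
  "flat_normal Z W v \<longleftrightarrow> v \<noteq> 0 \<and> (\<forall>z\<in>Z. v \<bullet> x z = 0) \<and> {h. v \<bullet> h = 0} \<subseteq> span (x ` (Z \<union> {i \<in> W. v \<bullet> x i = 0}))"

text \<open>Internal bases of the minor. An element \<open>b\<close> always lies in its own
  fundamental cocircuit, so it is inactive exactly if some element of that cocircuit has larger
  rank.\<close>

definition internal :: "'a set \<Rightarrow> 'a set \<Rightarrow> 'a set \<Rightarrow> bool" where
  "internal Z W B \<longleftrightarrow> B \<subseteq> W \<and> inj_on x (Z \<union> B) \<and> independent (x ` (Z \<union> B)) \<and> span (x ` (Z \<union> B)) = UNIV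
     \<and> (\<forall>b\<in>B. \<exists>i\<in>W. x i \<notin> span (x ` (Z \<union> B - {b})) \<and> \<rho> b < \<rho> i)"

lemma minor_delete: "minor Z W \<Longrightarrow> span (x ` (Z \<union> (W - {y}))) = UNIV \<Longrightarrow> minor Z (W - {y})"
  by (auto simp: minor_def inj_on_diff)

lemma minor_contract:
  assumes "minor Z W" "y \<in> W" "x y \<notin> span (x ` Z)"
  shows "minor (insert y Z) (W - {y})"
proof -
  have "insert y Z \<union> (W - {y}) = Z \<union> W" using assms(2) by auto
  moreover have "x y \<notin> x ` Z" using assms(3) by (auto intro: span_base)
  ultimately show ?thesis
    using assms by (auto simp: minor_def inj_on_diff independent_insert)
qed

text \<open>Deletion and contraction of the smallest element \<open>y\<close>: a loop is deleted, a
  coloop is contracted, and otherwise both minors are available. Removing the smallest element does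
  not change the maximum of a set that has other elements.\<close>

lemma minor_induct [consumes 1, case_names empty loop coloop step]:
  assumes "minor Z W"
    and empty: "\<And>Z. minor Z {} \<Longrightarrow> P Z {}"
    and loop: "\<And>Z W y. minor Z W \<Longrightarrow> y \<in> W \<Longrightarrow> (\<And>i. i \<in> W - {y} \<Longrightarrow> \<rho> y < \<rho> i) \<Longrightarrow> x y \<in> span (x ` Z)
        \<Longrightarrow> P Z (W - {y}) \<Longrightarrow> P Z W"
    and coloop: "\<And>Z W y. minor Z W \<Longrightarrow> y \<in> W \<Longrightarrow> x y \<notin> span (x ` Z)
        \<Longrightarrow> span (x ` (Z \<union> (W - {y}))) \<noteq> UNIV \<Longrightarrow> P (insert y Z) (W - {y}) \<Longrightarrow> P Z W"
    and step: "\<And>Z W y. minor Z W \<Longrightarrow> y \<in> W \<Longrightarrow> (\<And>i. i \<in> W - {y} \<Longrightarrow> \<rho> y < \<rho> i) \<Longrightarrow> x y \<notin> span (x ` Z)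
        \<Longrightarrow> span (x ` (Z \<union> (W - {y}))) = UNIV \<Longrightarrow> P Z (W - {y}) \<Longrightarrow> P (insert y Z) (W - {y}) \<Longrightarrow> P Z W"
  shows "P Z W"
proof -
  have "finite W" using assms(1) by (simp add: minor_def)
  then show ?thesis
    using assms(1)
  proof (induction "card W" arbitrary: Z W)
    case 0
    then show ?case using empty by simp
  next
    case (Suc n)
    then have "W \<noteq> {}" by auto
    then obtain y where y: "y \<in> W" "\<And>i. i \<in> W \<Longrightarrow> \<rho> y \<le> \<rho> i"
      using ex_min_if_finite[of "\<rho> ` W"] Suc.prems(1) by (auto simp: not_less) 
    have less: "\<rho> y < \<rho> i" if "i \<in> W - {y}" for i
      using y that Suc.prems(2) inj_onD[of \<rho> W y i] by (force simp: minor_def le_less)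
    have n: "n = card (W - {y})" "finite (W - {y})"
      using Suc y(1) by auto
    show ?case
    proof (cases "x y \<in> span (x ` Z)")
      case True
      have "x ` (Z \<union> W) \<subseteq> span (x ` (Z \<union> (W - {y})))"
        using True span_mono[of "x ` Z" "x ` (Z \<union> (W - {y}))"] by (auto intro: span_base)
      then have "span (x ` (Z \<union> W)) \<subseteq> span (x ` (Z \<union> (W - {y})))"
        by (simp add: span_minimal)
      then have "minor Z (W - {y})"
        using Suc.prems(2) by (intro minor_delete) (auto simp: minor_def)
      then show ?thesis
        using Suc.hyps(1)[OF n] loop[OF Suc.prems(2) y(1) less True] by blast
    next
      case False
      have c: "P (insert y Z) (W - {y})"
        using Suc.hyps(1)[OF n] minor_contract[OF Suc.prems(2) y(1) False] by blast
      show ?thesis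
      proof (cases "span (x ` (Z \<union> (W - {y}))) = UNIV")
        case True
        then show ?thesis
          using Suc.hyps(1)[OF n minor_delete[OF Suc.prems(2) True]] step[OF Suc.prems(2) y(1) less False True _ c] by blast
      qed (use coloop[OF Suc.prems(2) y(1) False _ c] in blast)
    qed
  qed
qed

lemma flat_normal_delete: "flat_normal Z (W - {y}) v \<Longrightarrow> flat_normal Z W v"
proof -
  have "span (x ` (Z \<union> {i \<in> W - {y}. v \<bullet> x i = 0})) \<subseteq> span (x ` (Z \<union> {i \<in> W. v \<bullet> x i = 0}))"
    by (intro span_mono) auto
  then show "flat_normal Z (W - {y}) v \<Longrightarrow> flat_normal Z W v"
    by (auto simp: flat_normal_def)
qed

lemma flat_normal_contract: "y \<in> W \<Longrightarrow> flat_normal (insert y Z) (W - {y}) v \<Longrightarrow> flat_normal Z W v"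
proof -
  assume y: "y \<in> W" and v: "flat_normal (insert y Z) (W - {y}) v"
  then have eq: "insert y Z \<union> {i \<in> W - {y}. v \<bullet> x i = 0} = Z \<union> {i \<in> W. v \<bullet> x i = 0}"
    by (auto simp: flat_normal_def)
  show "flat_normal Z W v"
    using v unfolding flat_normal_def eq by simp
qed

lemma off_delete: "v \<bullet> x y = 0 \<Longrightarrow> off v (W - {y}) = off v W"
  by (auto simp: off_def)

lemma card_off_delete: "finite W \<Longrightarrow> y \<in> W \<Longrightarrow> v \<bullet> x y \<noteq> 0 \<Longrightarrow> card (off v (W - {y})) = card (off v W) - 1"
proof -
  assume "finite W" "y \<in> W" "v \<bullet> x y \<noteq> 0"
  moreover have "off v (W - {y}) = off v W - {y}" by (auto simp: off_def)
  ultimately show ?thesis by (simp add: off_def)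
qed

text \<open>Without the coloop the rest spans a hyperplane of multiplicity one.\<close>

lemma coloop_normal:
  assumes "minor Z W" "y \<in> W" "span (x ` (Z \<union> (W - {y}))) \<noteq> UNIV"
  obtains v where "flat_normal Z W v" "off v W = {y}" "v \<bullet> x y \<noteq> 0"
proof -
  have "insert (x y) (x ` (Z \<union> (W - {y}))) = x ` (Z \<union> W)" using assms(2) by auto
  then have "span (insert (x y) (x ` (Z \<union> (W - {y})))) = UNIV"
    using assms(1) by (simp add: minor_def)
  then obtain v where v: "v \<noteq> 0" "x y \<bullet> v \<noteq> 0" "\<And>s. s \<in> x ` (Z \<union> (W - {y})) \<Longrightarrow> v \<bullet> s = 0"
      "{h. v \<bullet> h = 0} \<subseteq> span (x ` (Z \<union> (W - {y})))"
    using hyperplane_normal assms(3) by metis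
  have "v \<bullet> x i = 0" if "i \<in> Z \<union> (W - {y})" for i using v(3) that by blast
  then have 1: "Z \<union> {i \<in> W. v \<bullet> x i = 0} = Z \<union> (W - {y})" "off v W = {y}"
    using v(2) assms(2) by (auto simp: off_def inner_commute)
  have "flat_normal Z W v"
    unfolding flat_normal_def 1(1) using v by auto
  then show thesis using that 1(2) v(2) by (simp add: inner_commute)
qed

lemma orth_loop:
  assumes "x y \<in> span (x ` Z)" "flat_normal Z W v"
  shows "v \<bullet> x y = 0"
  using assms by (intro orthogonal_span_eq_0[OF assms(1)]) (auto simp: flat_normal_def)

section \<open>The central space of a minor as a kernel\<close>

definition central :: "'a set \<Rightarrow> 'a set \<Rightarrow> 'n cpoly set" where
  "central Z W = cpoly.span {prod_form x Y | Y. Y \<subseteq> W \<and> span (x ` (Z \<union> (W - Y))) = UNIV}"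

lemma central_delete: "central Z (W - {y}) \<subseteq> central Z W"
  unfolding central_def
proof (rule cpoly.span_mono, safe)
  fix Y assume Y: "Y \<subseteq> W - {y}" "span (x ` (Z \<union> (W - {y} - Y))) = UNIV"
  have "span (x ` (Z \<union> (W - {y} - Y))) \<subseteq> span (x ` (Z \<union> (W - Y)))"
    by (intro span_mono) auto
  then show "\<exists>Y'. prod_form x Y = prod_form x Y' \<and> Y' \<subseteq> W \<and> span (x ` (Z \<union> (W - Y'))) = UNIV"
    using Y by auto
qed

lemma central_contract: "y \<in> W \<Longrightarrow> central (insert y Z) (W - {y}) \<subseteq> central Z W"
  unfolding central_def
proof (rule cpoly.span_mono, safe)
  fix Y assume Y: "y \<in> W" "Y \<subseteq> W - {y}" "span (x ` (insert y Z \<union> (W - {y} - Y))) = UNIV"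
  have "insert y Z \<union> (W - {y} - Y) = Z \<union> (W - Y)" using Y by auto
  then show "\<exists>Y'. prod_form x Y = prod_form x Y' \<and> Y' \<subseteq> W \<and> span (x ` (Z \<union> (W - Y'))) = UNIV"
    using Y by auto
qed

lemma central_mult:
  assumes "finite W" "y \<in> W" "h \<in> central Z (W - {y})"
  shows "lin_form (x y) * h \<in> central Z W"
  using assms(3) unfolding central_def[of Z "W - {y}"]
proof (induction rule: cpoly.span_induct_alt)
  case base
  show ?case by (simp add: central_def cpoly.span_zero)
next
  case (step c p g)
  then obtain Y where Y: "p = prod_form x Y" "Y \<subseteq> W - {y}" "span (x ` (Z \<union> (W - {y} - Y))) = UNIV" by blast
  then have "lin_form (x y) * p = prod_form x (insert y Y)"
    using assms(1) finite_subset[of Y W] by (subst prod_form_def, subst prod.insert) (auto simp: prod_form_def)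
  moreover have "W - insert y Y = W - {y} - Y" by auto
  then have "prod_form x (insert y Y) \<in> central Z W"
    unfolding central_def using Y assms(2) by (intro cpoly.span_base) auto
  ultimately have "lin_form (x y) * p \<in> central Z W" by simp
  then show ?case
    using step.IH by (simp add: distrib_left cscale_mult_right) (simp add: central_def cpoly.span_add cpoly.span_scale)
qed

text \<open>A spanning set \<open>Z \<union> (W - Y)\<close> is not contained in the hyperplane of
  \<open>v\<close>, so \<open>Y\<close> misses an element off it and fewer factors than derivatives
  remain.\<close>

lemma pdiff_central_eq_0:
  assumes "finite W" "g \<in> central Z W" "v \<noteq> 0" "\<And>z. z \<in> Z \<Longrightarrow> v \<bullet> x z = 0"
  shows "pdiff (lin_form v ^ card (off v W)) g = 0"
  using assms(2) unfolding central_def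
proof (induction rule: cpoly.span_induct_alt)
  case (step c p g)
  then obtain Y where Y: "p = prod_form x Y" "Y \<subseteq> W" "span (x ` (Z \<union> (W - Y))) = UNIV" by blast
  have "{i \<in> Y. v \<bullet> x i \<noteq> 0} \<noteq> off v W"
  proof
    assume eq: "{i \<in> Y. v \<bullet> x i \<noteq> 0} = off v W"
    have "v \<bullet> v = 0"
      using Y(2,3) assms(4) eq by (intro orthogonal_span_eq_0[of v "x ` (Z \<union> (W - Y))"]) (auto simp: off_def)
    then show False using assms(3) by simp
  qed
  then have "{i \<in> Y. v \<bullet> x i \<noteq> 0} \<subset> off v W" using Y(2) by (auto simp: off_def)
  then have "card {i \<in> Y. v \<bullet> x i \<noteq> 0} < card (off v W)"
    using assms(1) by (intro psubset_card_mono) (auto simp: off_def)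
  then have "pdiff (lin_form v ^ card (off v W)) p = 0"
    unfolding Y(1) prod_form_def using finite_subset[OF Y(2) assms(1)] by (rule pdiff_prod_lin_form[rotated])
  then show ?case using step by simp
qed simp

text \<open>The contraction provides \<open>g\<close> equal to \<open>f\<close> where the form of
  \<open>y\<close> vanishes, and the deletion treats the quotient of \<open>f - g\<close> by that
  form. Division lowers the degree along \<open>v\<close> exactly when deleting \<open>y\<close>
  lowers the multiplicity.\<close>

lemma central_eq_on_flat:
  assumes "minor Z W"
    and "\<And>v t. flat_normal Z W v \<Longrightarrow> t \<in> flat x (\<lambda>_. 0) Z \<Longrightarrow> peval (pdiff (lin_form v ^ card (off v W)) f) t = 0"
  shows "\<exists>g\<in>central Z W. \<forall>t\<in>flat x (\<lambda>_. 0) Z. peval f t = peval g t"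
  using assms
proof (induction arbitrary: f rule: minor_induct)
  case (empty Z)
  have "prod_form x {} \<in> central Z {}"
    unfolding central_def using empty(1) by (intro cpoly.span_base) (auto simp: minor_def)
  then have "cscale (peval f 0) (prod_form x {}) \<in> central Z {}"
    by (simp add: central_def cpoly.span_scale)
  \<comment> \<open>A spanning \<open>Z\<close> leaves only the origin, so matching the constant
    \<open>peval f 0\<close> suffices.\<close>
  moreover have "t = 0" if "t \<in> flat x (\<lambda>_. 0) Z" for t
    using that empty(1) by (intro flat_unique[of x Z t "\<lambda>_. 0"]) (auto simp: minor_def flat_def)
  ultimately show ?case by (intro bexI) (auto simp: prod_form_def)
next
  case (loop Z W y)
  have "peval (pdiff (lin_form v ^ card (off v (W - {y}))) f) t = 0"
    if "flat_normal Z (W - {y}) v" "t \<in> flat x (\<lambda>_. 0) Z" for v t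
    using loop.prems[OF flat_normal_delete[OF that(1)] that(2)] orth_loop[OF loop.hyps(4) that(1)]
    by (simp add: off_delete)
  from loop.IH[OF this] show ?case using central_delete by blast
next
  case (coloop Z W y)
  \<comment> \<open>the contraction covers \<open>f\<close> up to a multiple of \<open>p\<^sub>y\<close>, which vanishes by the normal of the coloop\<close>
  have "finite W" using coloop(1) by (simp add: minor_def)
  obtain u where u: "x y \<bullet> u = 1" "\<And>z. z \<in> Z \<Longrightarrow> u \<bullet> x z = 0"
    by (metis separating_vector[OF coloop.hyps(3)] imageI)
  have "peval (pdiff (lin_form v ^ card (off v (W - {y}))) f) t = 0"
    if "flat_normal (insert y Z) (W - {y}) v" "t \<in> flat x (\<lambda>_. 0) (insert y Z)" for v t
    using coloop.prems[OF flat_normal_contract[OF coloop.hyps(2) that(1)], of t] that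
    by (auto simp: off_delete flat_normal_def flat_def)
  from coloop.IH[OF this] obtain g where g: "g \<in> central (insert y Z) (W - {y})"
      "\<And>t. t \<in> flat x (\<lambda>_. 0) (insert y Z) \<Longrightarrow> peval f t = peval g t" by blast
  have g': "g \<in> central Z W" using g(1) central_contract[OF coloop.hyps(2)] by blast
  obtain h where h: "\<And>t. t \<in> flat x (\<lambda>_. 0) Z \<Longrightarrow> peval (f - g) t = complex_of_real (x y \<bullet> t - 0) * peval h t"
    by (rule divide_on_flat[of x y u Z "\<lambda>_. 0" "f - g"]) (use u g(2) in auto)
  obtain v where v: "flat_normal Z W v" "off v W = {y}" "v \<bullet> x y \<noteq> 0"
    using coloop_normal[OF coloop.hyps(1,2,4)] .
  have "peval (pdiff (lin_form v ^ 1) (f - g)) t = 0" if "t \<in> flat x (\<lambda>_. 0) Z" for t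
    using coloop.prems[OF v(1) that] pdiff_central_eq_0[OF \<open>finite W\<close> g', of v] v by (auto simp: flat_normal_def)
  then have "peval (pdiff (lin_form v ^ (if v \<bullet> x y = 0 then 1 else 1 - 1)) h) t = 0" if "t \<in> flat x (\<lambda>_. 0) Z" for t
    using u v(1) h that by (intro direction_degree_divide[of x y u Z v "\<lambda>_. 0" "f - g" 0]) (auto simp: flat_normal_def)
  then have "peval f t = peval g t" if "t \<in> flat x (\<lambda>_. 0) Z" for t
    using h[OF that] v(3) that by simp
  then show ?case using g' by blast
next
  case (step Z W y)
  have "finite W" using step(1) by (simp add: minor_def)
  obtain u where u: "x y \<bullet> u = 1" "\<And>z. z \<in> Z \<Longrightarrow> u \<bullet> x z = 0"
    by (metis separating_vector[OF step.hyps(4)] imageI)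
  have "peval (pdiff (lin_form v ^ card (off v (W - {y}))) f) t = 0"
    if "flat_normal (insert y Z) (W - {y}) v" "t \<in> flat x (\<lambda>_. 0) (insert y Z)" for v t
    using step.prems[OF flat_normal_contract[OF step.hyps(2) that(1)], of t] that
    by (auto simp: off_delete flat_normal_def flat_def)
  from step.IH(2)[OF this] obtain g where g: "g \<in> central (insert y Z) (W - {y})"
      "\<And>t. t \<in> flat x (\<lambda>_. 0) (insert y Z) \<Longrightarrow> peval f t = peval g t" by blast
  have g': "g \<in> central Z W" using g(1) central_contract[OF step.hyps(2)] by blast
  obtain h where h: "\<And>t. t \<in> flat x (\<lambda>_. 0) Z \<Longrightarrow> peval (f - g) t = complex_of_real (x y \<bullet> t - 0) * peval h t"
    by (rule divide_on_flat[of x y u Z "\<lambda>_. 0" "f - g"]) (use u g(2) in auto)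
  have "peval (pdiff (lin_form v ^ card (off v (W - {y}))) h) t = 0"
    if v: "flat_normal Z (W - {y}) v" and t: "t \<in> flat x (\<lambda>_. 0) Z" for v t
  proof -
    have "peval (pdiff (lin_form v ^ card (off v W)) (f - g)) t = 0" if "t \<in> flat x (\<lambda>_. 0) Z" for t
      using step.prems[OF flat_normal_delete[OF v] that] pdiff_central_eq_0[OF \<open>finite W\<close> g', of v] v
      by (auto simp: flat_normal_def)
    then have "peval (pdiff (lin_form v ^ (if v \<bullet> x y = 0 then card (off v W) else card (off v W) - 1)) h) t = 0"
      using u v h t by (intro direction_degree_divide[of x y u Z v "\<lambda>_. 0" "f - g" 0]) (auto simp: flat_normal_def)
    then show ?thesis
      using \<open>finite W\<close> step.hyps(2) by (simp add: off_delete card_off_delete split: if_splits)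
  qed
  from step.IH(1)[OF this] obtain g2 where g2: "g2 \<in> central Z (W - {y})"
      "\<And>t. t \<in> flat x (\<lambda>_. 0) Z \<Longrightarrow> peval h t = peval g2 t" by blast
  have "g + lin_form (x y) * g2 \<in> central Z W"
    using g' central_mult[OF \<open>finite W\<close> step.hyps(2) g2(1)] by (simp add: central_def cpoly.span_add)
  moreover have "peval f t = peval (g + lin_form (x y) * g2) t" if "t \<in> flat x (\<lambda>_. 0) Z" for t
    using h[OF that] g2(2)[OF that] by (simp add: algebra_simps)
  ultimately show ?case by blast
qed

end

section \<open>Vanishing and orthogonality by deletion and contraction\<close>

lemma card_basis:
  fixes S :: "(real ^ 'n) set"
  assumes "independent S" "span S = UNIV"
  shows "card S = CARD('n)"
  using dim_eq_card_independent[OF assms(1)] dim_span[of S] by (simp add: assms(2))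

lemma pdiff_lin_span:
  assumes "\<And>v. v \<in> S \<Longrightarrow> pdiff (lin_form v) f = 0" "w \<in> span S"
  shows "pdiff (lin_form w) f = 0"
proof -
  have "subspace {v. pdiff (lin_form v) f = 0}"
    by (auto simp: subspace_def lin_form_add lin_form_scale)
  then show ?thesis using span_minimal[of S "{v. pdiff (lin_form v) f = 0}"] assms by auto
qed

text \<open>A multiple of the form of \<open>y\<close> kills \<open>f\<close>, also after other
  operators have been applied, since all of them commute.\<close>

lemma pdiff_prod_lin_cong:
  assumes "pdiff (lin_form y) f = 0" "\<And>i. i \<in> K \<Longrightarrow> u i - u' i \<in> span {y}"
  shows "pdiff (\<Prod>i\<in>K. lin_form (u i)) f = pdiff (\<Prod>i\<in>K. lin_form (u' i)) f"
  using assms(2)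
proof (induction K rule: infinite_finite_induct)
  case (insert i K)
  let ?g = "pdiff (\<Prod>i\<in>K. lin_form (u' i)) f"
  have "pdiff (lin_form y) ?g = 0"
    using assms(1) by (simp add: pdiff_commute[of "lin_form y"])
  then have "pdiff (lin_form (u i - u' i)) ?g = 0"
    by (intro pdiff_lin_span[of "{y}", OF _ insert.prems]) auto
  moreover have "lin_form (u i) = lin_form (u i - u' i) + lin_form (u' i)"
    by (simp flip: lin_form_add)
  ultimately have "pdiff (lin_form (u i)) ?g = pdiff (lin_form (u' i)) ?g" by simp
  moreover have "pdiff (\<Prod>i\<in>K. lin_form (u i)) f = ?g"
    using insert.IH insert.prems by blast
  ultimately show ?case using insert.hyps by (simp add: pdiff_mult)
qed auto

context ranked_family
begin

lemma card_internal: "internal Z W B \<Longrightarrow> card (Z \<union> B) = CARD('n)"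
  using card_basis[of "x ` (Z \<union> B)"] by (simp add: internal_def card_image)

lemma internal_delete: "internal Z (W - {y}) B \<Longrightarrow> internal Z W B"
  unfolding internal_def by blast

text \<open>The new element \<open>y\<close> is inactive: since it is no coloop, another element
  lies outside the span of \<open>Z \<union> B\<close>, and \<open>y\<close> has the smallest
  rank.\<close>

lemma internal_contract:
  assumes "minor Z W" "y \<in> W" "\<And>i. i \<in> W - {y} \<Longrightarrow> \<rho> y < \<rho> i"
    and span: "span (x ` (Z \<union> (W - {y}))) = UNIV"
    and B: "internal (insert y Z) (W - {y}) B"
  shows "internal Z W (insert y B)"
proof -
  have yB: "y \<notin> B" "B \<subseteq> W - {y}" using B by (auto simp: internal_def)
  have yZ: "y \<notin> Z" using assms(1,2) by (auto simp: minor_def)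
  have eq: "insert y Z \<union> B = Z \<union> insert y B" by auto
  have "\<exists>i\<in>W. x i \<notin> span (x ` (Z \<union> insert y B - {b})) \<and> \<rho> b < \<rho> i" if "b \<in> insert y B" for b
  proof (cases "b = y")
    case False
    then show ?thesis using that B unfolding internal_def eq by blast
  next
    case True
    have b: "Z \<union> insert y B - {b} = Z \<union> B" using True yB yZ by auto
    have ins: "x ` (insert y Z \<union> B) = insert (x y) (x ` (Z \<union> B))" by auto
    have "x y \<notin> x ` (Z \<union> B)"
      using B yB yZ unfolding internal_def inj_on_def by blast
    then have y: "x y \<notin> span (x ` (Z \<union> B))"
      using B unfolding internal_def ins by (simp add: independent_insert)
    have "\<exists>i\<in>W - {y}. x i \<notin> span (x ` (Z \<union> B))"
    proof (rule ccontr)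
      assume "\<not> ?thesis"
      then have "x ` (Z \<union> (W - {y})) \<subseteq> span (x ` (Z \<union> B))" by (auto intro: span_base)
      then have "span (x ` (Z \<union> (W - {y}))) \<subseteq> span (x ` (Z \<union> B))" by (simp add: span_minimal)
      then show False using span y by auto
    qed
    then show ?thesis using assms(3) True unfolding b by blast
  qed
  then show ?thesis
    using B assms(2) unfolding internal_def eq by blast
qed

text \<open>The contraction makes \<open>f\<close> vanish on the hyperplane of \<open>y\<close>, so
  \<open>f\<close> has a linear factor there. The quotient meets the hypotheses of the deletion,
  because genericity keeps the vertices of the deletion off this hyperplane.\<close>

lemma vanish_on_flat:
  assumes "minor Z W"
    and "\<And>S t. S \<subseteq> Z \<union> W \<Longrightarrow> card S = CARD('n) + 1 \<Longrightarrow> t \<notin> flat x l S"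
    and "\<And>v t. flat_normal Z W v \<Longrightarrow> t \<in> flat x l Z \<Longrightarrow> peval (pdiff (lin_form v ^ (card (off v W) - 1)) f) t = 0"
    and "\<And>B t. internal Z W B \<Longrightarrow> t \<in> flat x l (Z \<union> B) \<Longrightarrow> peval f t = 0"
  shows "\<forall>t\<in>flat x l Z. peval f t = 0"
  using assms
proof (induction arbitrary: f rule: minor_induct)
  case (empty Z)
  then have "internal Z {} {}" by (simp add: minor_def internal_def)
  then show ?case using empty.prems(3)[of "{}"] by auto
next
  case (loop Z W y)
  show ?case
  proof (rule loop.IH)
    show "peval (pdiff (lin_form v ^ (card (off v (W - {y})) - 1)) f) t = 0"
      if "flat_normal Z (W - {y}) v" "t \<in> flat x l Z" for v t
      using loop.prems(2)[OF flat_normal_delete[OF that(1)] that(2)] orth_loop[OF loop.hyps(4) that(1)]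
      by (simp add: off_delete)
    show "t \<notin> flat x l S" if "S \<subseteq> Z \<union> (W - {y})" "card S = CARD('n) + 1" for S t
      using that loop.prems(1)[of S t] by blast
    show "peval f t = 0" if "internal Z (W - {y}) B" "t \<in> flat x l (Z \<union> B)" for B t
      using loop.prems(3)[OF internal_delete[OF that(1)] that(2)] .
  qed
next
  case (coloop Z W y)
  \<comment> \<open>The exponent for this normal is \<open>1 - 1 = 0\<close>, so the hypothesis
    already says that \<open>f\<close> vanishes.\<close>
  obtain v where v: "flat_normal Z W v" "off v W = {y}" "v \<bullet> x y \<noteq> 0"
    using coloop_normal[OF coloop.hyps(1,2,4)] .
  then show ?case using coloop.prems(2)[OF v(1)] by simp
next
  case (step Z W y)
  have "finite W" using step(1) by (simp add: minor_def)
  obtain u where u: "x y \<bullet> u = 1" "\<And>z. z \<in> Z \<Longrightarrow> u \<bullet> x z = 0"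
    by (metis separating_vector[OF step.hyps(4)] imageI)
  have "\<forall>t\<in>flat x l (insert y Z). peval f t = 0"
  proof (rule step.IH(2))
    show "peval (pdiff (lin_form v ^ (card (off v (W - {y})) - 1)) f) t = 0"
      if "flat_normal (insert y Z) (W - {y}) v" "t \<in> flat x l (insert y Z)" for v t
      using step.prems(2)[OF flat_normal_contract[OF step.hyps(2) that(1)], of t] that
      by (auto simp: off_delete flat_normal_def flat_def)
    show "peval f t = 0" if "internal (insert y Z) (W - {y}) B" "t \<in> flat x l (insert y Z \<union> B)" for B t
      using step.prems(3)[OF internal_contract[OF step.hyps(1-3,5) that(1)], of t] that(2) by simp
    show "t \<notin> flat x l S" if "S \<subseteq> insert y Z \<union> (W - {y})" "card S = CARD('n) + 1" for S t
      using that step.prems(1)[of S t] step.hyps(2) by blast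
  qed
  then obtain h where h: "\<And>t. t \<in> flat x l Z \<Longrightarrow> peval f t = complex_of_real (x y \<bullet> t - l y) * peval h t"
    by (rule_tac divide_on_flat[of x y u Z l f]) (use u in auto)
  have "\<forall>t\<in>flat x l Z. peval h t = 0"
  proof (rule step.IH(1))
    show "t \<notin> flat x l S" if "S \<subseteq> Z \<union> (W - {y})" "card S = CARD('n) + 1" for S t
      using that step.prems(1)[of S t] by blast
    show "peval (pdiff (lin_form v ^ (card (off v (W - {y})) - 1)) h) t = 0"
      if v: "flat_normal Z (W - {y}) v" and t: "t \<in> flat x l Z" for v t
    proof -
      have "peval (pdiff (lin_form v ^ (if v \<bullet> x y = 0 then card (off v W) - 1 else card (off v W) - 1 - 1)) h) t = 0"
        using u v h t step.prems(2)[OF flat_normal_delete[OF v]]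
        by (intro direction_degree_divide[of x y u Z v l f "l y"]) (auto simp: flat_normal_def)
      then show ?thesis
        using \<open>finite W\<close> step.hyps(2) by (simp add: off_delete card_off_delete split: if_splits)
    qed
    show "peval h t = 0" if B: "internal Z (W - {y}) B" and t: "t \<in> flat x l (Z \<union> B)" for B t
    proof -
      have 0: "peval f t = 0" using step.prems(3)[OF internal_delete[OF B] t] .
      have "finite (Z \<union> B)"
        using B step.hyps(1) by (auto simp: internal_def minor_def intro: finite_subset)
      moreover have "card (Z \<union> B) = CARD('n)"
        using card_internal[OF B] .
      moreover have "y \<notin> Z \<union> B"
        using B step.hyps(1,2) by (auto simp: internal_def minor_def)
      ultimately have "card (insert y (Z \<union> B)) = CARD('n) + 1" by simp
      moreover have "insert y (Z \<union> B) \<subseteq> Z \<union> W"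
        using B step.hyps(2) by (auto simp: internal_def)
      ultimately have "t \<notin> flat x l (insert y (Z \<union> B))" using step.prems(1) by blast
      then have "x y \<bullet> t \<noteq> l y" using t by (auto simp: flat_def)
      moreover have "t \<in> flat x l Z" using t by (simp add: flat_def)
      ultimately show ?thesis using h[of t] 0 by (simp flip: of_real_diff)
    qed
  qed
  then show ?case using h by simp
qed

section \<open>Adjusted products of linear forms\<close>

text \<open>Singles out the maximal element \<open>i\<close> of the fundamental cocircuit of
  \<open>b\<close>; \<open>block\<close> collects the \<open>b\<close> that share it.\<close>

definition top_elt :: "'a set \<Rightarrow> 'a set \<Rightarrow> 'a set \<Rightarrow> 'a \<Rightarrow> 'a \<Rightarrow> bool" where
  "top_elt Z W B b i \<longleftrightarrow> i \<in> W \<and> x i \<notin> span (x ` (Z \<union> B - {b}))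
     \<and> (\<forall>j\<in>W. x j \<notin> span (x ` (Z \<union> B - {b})) \<longrightarrow> \<rho> j \<le> \<rho> i)"

definition block :: "'a set \<Rightarrow> 'a set \<Rightarrow> 'a set \<Rightarrow> 'a \<Rightarrow> 'a set" where
  "block Z W B i = {b \<in> B. top_elt Z W B b i}"

text \<open>\<open>adjusted Z W B i v\<close> says that \<open>v\<close> arises from \<open>x i\<close> by removing its coordinates, in the basis
  \<open>Z \<union> B\<close>, along all \<open>b\<close> whose fundamental cocircuit has \<open>i\<close> as maximal element.\<close>

definition adjusted :: "'a set \<Rightarrow> 'a set \<Rightarrow> 'a set \<Rightarrow> 'a \<Rightarrow> real ^ 'n \<Rightarrow> bool" where
  "adjusted Z W B i v \<longleftrightarrow> v - x i \<in> span (x ` block Z W B i) \<and> v \<in> span (x ` (Z \<union> (B - block Z W B i)))"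

lemma block_delete:
  assumes "i \<in> W - {y}" "\<And>i. i \<in> W - {y} \<Longrightarrow> \<rho> y < \<rho> i"
  shows "block Z (W - {y}) B i = block Z W B i"
proof -
  have "top_elt Z (W - {y}) B b i \<longleftrightarrow> top_elt Z W B b i" for b
    using assms unfolding top_elt_def by (metis Diff_iff insertE less_imp_le singletonD)
  then show ?thesis by (simp add: block_def)
qed

text \<open>Every fundamental cocircuit already has an element in the deletion, and that element is
  above \<open>y\<close>. Hence \<open>x y\<close> itself is adjusted.\<close>

lemma block_min:
  assumes "\<And>i. i \<in> W - {y} \<Longrightarrow> \<rho> y < \<rho> i" "internal Z (W - {y}) B"
  shows "block Z W B y = {}"
proof -
  have "\<not> top_elt Z W B b y" if b: "b \<in> B" for b
  proof -
    have "\<forall>b\<in>B. \<exists>i\<in>W - {y}. x i \<notin> span (x ` (Z \<union> B - {b})) \<and> \<rho> b < \<rho> i"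
      using assms(2) unfolding internal_def by (elim conjE)
    then obtain i where "i \<in> W - {y}" "x i \<notin> span (x ` (Z \<union> B - {b}))"
      using b by blast
    then show ?thesis
      using assms(1)[of i] unfolding top_elt_def by (meson DiffD1 not_le)
  qed
  then show ?thesis by (simp add: block_def)
qed

text \<open>Undoing the contraction moves \<open>y\<close> from \<open>Z\<close> into the basis
  without changing \<open>Z \<union> B\<close>. Blocks agree except that \<open>y\<close> may join
  the block of \<open>i\<close>, and then the coordinate of \<open>u\<close> along
  \<open>x y\<close> has to be subtracted.\<close>

lemma adjusted_contract:
  assumes y: "y \<in> W" "y \<notin> B" "y \<notin> Z" and i: "i \<in> W - {y}"
    and u: "adjusted (insert y Z) (W - {y}) B i u"
  obtains u' where "adjusted Z W (insert y B) i u'" "u - u' \<in> span {x y}"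
proof -
  let ?\<beta> = "block (insert y Z) (W - {y}) B i"
  have "top_elt (insert y Z) (W - {y}) B b i \<longleftrightarrow> top_elt Z W (insert y B) b i" if "b \<in> B" for b
  proof -
    have eq: "insert y Z \<union> B - {b} = Z \<union> insert y B - {b}" by auto
    have "x y \<in> span (x ` (Z \<union> insert y B - {b}))"
      using that y by (intro span_base) auto
    then show ?thesis
      unfolding top_elt_def eq using i by (auto simp del: insert_iff)
  qed
  then have \<beta>: "block Z W (insert y B) i = (if top_elt Z W (insert y B) y i then insert y ?\<beta> else ?\<beta>)"
    by (auto simp: block_def)
  have \<beta>B: "?\<beta> \<subseteq> B" by (auto simp: block_def)
  have u1: "u - x i \<in> span (x ` ?\<beta>)" and u2: "u \<in> span (x ` (insert y Z \<union> (B - ?\<beta>)))"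
    using u by (auto simp: adjusted_def)
  show thesis
  proof (cases "top_elt Z W (insert y B) y i")
    case False
    then have "Z \<union> (insert y B - block Z W (insert y B) i) = insert y Z \<union> (B - ?\<beta>)"
      using \<beta>B y(2) by (auto simp: \<beta>)
    then have "adjusted Z W (insert y B) i u"
      using u1 u2 False by (simp add: adjusted_def \<beta>)
    then show thesis by (intro that[of u]) (auto simp: span_zero)
  next
    case True
    have "x ` (insert y Z \<union> (B - ?\<beta>)) = insert (x y) (x ` (Z \<union> (B - ?\<beta>)))" by auto
    then obtain k where k: "u - k *\<^sub>R x y \<in> span (x ` (Z \<union> (B - ?\<beta>)))"
      using u2 by (auto simp: span_insert)
    have "u - x i \<in> span (x ` insert y ?\<beta>)"
      using u1 span_mono[of "x ` ?\<beta>" "x ` insert y ?\<beta>"] by auto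
    then have "u - x i - k *\<^sub>R x y \<in> span (x ` insert y ?\<beta>)"
      by (rule span_diff) (auto intro: span_base span_scale)
    moreover have "u - x i - k *\<^sub>R x y = u - k *\<^sub>R x y - x i" by simp
    moreover have "Z \<union> (insert y B - insert y ?\<beta>) = Z \<union> (B - ?\<beta>)" using y(2) by auto
    ultimately have "adjusted Z W (insert y B) i (u - k *\<^sub>R x y)"
      using k True by (simp only: adjusted_def \<beta> if_True)
    then show thesis by (rule that) (simp add: span_scale span_base)
  qed
qed

text \<open>The derivative of \<open>f\<close> by the form of \<open>y\<close> satisfies the
  hypotheses of the deletion and is therefore zero; then \<open>f\<close> satisfies those of the
  contraction. At the end all derivatives of \<open>f\<close> vanish and the empty product detects
  the remaining constant.\<close>

lemma orthogonal_to_adjusted_products: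
  assumes "minor Z W"
    and "\<And>z. z \<in> Z \<Longrightarrow> pdiff (lin_form (x z)) f = 0"
    and "\<And>v w. flat_normal Z W v \<Longrightarrow> w \<in> off v W \<Longrightarrow> (\<And>i. i \<in> off v W \<Longrightarrow> \<rho> i \<le> \<rho> w)
        \<Longrightarrow> pdiff (prod_form x (off v W - {w})) f = 0"
    and "\<And>B K u. internal Z W B \<Longrightarrow> K \<subseteq> W - B \<Longrightarrow> (\<And>i. i \<in> K \<Longrightarrow> adjusted Z W B i (u i))
        \<Longrightarrow> pairing (\<Prod>i\<in>K. lin_form (u i)) f = 0"
  shows "f = 0"
  using assms
proof (induction arbitrary: f rule: minor_induct)
  case (empty Z)
  have "internal Z {} {}" using empty(1) by (simp add: minor_def internal_def)
  then have 1: "pairing 1 f = 0" using empty.prems(3)[of "{}" "{}"] by simp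
  have D: "pdiff (lin_form w) f = 0" for w
    by (rule pdiff_lin_span[of "x ` Z"]) (use empty(1) empty.prems(1) in \<open>auto simp: minor_def\<close>)
  show ?case
  proof (rule pairing_eq_0_imp_eq_0)
    fix s show "pairing s f = 0"
    proof (induction s rule: cpoly_induct)
      case (const c)
      then show ?case using 1 by (metis cscale_one_eq mult_zero_right pairing_cscale_left)
    next
      case (var i p)
      then show ?case
        using D[of "axis i 1"] by (simp add: lin_form_axis mult.commute[of "var i"] pairing_mult)
    qed simp
  qed
next
  case (loop Z W y)
  show ?case
  proof (rule loop.IH)
    show "pdiff (prod_form x (off v (W - {y}) - {w})) f = 0"
      if "flat_normal Z (W - {y}) v" "w \<in> off v (W - {y})" "\<And>i. i \<in> off v (W - {y}) \<Longrightarrow> \<rho> i \<le> \<rho> w" for v w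
      using loop.prems(2)[OF flat_normal_delete[OF that(1)], of w] that(2,3) orth_loop[OF loop.hyps(4) that(1)]
      by (simp add: off_delete)
    show "pairing (\<Prod>i\<in>K. lin_form (u i)) f = 0"
      if "internal Z (W - {y}) B" "K \<subseteq> W - {y} - B" "\<And>i. i \<in> K \<Longrightarrow> adjusted Z (W - {y}) B i (u i)" for B K u
    proof (rule loop.prems(3)[OF internal_delete[OF that(1)]])
      show "K \<subseteq> W - B" using that(2) by auto
      show "adjusted Z W B i (u i)" if "i \<in> K" for i
      proof -
        have "block Z (W - {y}) B i = block Z W B i"
          by (rule block_delete) (use that \<open>K \<subseteq> W - {y} - B\<close> loop.hyps(3) in auto)
        then show ?thesis
          using \<open>\<And>i. i \<in> K \<Longrightarrow> adjusted Z (W - {y}) B i (u i)\<close>[OF that] by (simp add: adjusted_def)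
      qed
    qed
  qed (fact loop.prems(1))
next
  case (coloop Z W y)
  obtain v where v: "flat_normal Z W v" "off v W = {y}" "v \<bullet> x y \<noteq> 0"
    using coloop_normal[OF coloop.hyps(1,2,4)] .
  then show ?case using coloop.prems(2)[OF v(1), of y] by (simp add: prod_form_def)
next
  case (step Z W y)
  have fin: "finite W" and yZ: "y \<notin> Z" using step(1,2) by (auto simp: minor_def)
  define g where "g = pdiff (lin_form (x y)) f"
  have "g = 0"
  proof (rule step.IH(1))
    show "pdiff (lin_form (x z)) g = 0" if "z \<in> Z" for z
      using step.prems(1)[OF that] by (simp add: g_def pdiff_commute[of _ "lin_form (x y)"])
    show "pdiff (prod_form x (off v (W - {y}) - {w})) g = 0"
      if v: "flat_normal Z (W - {y}) v" and w: "w \<in> off v (W - {y})" "\<And>i. i \<in> off v (W - {y}) \<Longrightarrow> \<rho> i \<le> \<rho> w" for v w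
    proof (cases "v \<bullet> x y = 0")
      case True
      then show ?thesis
        using step.prems(2)[OF flat_normal_delete[OF v], of w] w
        by (simp add: off_delete g_def pdiff_commute[of _ "lin_form (x y)"])
    next
      case False
      have off: "off v W = insert y (off v (W - {y}))" "y \<notin> off v (W - {y})" "finite (off v (W - {y}))"
        using False step.hyps(2) fin by (auto simp: off_def)
      \<comment> \<open>The element \<open>y\<close> is not the maximum left out, so its form is a
        factor of the operator for \<open>W\<close>, which is the one already present in
        \<open>g\<close>.\<close>
      have "\<rho> y < \<rho> w" using w(1) step.hyps(3)[of w] by (auto simp: off_def)
      then have "pdiff (prod_form x (off v W - {w})) f = 0"
        using w by (intro step.prems(2) flat_normal_delete[OF v]) (auto simp: off(1))
      moreover have "off v W - {w} = insert y (off v (W - {y}) - {w})"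
        using off w(1) by auto
      ultimately show ?thesis
        using off by (simp add: prod_form_def g_def pdiff_mult pdiff_commute[of _ "lin_form (x y)"])
    qed
    show "pairing (\<Prod>i\<in>K. lin_form (u i)) g = 0"
      if B: "internal Z (W - {y}) B" and K: "K \<subseteq> W - {y} - B" and u: "\<And>i. i \<in> K \<Longrightarrow> adjusted Z (W - {y}) B i (u i)" for B K u
    proof -
      have yK: "y \<notin> K" "finite K" using K fin by (auto intro: finite_subset)
      \<comment> \<open>The derivative in \<open>g\<close> becomes the extra factor
        \<open>x y\<close>, which is adjusted because its block is empty.\<close>
      have "pairing (\<Prod>i\<in>insert y K. lin_form ((u(y := x y)) i)) f = 0"
      proof (rule step.prems(3)[OF internal_delete[OF B]])
        show "insert y K \<subseteq> W - B" using K B step.hyps(2) by (auto simp: internal_def)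
        show "adjusted Z W B i ((u(y := x y)) i)" if "i \<in> insert y K" for i
        proof (cases "i = y")
          case True
          have "block Z W B y = {}" using block_min[OF step.hyps(3) B] .
          then show ?thesis using True B by (simp add: adjusted_def internal_def)
        next
          case False
          then have "block Z (W - {y}) B i = block Z W B i"
            by (intro block_delete) (use that K step.hyps(3) in auto)
          then show ?thesis
            using False that u[of i] by (auto simp: adjusted_def)
        qed
      qed
      moreover have "(\<Prod>i\<in>K. lin_form ((u(y := x y)) i)) = (\<Prod>i\<in>K. lin_form (u i))"
        using yK by (intro prod.cong) auto
      ultimately show ?thesis
        using yK by (simp add: g_def mult.commute[of "lin_form (x y)"] pairing_mult)
    qed
  qed
  show ?case
  proof (rule step.IH(2))
    show "pdiff (lin_form (x z)) f = 0" if "z \<in> insert y Z" for z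
      using that step.prems(1) \<open>g = 0\<close> by (auto simp: g_def)
    show "pdiff (prod_form x (off v (W - {y}) - {w})) f = 0"
      if v: "flat_normal (insert y Z) (W - {y}) v" and w: "w \<in> off v (W - {y})" "\<And>i. i \<in> off v (W - {y}) \<Longrightarrow> \<rho> i \<le> \<rho> w" for v w
    proof -
      have "v \<bullet> x y = 0" using v by (simp add: flat_normal_def)
      then show ?thesis
        using step.prems(2)[OF flat_normal_contract[OF step.hyps(2) v], of w] w by (simp add: off_delete)
    qed
    show "pairing (\<Prod>i\<in>K. lin_form (u i)) f = 0"
      if B: "internal (insert y Z) (W - {y}) B" and K: "K \<subseteq> W - {y} - B"
        and u: "\<And>i. i \<in> K \<Longrightarrow> adjusted (insert y Z) (W - {y}) B i (u i)" for B K u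
    proof -
      have yB: "y \<notin> B" using B by (auto simp: internal_def)
      have "\<exists>u'. adjusted Z W (insert y B) i u' \<and> u i - u' \<in> span {x y}" if "i \<in> K" for i
        using adjusted_contract[OF step.hyps(2) yB yZ _ u[OF that]] that K by blast
      then obtain u' where u': "\<And>i. i \<in> K \<Longrightarrow> adjusted Z W (insert y B) i (u' i) \<and> u i - u' i \<in> span {x y}"
        by metis
      have "pairing (\<Prod>i\<in>K. lin_form (u' i)) f = 0"
        using K u' by (intro step.prems(3)[OF internal_contract[OF step.hyps(1-3,5) B]]) auto
      \<comment> \<open>The two families differ by multiples of \<open>x y\<close>, whose form kills
        \<open>f\<close> because \<open>g = 0\<close>.\<close>
      moreover have "pdiff (\<Prod>i\<in>K. lin_form (u i)) f = pdiff (\<Prod>i\<in>K. lin_form (u' i)) f"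
        using \<open>g = 0\<close> u' by (intro pdiff_prod_lin_cong[of "x y"]) (auto simp: g_def)
      ultimately show ?thesis by (simp add: pairing_def)
    qed
  qed
qed

end

section \<open>The internal space as a kernel\<close>

lemma normal_to_hyperplane:
  fixes v w :: "real ^ 'n"
  assumes "v \<noteq> 0" "\<And>h. v \<bullet> h = 0 \<Longrightarrow> w \<bullet> h = 0"
  shows "w = (w \<bullet> v / (v \<bullet> v)) *\<^sub>R v"
proof -
  let ?d = "w - (w \<bullet> v / (v \<bullet> v)) *\<^sub>R v"
  have v: "v \<bullet> ?d = 0" using assms(1) by (simp add: inner_diff_right inner_commute)
  then have "?d \<bullet> ?d = 0" using assms(2)[OF v] by (simp add: inner_diff_left)
  then show ?thesis by simp
qed

lemma pdiff_power_mono: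
  assumes "pdiff (q ^ a) f = 0" "a \<le> b"
  shows "pdiff (q ^ b) f = 0"
proof -
  have "q ^ b = q ^ (b - a) * q ^ a" using assms(2) by (simp flip: power_add)
  then show ?thesis using assms(1) by (simp add: pdiff_mult)
qed

lemma facet_hyperplane:
  fixes x :: "'a \<Rightarrow> real ^ 'n::finite"
  assumes "H \<in> facets X x" "is_normal v H"
  shows "H = {h. v \<bullet> h = 0}"
proof (rule subspace_dim_equal)
  show "dim {h. v \<bullet> h = 0} \<le> dim H"
    using assms dim_hyperplane[of v] by (simp add: facets_def is_normal_def)
qed (use assms in \<open>auto simp: facets_def is_normal_def subspace_hyperplane\<close>)

context ranked_family
begin

lemma dual_basis:
  assumes "inj_on x B" "independent (x ` B)"
  obtains d where "\<And>a b. a \<in> B \<Longrightarrow> b \<in> B \<Longrightarrow> d b \<bullet> x a = (if a = b then 1 else 0)"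
proof -
  have "\<exists>u. u \<bullet> x b = 1 \<and> (\<forall>a\<in>B. a \<noteq> b \<longrightarrow> u \<bullet> x a = 0)" if b: "b \<in> B" for b
  proof -
    have "x ` (B - {b}) = x ` B - {x b}" using assms(1) b by (auto simp: inj_on_def)
    then have "x b \<notin> span (x ` (B - {b}))" using assms(2) b by (auto simp: dependent_def)
    then obtain u where "x b \<bullet> u = 1" "\<And>s. s \<in> x ` (B - {b}) \<Longrightarrow> u \<bullet> s = 0"
      using separating_vector by metis
    then have "u \<bullet> x b = 1 \<and> (\<forall>a\<in>B. a \<noteq> b \<longrightarrow> u \<bullet> x a = 0)"
      by (metis DiffI imageI inner_commute singletonD)
    then show ?thesis ..
  qed
  then obtain d where "\<And>b. b \<in> B \<Longrightarrow> d b \<bullet> x b = 1 \<and> (\<forall>a\<in>B. a \<noteq> b \<longrightarrow> d b \<bullet> x a = 0)" by metis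
  then show thesis by (intro that[of d]) auto
qed

lemma flat_basis_nonempty:
  assumes "finite B" "inj_on x B" "independent (x ` B)"
  obtains t where "t \<in> flat x l B"
proof -
  obtain d where d: "\<And>a b. a \<in> B \<Longrightarrow> b \<in> B \<Longrightarrow> d b \<bullet> x a = (if a = b then 1 else 0)"
    using dual_basis[OF assms(2,3)] by blast
  have "x a \<bullet> (\<Sum>b\<in>B. l b *\<^sub>R d b) = l a" if "a \<in> B" for a
  proof -
    have "x a \<bullet> (\<Sum>b\<in>B. l b *\<^sub>R d b) = (\<Sum>b\<in>B. if a = b then l b else 0)"
      unfolding inner_sum_right using that by (intro sum.cong) (auto simp: inner_commute[of "x a"] d)
    then show ?thesis using that assms(1) by simp
  qed
  then show thesis by (intro that[of "\<Sum>b\<in>B. l b *\<^sub>R d b"]) (simp add: flat_def)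
qed

text \<open>The inner product is the sum over \<open>b\<close> of \<open>v \<bullet> x b\<close>
  times the coordinate of \<open>w\<close> along \<open>b\<close>, and one of the two factors is
  always zero.\<close>

lemma inner_eq_0_if_no_coordinates:
  assumes B: "finite B" "inj_on x B" "independent (x ` B)" "span (x ` B) = UNIV"
    and w: "\<And>b. b \<in> B \<Longrightarrow> v \<bullet> x b \<noteq> 0 \<Longrightarrow> w \<in> span (x ` (B - {b}))"
  shows "v \<bullet> w = 0"
proof -
  obtain d where d: "\<And>a b. a \<in> B \<Longrightarrow> b \<in> B \<Longrightarrow> d b \<bullet> x a = (if a = b then 1 else 0)"
    using dual_basis[OF B(2,3)] by blast
  let ?v = "\<Sum>b\<in>B. (v \<bullet> x b) *\<^sub>R d b"
  have "(v - ?v) \<bullet> w = 0"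
  proof (rule orthogonal_span_eq_0[of w "x ` B"])
    fix s assume "s \<in> x ` B"
    then obtain a where a: "a \<in> B" "s = x a" by blast
    have "?v \<bullet> x a = (\<Sum>b\<in>B. if a = b then v \<bullet> x b else 0)"
      unfolding inner_sum_left using a by (intro sum.cong) (auto simp: d)
    then show "(v - ?v) \<bullet> s = 0" using a B(1) by (simp add: inner_diff_left)
  qed (simp add: B(4))
  moreover have "(v \<bullet> x b) * (d b \<bullet> w) = 0" if b: "b \<in> B" for b
  proof (cases "v \<bullet> x b = 0")
    case False
    have "d b \<bullet> w = 0"
      using b by (intro orthogonal_span_eq_0[OF w[OF b False]]) (auto simp: d split: if_splits)
    then show ?thesis by simp
  qed simp
  ultimately show ?thesis by (simp add: inner_diff_left inner_sum_left)
qed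

section \<open>Adjusted products lie in the kernel of the facet powers\<close>

lemma top_elt_exists:
  assumes "finite X" "inj_on x B" "independent (x ` B)" "b \<in> B" "B \<subseteq> X"
  obtains i where "top_elt {} X B b i"
proof -
  let ?C = "{i \<in> X. x i \<notin> span (x ` (B - {b}))}"
  have "x ` (B - {b}) = x ` B - {x b}" using assms(2,4) by (auto simp: inj_on_def)
  then have "b \<in> ?C" using assms(3-5) by (auto simp: dependent_def)
  then have "finite (\<rho> ` ?C)" "\<rho> ` ?C \<noteq> {}" using assms(1) by auto
  from Max_in[OF this] obtain i where "i \<in> ?C" "\<rho> i = Max (\<rho> ` ?C)" by auto
  moreover have "\<rho> j \<le> Max (\<rho> ` ?C)" if "j \<in> ?C" for j using that assms(1) by (intro Max_ge) auto
  ultimately show thesis by (intro that[of i]) (auto simp: top_elt_def)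
qed

text \<open>The counting behind the membership of the products in \<open>\<P>\<^sub>-\<close>. Among the \<open>b \<in> B\<close> off the
  hyperplane choose one whose top element \<open>i\<^sub>0\<close> is maximal. Then \<open>u i\<^sub>0\<close> lies on the hyperplane, and the set
  \<open>insert i (block i)\<close> has an element off the hyperplane whenever \<open>u i\<close> is off it, and two of them for
  \<open>i = i\<^sub>0\<close>.\<close>

lemma card_adjusted_off:
  assumes X: "finite X" "inj_on \<rho> X" and B: "internal {} X B" and v: "v \<noteq> 0"
    and K: "K \<subseteq> X - B" and u: "\<And>i. i \<in> K \<Longrightarrow> adjusted {} X B i (u i)"
  shows "card {i \<in> K. v \<bullet> u i \<noteq> 0} + 2 \<le> card (off v X)"
proof -
  have BX: "B \<subseteq> X" "finite B" and basis: "inj_on x B" "independent (x ` B)" "span (x ` B) = UNIV"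
    using B X(1) finite_subset by (auto simp: internal_def)
  define N where "N = {i \<in> K. v \<bullet> u i \<noteq> 0}"
  define G where "G i = {j \<in> insert i (block {} X B i). v \<bullet> x j \<noteq> 0}" for i
  have "\<exists>i. top_elt {} X B b i" if b: "b \<in> B" for b
    using top_elt_exists[OF X(1) basis(1,2) b BX(1)] by blast
  then obtain T where T: "\<And>b. b \<in> B \<Longrightarrow> top_elt {} X B b (T b)" by metis
  have T_unique: "i = T b" if "b \<in> B" "top_elt {} X B b i" for b i
    using T[OF that(1)] that(2) inj_onD[OF X(2)] unfolding top_elt_def by (metis antisym)
  have block: "block {} X B i = {b \<in> B. T b = i}" for i
    using T T_unique by (auto simp: block_def)
  \<comment> \<open>Internality excludes \<open>T b = b\<close>, and the other basis elements lie in
    the span of \<open>B - {b}\<close>.\<close>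
  have T_notin: "T b \<in> X - B" if b: "b \<in> B" for b
  proof -
    obtain i where i: "i \<in> X" "x i \<notin> span (x ` (B - {b}))" "\<rho> b < \<rho> i"
      using B b unfolding internal_def by auto
    then have "T b \<noteq> b" using T[OF b] by (auto simp: top_elt_def not_le[symmetric])
    moreover have "x (T b) \<notin> span (x ` (B - {b}))" "T b \<in> X"
      using T[OF b] by (auto simp: top_elt_def)
    ultimately show ?thesis by (auto intro: span_base)
  qed
  have below: "x i \<in> span (x ` (B - {b}))" if "b \<in> B" "i \<in> X" "\<rho> (T b) < \<rho> i" for b i
    using T[OF that(1)] that(2,3) by (auto simp: top_elt_def not_le[symmetric])
  have "\<exists>b\<in>B. v \<bullet> x b \<noteq> 0"
  proof (rule ccontr)
    assume "\<not> ?thesis"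
    then have "v \<bullet> v = 0" using basis(3) by (intro orthogonal_span_eq_0[of v "x ` B"]) auto
    then show False using v by simp
  qed
  then have "finite (\<rho> ` T ` {b \<in> B. v \<bullet> x b \<noteq> 0})" "\<rho> ` T ` {b \<in> B. v \<bullet> x b \<noteq> 0} \<noteq> {}"
    using BX(2) by auto
  from Max_in[OF this] obtain b0 where b0: "b0 \<in> B" "v \<bullet> x b0 \<noteq> 0" 
      "\<rho> (T b0) = Max (\<rho> ` T ` {b \<in> B. v \<bullet> x b \<noteq> 0})" by auto
  define i0 where "i0 = T b0"
  have max: "b \<in> block {} X B i0 \<or> x i0 \<in> span (x ` (B - {b}))" if b: "b \<in> B" "v \<bullet> x b \<noteq> 0" for b
  proof -
    have "\<rho> (T b) \<le> \<rho> i0" unfolding i0_def b0(3) using b BX(2) by (intro Max_ge) auto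
    then have "T b = i0 \<or> \<rho> (T b) < \<rho> i0"
      using inj_onD[OF X(2)] T_notin b(1) b0(1) by (fastforce simp: i0_def le_less)
    then show ?thesis using below[OF b(1)] T_notin[OF b0(1)] b(1) by (auto simp: block i0_def)
  qed
  have "i0 \<notin> N"
  proof
    assume "i0 \<in> N"
    then have i0: "i0 \<in> K" "v \<bullet> u i0 \<noteq> 0" by (auto simp: N_def)
    \<comment> \<open>Coordinates along the block were removed by the adjustment; along other basis
      elements off the hyperplane \<open>x i0\<close> has none, by the maximality of
      \<open>i0\<close>.\<close>
    have "u i0 \<in> span (x ` (B - {b}))" if b: "b \<in> B" "v \<bullet> x b \<noteq> 0" for b
    proof (cases "b \<in> block {} X B i0")
      case True
      then have "span (x ` (B - block {} X B i0)) \<subseteq> span (x ` (B - {b}))" by (intro span_mono) auto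
      then show ?thesis using u[OF i0(1)] by (auto simp: adjusted_def)
    next
      case False
      then have "span (x ` block {} X B i0) \<subseteq> span (x ` (B - {b}))"
        by (intro span_mono) (auto simp: block_def)
      then have "u i0 - x i0 \<in> span (x ` (B - {b}))" using u[OF i0(1)] by (auto simp: adjusted_def)
      then show ?thesis using max[OF b] False span_add[of "u i0 - x i0" _ "x i0"] by auto
    qed
    then have "v \<bullet> u i0 = 0" by (rule inner_eq_0_if_no_coordinates[OF BX(2) basis])
    then show False using i0(2) by simp
  qed
  have G1: "1 \<le> card (G i)" if i: "i \<in> N" for i
  proof -
    have "\<exists>j\<in>insert i (block {} X B i). v \<bullet> x j \<noteq> 0"
    proof (rule ccontr)
      assume *: "\<not> ?thesis"
      have "v \<bullet> (u i - x i) = 0"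
      proof (rule orthogonal_span_eq_0)
        show "u i - x i \<in> span (x ` block {} X B i)"
          using u[of i] i by (simp add: adjusted_def N_def)
      qed (use * in blast)
      then show False using * i by (auto simp: N_def inner_diff_right)
    qed
    moreover have "finite (G i)" using BX(2) by (auto simp: G_def block_def)
    ultimately show ?thesis by (auto simp: G_def Suc_le_eq card_gt_0_iff)
  qed
  \<comment> \<open>If \<open>b0\<close> were alone, \<open>x i0\<close> would lie on the
    hyperplane, and its only coordinate along a basis element off it would be the one along
    \<open>b0\<close>. That coordinate would be zero, although \<open>i0\<close> lies in the
    cocircuit of \<open>b0\<close>.\<close>
  have G2: "2 \<le> card (G i0)"
  proof -
    have b0G: "b0 \<in> G i0" using b0 by (auto simp: G_def block i0_def)
    have "\<exists>j\<in>G i0. j \<noteq> b0"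
    proof (rule ccontr)
      assume *: "\<not> ?thesis"
      have "i0 \<notin> G i0" using * T_notin[OF b0(1)] b0(1) by (auto simp: i0_def)
      then have vi0: "v \<bullet> x i0 = 0" by (auto simp: G_def)
      have "x i0 \<in> span (insert (x b0) (x ` (B - {b0})))"
        using basis(3) b0(1) by (simp add: insert_absorb flip: image_insert)
      then obtain k where k: "x i0 - k *\<^sub>R x b0 \<in> span (x ` (B - {b0}))" by (auto simp: span_insert)
      have "x i0 - k *\<^sub>R x b0 \<in> span (x ` (B - {b}))" if b: "b \<in> B" "v \<bullet> x b \<noteq> 0" for b
      proof (cases "b = b0")
        case False
        then have "x i0 \<in> span (x ` (B - {b}))" using max[OF b] * b by (auto simp: G_def)
        moreover have "x b0 \<in> span (x ` (B - {b}))" using False b0(1) by (intro span_base) auto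
        ultimately show ?thesis by (intro span_diff span_scale)
      qed (use k in simp)
      then have "v \<bullet> (x i0 - k *\<^sub>R x b0) = 0" by (rule inner_eq_0_if_no_coordinates[OF BX(2) basis])
      then have "k = 0" using vi0 b0(2) by (simp add: inner_diff_right)
      then show False using k T[OF b0(1)] by (auto simp: top_elt_def i0_def)
    qed
    then obtain j where "j \<in> G i0" "j \<noteq> b0" by blast
    moreover have "finite (G i0)" using BX(2) by (auto simp: G_def block_def)
    ultimately show ?thesis
      using b0G card_mono[of "G i0" "{j, b0}"] by auto
  qed
  have NX: "N \<subseteq> X - B" "finite N" using K X(1) by (auto simp: N_def intro: finite_subset)
  \<comment> \<open>The index \<open>i0\<close> is outside \<open>N\<close> and contributes two. The
    sets are disjoint, since each basis element has a single top element and top elements are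
    outside \<open>B\<close>.\<close>
  have "card N + 2 \<le> (\<Sum>i\<in>insert i0 N. card (G i))"
    using NX \<open>i0 \<notin> N\<close> G2 sum_mono[of N "\<lambda>_. 1" "\<lambda>i. card (G i)"] G1 by simp
  also have "\<dots> = card (\<Union>i\<in>insert i0 N. G i)"
  proof (rule card_UN_disjoint[symmetric])
    show "\<forall>i\<in>insert i0 N. \<forall>j\<in>insert i0 N. i \<noteq> j \<longrightarrow> G i \<inter> G j = {}"
      using NX T_notin[OF b0(1)] by (auto simp: G_def block i0_def)
  qed (use NX BX(2) in \<open>auto simp: G_def block_def\<close>)
  also have "\<dots> \<le> card (off v X)"
    using NX BX T_notin[OF b0(1)] X(1) by (intro card_mono) (auto simp: G_def block off_def i0_def)
  finally show ?thesis by (simp add: N_def)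
qed

lemma pdiff_adjusted_product:
  assumes "finite X" "inj_on \<rho> X" "internal {} X B" "v \<noteq> 0"
    and "K \<subseteq> X - B" "\<And>i. i \<in> K \<Longrightarrow> adjusted {} X B i (u i)"
  shows "pdiff (lin_form v ^ (card (off v X) - 1)) (\<Prod>i\<in>K. lin_form (u i)) = 0"
proof (rule pdiff_prod_lin_form)
  show "card {i \<in> K. v \<bullet> u i \<noteq> 0} < card (off v X) - 1"
    using card_adjusted_off[OF assms] by simp
  show "finite K" using assms(1,5) by (auto intro: finite_subset)
qed

section \<open>Kernel description of the internal space\<close>

text \<open>Normals of a hyperplane are proportional, and rescaling changes the power of a form by a
  nonzero scalar only. So the chosen normals can be replaced by all normals.\<close>

lemma pker_I_int_iff:
  assumes "\<forall>H\<in>facets X x. is_normal (\<eta> H) H"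
  shows "f \<in> pker (I_int \<eta> X x) \<longleftrightarrow> (\<forall>v. flat_normal {} X v \<longrightarrow> pdiff (lin_form v ^ (card (off v X) - 1)) f = 0)"
proof -
  have off: "{i \<in> X. x i \<notin> H} = off (\<eta> H) X" if "H \<in> facets X x" for H
    using facet_hyperplane[OF that] assms that by (auto simp: off_def)
  have "(\<forall>H\<in>facets X x. pdiff (lin_form (\<eta> H) ^ (card (off (\<eta> H) X) - 1)) f = 0)
      \<longleftrightarrow> (\<forall>v. flat_normal {} X v \<longrightarrow> pdiff (lin_form v ^ (card (off v X) - 1)) f = 0)"
  proof (intro iffI allI impI ballI)
    fix v assume *: "\<forall>H\<in>facets X x. pdiff (lin_form (\<eta> H) ^ (card (off (\<eta> H) X) - 1)) f = 0"
      and v: "flat_normal {} X v"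
    define H where "H = {h. v \<bullet> h = 0}"
    have XH: "x ` X \<inter> H = x ` {i \<in> X. v \<bullet> x i = 0}" by (auto simp: H_def)
    have "span (x ` X \<inter> H) = H"
    proof
      show "span (x ` X \<inter> H) \<subseteq> H" by (rule span_minimal) (auto simp: H_def subspace_hyperplane)
      show "H \<subseteq> span (x ` X \<inter> H)" unfolding XH using v by (simp add: flat_normal_def H_def)
    qed
    moreover have "dim H = CARD('n) - 1"
      using v dim_hyperplane[of v] by (simp add: flat_normal_def H_def)
    ultimately have H: "H \<in> facets X x"
      by (simp add: facets_def subspace_hyperplane H_def)
    then have normal: "is_normal (\<eta> H) H" using assms by blast
    define c where "c = \<eta> H \<bullet> v / (v \<bullet> v)"
    have \<eta>: "\<eta> H = c *\<^sub>R v"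
      unfolding c_def using normal v
      by (intro normal_to_hyperplane) (auto simp: is_normal_def H_def flat_normal_def)
    then have "c \<noteq> 0" using normal by (auto simp: is_normal_def)
    then have "off (\<eta> H) X = off v X" by (simp add: off_def \<eta>)
    moreover have "lin_form (\<eta> H) ^ k = cscale (complex_of_real c ^ k) (lin_form v ^ k)" for k
    proof (induction k)
      case (Suc k)
      show ?case
        unfolding power_Suc Suc by (simp add: \<eta> lin_form_scale cscale_mult_left cscale_mult_right)
    qed simp
    ultimately have "cscale (complex_of_real c ^ (card (off v X) - 1)) (pdiff (lin_form v ^ (card (off v X) - 1)) f) = 0"
      using * H by (metis pdiff_cscale_left)
    then show "pdiff (lin_form v ^ (card (off v X) - 1)) f = 0"
      using \<open>c \<noteq> 0\<close> by simp
  next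
    fix H assume *: "\<forall>v. flat_normal {} X v \<longrightarrow> pdiff (lin_form v ^ (card (off v X) - 1)) f = 0"
      and H: "H \<in> facets X x"
    define v where "v = \<eta> H"
    have v: "v \<noteq> 0" and Hv: "H = {h. v \<bullet> h = 0}"
      using facet_hyperplane[OF H, of v] assms H by (auto simp: is_normal_def v_def)
    have XH: "x ` X \<inter> H = x ` {i \<in> X. v \<bullet> x i = 0}" unfolding Hv by auto
    have "span (x ` X \<inter> H) = H" using H by (simp add: facets_def)
    then have "span (x ` {i \<in> X. v \<bullet> x i = 0}) = {h. v \<bullet> h = 0}" unfolding XH unfolding Hv .
    then have "flat_normal {} X v" using v by (simp add: flat_normal_def)
    then have "flat_normal {} X (\<eta> H)" unfolding v_def .
    then show "pdiff (lin_form (\<eta> H) ^ (card (off (\<eta> H) X) - 1)) f = 0" using * by blast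
  qed
  then show ?thesis
    by (simp add: I_int_def pker_span_iff off)
qed

lemma P_central_eq: "P_central W x = central {} W"
proof -
  have "dim (x ` (W - Y)) = CARD('n) \<longleftrightarrow> span (x ` ({} \<union> (W - Y))) = UNIV" for Y
    using dim_eq_full[of "x ` (W - Y)"] by simp
  then show ?thesis by (simp add: P_central_def central_def)
qed

lemma central_eq_pker:
  assumes "minor {} W"
  shows "f \<in> central {} W \<longleftrightarrow> (\<forall>v. flat_normal {} W v \<longrightarrow> pdiff (lin_form v ^ card (off v W)) f = 0)"
proof
  assume "\<forall>v. flat_normal {} W v \<longrightarrow> pdiff (lin_form v ^ card (off v W)) f = 0"
  then obtain g where "g \<in> central {} W" "\<forall>t\<in>flat x (\<lambda>_. 0) {}. peval f t = peval g t"
    using central_eq_on_flat[OF assms, of f] by auto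
  then show "f \<in> central {} W" using peval_inject[of f g] by (auto simp: flat_def)
qed (use assms pdiff_central_eq_0[of W f "{}"] in \<open>auto simp: minor_def flat_normal_def\<close>)

lemma central_trivial:
  assumes "span (x ` W) \<noteq> UNIV"
  shows "central {} W = {0}"
proof -
  have "span (x ` ({} \<union> (W - Y))) \<noteq> UNIV" for Y
    using assms span_mono[of "x ` (W - Y)" "x ` W"] by auto
  then show ?thesis by (simp add: central_def)
qed

text \<open>Deleting an element off a facet hyperplane lowers its multiplicity by one, which gives
  the exponent in one direction. Conversely, facets of a deletion are facets of \<open>X\<close>,
  and the exponent is at most the one required for the deletion.\<close>

lemma P_int_iff:
  assumes X: "minor {} X"
  shows "f \<in> P_int X x \<longleftrightarrow> (\<forall>v. flat_normal {} X v \<longrightarrow> pdiff (lin_form v ^ (card (off v X) - 1)) f = 0)"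
proof
  assume f: "f \<in> P_int X x"
  show "\<forall>v. flat_normal {} X v \<longrightarrow> pdiff (lin_form v ^ (card (off v X) - 1)) f = 0"
  proof (intro allI impI)
    fix v assume v: "flat_normal {} X v"
    have "\<exists>i\<in>X. v \<bullet> x i \<noteq> 0"
    proof (rule ccontr)
      assume "\<not> ?thesis"
      then have "v \<bullet> v = 0"
        using X by (intro orthogonal_span_eq_0[of v "x ` X"]) (auto simp: minor_def)
      then show False using v by (simp add: flat_normal_def)
    qed
    then obtain i where i: "i \<in> X" "v \<bullet> x i \<noteq> 0" by blast
    have fi: "f \<in> central {} (X - {i})" using f i(1) by (simp add: P_int_def P_central_eq)
    show "pdiff (lin_form v ^ (card (off v X) - 1)) f = 0"
    proof (cases "span (x ` (X - {i})) = UNIV")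
      case True
      then have "minor {} (X - {i})" using X by (intro minor_delete) auto
      moreover have "{j \<in> X - {i}. v \<bullet> x j = 0} = {j \<in> X. v \<bullet> x j = 0}" using i by auto
      then have "flat_normal {} (X - {i}) v" using v by (simp add: flat_normal_def)
      ultimately have "pdiff (lin_form v ^ card (off v (X - {i}))) f = 0"
        using fi central_eq_pker[of "X - {i}" f] by blast
      then show ?thesis using card_off_delete[of X i v] i X by (simp add: minor_def)
    qed (use fi central_trivial in simp)
  qed
next
  assume f: "\<forall>v. flat_normal {} X v \<longrightarrow> pdiff (lin_form v ^ (card (off v X) - 1)) f = 0"
  have "f \<in> central {} (X - {i})" if i: "i \<in> X" for i
  proof (cases "span (x ` (X - {i})) = UNIV")
    case True
    then have "minor {} (X - {i})" using X by (intro minor_delete) auto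
    moreover have "pdiff (lin_form v ^ card (off v (X - {i}))) f = 0" if v: "flat_normal {} (X - {i}) v" for v
    proof (cases "v \<bullet> x i = 0")
      case True
      then show ?thesis
        using f flat_normal_delete[OF v] by (auto simp: off_delete intro: pdiff_power_mono)
    next
      case False
      then show ?thesis
        using f flat_normal_delete[OF v] X i by (simp add: card_off_delete minor_def)
    qed
    ultimately show ?thesis by (simp add: central_eq_pker)
  next
    case False
    \<comment> \<open>A coloop gives a facet with exponent 0, which forces
      \<open>f = 0\<close>.\<close>
    then obtain v where "flat_normal {} X v" "off v X = {i}"
      using coloop_normal[OF X i] by auto
    then have "f = 0" using f by force
    then show ?thesis by (simp add: central_def cpoly.span_zero)
  qed
  then show "f \<in> P_int X x" by (simp add: P_int_def P_central_eq)
qed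

end

text \<open>By transitivity and antisymmetry lower sets grow strictly along the order, so their
  sizes encode it.\<close>

lemma rank_function:
  assumes r: "linear_order_on X r" and "finite X"
  defines "\<rho> \<equiv> \<lambda>i. card {k \<in> X. (k, i) \<in> r}"
  shows "inj_on \<rho> X" "\<And>i j. i \<in> X \<Longrightarrow> j \<in> X \<Longrightarrow> \<rho> i < \<rho> j \<longleftrightarrow> (j, i) \<notin> r"
proof -
  have "refl_on X r" "trans r" "antisym r" "total_on X r"
    using r by (simp_all add: order_on_defs)
  then have refl: "(i, i) \<in> r" if "i \<in> X" for i
    using that by (simp add: refl_on_def)
  have trans: "(i, k) \<in> r" if "(i, j) \<in> r" "(j, k) \<in> r" for i j k
    using \<open>trans r\<close> that by (rule transD)
  have antisym: "i = j" if "(i, j) \<in> r" "(j, i) \<in> r" for i j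
    using \<open>antisym r\<close> that by (rule antisymD)
  have total: "(i, j) \<in> r \<or> (j, i) \<in> r" if "i \<in> X" "j \<in> X" for i j
    using \<open>total_on X r\<close> that refl by (cases "i = j") (simp_all add: total_on_def)
  have less: "\<rho> i < \<rho> j" if "i \<in> X" "j \<in> X" "(i, j) \<in> r" "i \<noteq> j" for i j
  proof -
    have "{k \<in> X. (k, i) \<in> r} \<subseteq> {k \<in> X. (k, j) \<in> r}" using trans[OF _ that(3)] by blast
    moreover have "j \<notin> {k \<in> X. (k, i) \<in> r}" "j \<in> {k \<in> X. (k, j) \<in> r}"
      using that antisym[OF that(3)] refl[OF that(2)] by auto
    ultimately show ?thesis
      unfolding \<rho>_def using \<open>finite X\<close> by (intro psubset_card_mono) auto
  qed
  show "inj_on \<rho> X"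
    by (rule inj_onI) (metis less total less_irrefl)
  show "\<rho> i < \<rho> j \<longleftrightarrow> (j, i) \<notin> r" if "i \<in> X" "j \<in> X" for i j
    using that less total refl by (metis less_asym)
qed

lemma int_bases_eq:
  fixes x :: "'a \<Rightarrow> real ^ 'n::finite"
  assumes "\<And>i j. i \<in> X \<Longrightarrow> j \<in> X \<Longrightarrow> \<rho> i < \<rho> j \<longleftrightarrow> (j, i) \<notin> r"
  shows "int_bases r X x = {B. ranked_family.internal x \<rho> {} X B}"
proof -
  have "\<not> int_active r X x B b \<longleftrightarrow> (\<exists>i\<in>X. x i \<notin> span (x ` (B - {b})) \<and> \<rho> b < \<rho> i)"
    if B: "B \<in> bases X x" and b: "b \<in> B" for B b
  proof -
    have "x ` (B - {b}) = x ` B - {x b}" using B b by (auto simp: bases_def inj_on_def)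
    then have "x b \<notin> span (x ` (B - {b}))" using B b by (auto simp: bases_def dependent_def)
    moreover have "b \<in> X" using B b by (auto simp: bases_def)
    ultimately show ?thesis using assms by (auto simp: int_active_def Let_def)
  qed
  then have "B \<in> int_bases r X x \<longleftrightarrow>
      B \<in> bases X x \<and> (\<forall>b\<in>B. \<exists>i\<in>X. x i \<notin> span (x ` (B - {b})) \<and> \<rho> b < \<rho> i)" for B
    unfolding int_bases_def by blast
  then show ?thesis
    by (auto simp: bases_def ranked_family.internal_def)
qed

section \<open>The main theorem\<close>

lemma dim_mono_fin_dim:
  assumes "U \<subseteq> V" "fin_dim V"
  shows "fin_dim U" "cpoly.dim U \<le> cpoly.dim V"
proof -
  show "fin_dim U" using assms by (auto simp: fin_dim_def)
  obtain B where B: "B \<subseteq> V" "cpoly.independent B" "V \<subseteq> cpoly.span B" "card B = cpoly.dim V"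
    by (rule cpoly.basis_exists)
  obtain T where "finite T" "V \<subseteq> cpoly.span T" using assms(2) by (auto simp: fin_dim_def)
  then have "finite B" using cpoly.independent_span_bound[of T B] B(1,2) by auto
  then show "cpoly.dim U \<le> cpoly.dim V"
    using cpoly.dim_le_card[of U B] assms(1) B(3,4) by auto
qed

lemma finite_basis:
  assumes "fin_dim V"
  obtains B where "finite B" "B \<subseteq> V" "cpoly.independent B" "V \<subseteq> cpoly.span B" "card B = cpoly.dim V"
proof -
  obtain B where B: "B \<subseteq> V" "cpoly.independent B" "V \<subseteq> cpoly.span B" "card B = cpoly.dim V"
    by (rule cpoly.basis_exists)
  obtain T where "finite T" "V \<subseteq> cpoly.span T" using assms by (auto simp: fin_dim_def)
  then have "finite B" using cpoly.independent_span_bound[of T B] B(1,2) by auto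
  then show thesis using that B by blast
qed

lemma subspace_eq_if_dim_eq:
  assumes U: "cpoly.subspace U" "U \<subseteq> V" and V: "fin_dim V" and dim: "cpoly.dim V \<le> cpoly.dim U"
  shows "U = V"
proof (rule ccontr)
  assume "U \<noteq> V"
  then obtain f where f: "f \<in> V" "f \<notin> U" using U(2) by blast
  obtain B where B: "finite B" "B \<subseteq> U" "cpoly.independent B" "U \<subseteq> cpoly.span B" "card B = cpoly.dim U"
    using finite_basis[OF dim_mono_fin_dim(1)[OF U(2) V]] .
  obtain C where C: "finite C" "V \<subseteq> cpoly.span C" "card C = cpoly.dim V"
    using finite_basis[OF V] by metis
  have "cpoly.span B \<subseteq> U" using B(2) U(1) by (rule cpoly.span_minimal)
  then have "cpoly.independent (insert f B)" "f \<notin> B"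
    using f B(2,3) by (auto simp: cpoly.independent_insert)
  moreover have "insert f B \<subseteq> cpoly.span C" using f B(2) U(2) C(2) by auto
  ultimately have "Suc (card B) \<le> card C"
    using cpoly.independent_span_bound[OF C(1), of "insert f B"] B(1) by auto
  then show False using dim B(5) C(3) by simp
qed

lemma correctI:
  assumes V: "cpoly.subspace V"
    and inj: "\<And>f. f \<in> V \<Longrightarrow> (\<And>a. a \<in> \<sigma> \<Longrightarrow> peval f a = 0) \<Longrightarrow> f = 0"
    and surj: "\<And>g. \<exists>f\<in>V. \<forall>a\<in>\<sigma>. peval f a = g a"
  shows "correct \<sigma> V"
  unfolding correct_def
proof (rule bij_betw_imageI)
  show "inj_on (\<lambda>p. restrict (peval p) \<sigma>) V"
  proof (rule inj_onI)
    fix p q assume pq: "p \<in> V" "q \<in> V" "restrict (peval p) \<sigma> = restrict (peval q) \<sigma>"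
    have "peval (p - q) a = 0" if "a \<in> \<sigma>" for a
      using fun_cong[OF pq(3), of a] that by simp
    then have "p - q = 0" using pq V by (intro inj) (auto intro: cpoly.subspace_diff)
    then show "p = q" by simp
  qed
  show "(\<lambda>p. restrict (peval p) \<sigma>) ` V = \<sigma> \<rightarrow>\<^sub>E UNIV"
  proof
    show "\<sigma> \<rightarrow>\<^sub>E UNIV \<subseteq> (\<lambda>p. restrict (peval p) \<sigma>) ` V"
    proof
      fix g :: "real ^ 'a \<Rightarrow> complex" assume g: "g \<in> \<sigma> \<rightarrow>\<^sub>E UNIV"
      obtain f where f: "f \<in> V" "\<forall>a\<in>\<sigma>. peval f a = g a" using surj[of g] by blast
      have "restrict (peval f) \<sigma> = g"
        using f(2) g by (auto simp: restrict_def PiE_def extensional_def)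
      then show "g \<in> (\<lambda>p. restrict (peval p) \<sigma>) ` V" using f(1) by blast
    qed
  qed auto
qed

theorem theorem5p9:
  fixes X :: "'a set" and x :: "'a \<Rightarrow> real ^ 'n::finite" and r :: "'a rel"
    and l :: "'a \<Rightarrow> real" and \<eta> :: "(real ^ 'n) set \<Rightarrow> real ^ 'n"
  assumes "finite X"
    and "\<forall>i\<in>X. x i \<noteq> 0"
    and "dim (x ` X) = CARD('n)"
    and "linear_order_on X r"
    and "generic X x l"
    and "\<forall>H\<in>facets X x. is_normal (\<eta> H) H"
  shows
    "(fin_dim (P_int X x) \<and> fin_dim (D_int r X x) \<and>
      cpoly.dim (P_int X x) = cpoly.dim (D_int r X x) \<and>
      cpoly.dim (D_int r X x) = card (int_bases r X x)) \<and>
     bij_betw (\<lambda>p. restrict (pairing p) (P_int X x)) (D_int r X x) (dual (P_int X x)) \<and>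
     (D_int r X x = least_space (int_vertices r X x l) \<and>
      least_space (int_vertices r X x l) = pker (J_int r X x)) \<and>
     (correct (int_vertices r X x l) (D_int r X x) \<and>
      correct (int_vertices r X x l) (P_int X x)) \<and>
     P_int X x = pker (I_int \<eta> X x) \<and>
     (P_int X x \<inter> J_int r X x = {0} \<and>
      {p + q | p q. p \<in> P_int X x \<and> q \<in> J_int r X x} = UNIV)"
proof -
  define \<rho> where "\<rho> = (\<lambda>i. card {k \<in> X. (k, i) \<in> r})"
  have \<rho>: "inj_on \<rho> X" "\<And>i j. i \<in> X \<Longrightarrow> j \<in> X \<Longrightarrow> \<rho> i < \<rho> j \<longleftrightarrow> (j, i) \<notin> r"
    using rank_function[OF assms(4,1)] by (simp_all add: \<rho>_def)
  interpret ranked_family x \<rho> .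
  define P where "P = P_int X x"
  define J where "J = J_int r X x"
  define D where "D = D_int r X x"
  define V where "V = int_vertices r X x l"
  have bases: "int_bases r X x = {B. internal {} X B}"
    by (rule int_bases_eq) (use \<rho>(2) in auto)
  have X: "minor {} X"
    using assms(1,3) \<rho>(1) dim_eq_full[of "x ` X"] by (simp add: minor_def independent_empty)
  have P_iff: "f \<in> P \<longleftrightarrow> (\<forall>v. flat_normal {} X v \<longrightarrow> pdiff (lin_form v ^ (card (off v X) - 1)) f = 0)" for f
    unfolding P_def by (rule P_int_iff[OF X])
  have P_eq: "P = pker (I_int \<eta> X x)"
    using pker_I_int_iff[OF assms(6)] P_iff by blast
  have P: "cpoly.subspace P" and D: "cpoly.subspace D"
    by (simp_all add: P_eq D_def D_int_def subspace_pker)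
  have J: "J = ideal.span (prod_form x ` int_long r X x)" "D = pker J"
    by (simp_all add: J_def J_int_def D_def D_int_def)

  \<comment> \<open>The vertices and their number\<close>
  have generic: "t \<notin> flat x l S" if "S \<subseteq> X" "card S = CARD('n) + 1" for S t
  proof -
    have "(\<Inter>i\<in>S. hyperplane x l i) = {}" using assms(5) that by (simp add: generic_def)
    then show ?thesis by (auto simp: hyperplane_def flat_def)
  qed
  have vertex: "vertex x l B \<in> flat x l B" "\<And>t. t \<in> flat x l B \<Longrightarrow> t = vertex x l B"
    if B: "internal {} X B" for B
  proof -
    have fin: "finite B" and B': "inj_on x B" "independent (x ` B)" "span (x ` B) = UNIV"
      using B assms(1) finite_subset by (auto simp: internal_def)
    obtain t where t: "t \<in> flat x l B" using flat_basis_nonempty[OF fin B'(1,2)] by blast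
    have "vertex x l B = (THE v. v \<in> flat x l B)"
      by (simp add: vertex_def hyperplane_def flat_def)
    also have "\<dots> = t"
      using t flat_unique[OF B'(3)] by (intro the_equality) auto
    finally show "vertex x l B \<in> flat x l B" "\<And>t. t \<in> flat x l B \<Longrightarrow> t = vertex x l B"
      using t flat_unique[OF B'(3)] by auto
  qed
  \<comment> \<open>A vertex shared by two bases would lie on the hyperplanes of their union, which
    has more than \<open>n\<close> elements.\<close>
  have "inj_on (vertex x l) {B. internal {} X B}"
  proof (rule inj_onI, rule ccontr)
    fix B C assume BC: "B \<in> {B. internal {} X B}" "C \<in> {B. internal {} X B}" "vertex x l B = vertex x l C" "B \<noteq> C"
    then have card: "card B = CARD('n)" "card C = CARD('n)" "B \<subseteq> X" "C \<subseteq> X"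
      using card_internal[of "{}" X] by (auto simp: internal_def)
    then have fin: "finite B" "finite C" using assms(1) finite_subset by auto
    have "B \<subset> B \<union> C" using BC(4) card fin card_subset_eq[of B C] by auto
    then have "CARD('n) + 1 \<le> card (B \<union> C)"
      using psubset_card_mono[of "B \<union> C" B] fin card by simp
    then obtain S where S: "S \<subseteq> B \<union> C" "card S = CARD('n) + 1"
      by (rule obtain_subset_with_card_n)
    have "vertex x l B \<in> flat x l B" "vertex x l B \<in> flat x l C"
      using vertex(1)[of B] vertex(1)[of C] BC by auto
    then have "vertex x l B \<in> flat x l S" using S(1) by (auto simp: flat_def)
    then show False using generic[of S "vertex x l B"] S card by auto
  qed
  then have card_V: "card V = card (int_bases r X x)"
    by (simp add: V_def int_vertices_def bases card_image)
  have fin_V: "finite V"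
  proof -
    have "{B. internal {} X B} \<subseteq> Pow X" by (auto simp: internal_def)
    then show ?thesis
      using assms(1) by (auto simp: V_def int_vertices_def bases intro: finite_subset)
  qed

  \<comment> \<open>Upper bounds for the dimensions\<close>
  have P_V: "f = 0" if f: "f \<in> P" "\<And>a. a \<in> V \<Longrightarrow> peval f a = 0" for f
  proof (rule peval_eq_0_imp_eq_0)
    have "\<forall>t\<in>flat x l {}. peval f t = 0"
    proof (rule vanish_on_flat[OF X])
      show "t \<notin> flat x l S" if "S \<subseteq> {} \<union> X" "card S = CARD('n) + 1" for S t
        using generic that by simp
      show "peval (pdiff (lin_form v ^ (card (off v X) - 1)) f) t = 0" if "flat_normal {} X v" for v t
        using f(1) P_iff that by simp
      show "peval f t = 0" if "internal {} X B" "t \<in> flat x l ({} \<union> B)" for B t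
        using f(2) vertex(2)[OF that(1)] that by (auto simp: V_def int_vertices_def bases)
    qed
    then show "peval f t = 0" for t by (simp add: flat_def)
  qed
  have fin_P: "fin_dim P" and dim_P: "cpoly.dim P \<le> card V"
    using peval.dim_le_card[OF fin_V P P_V] by auto

  have D_P: "f = 0" if f: "f \<in> D" "\<And>p. p \<in> P \<Longrightarrow> pairing p f = 0" for f
  proof (rule orthogonal_to_adjusted_products[OF X])
    show "pdiff (prod_form x (off v X - {w})) f = 0"
      if v: "flat_normal {} X v" and w: "w \<in> off v X" "\<And>i. i \<in> off v X \<Longrightarrow> \<rho> i \<le> \<rho> w" for v w
    proof -
      \<comment> \<open>A basis avoiding this set has \<open>w\<close> as its only element off the
        hyperplane. The cocircuit of \<open>w\<close> is then contained in \<open>off v X\<close>,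
        where \<open>w\<close> is maximal, so \<open>w\<close> would be internally active.\<close>
      have "(off v X - {w}) \<inter> B \<noteq> {}" if B: "internal {} X B" for B
      proof
        assume 0: "(off v X - {w}) \<inter> B = {}"
        have BX: "B \<subseteq> X" "span (x ` B) = UNIV" using B by (auto simp: internal_def)
        have vb: "v \<bullet> x b = 0" if "b \<in> B" "b \<noteq> w" for b
          using 0 that BX(1) by (auto simp: off_def)
        have "w \<in> B"
        proof (rule ccontr)
          assume "w \<notin> B"
          then have "v \<bullet> v = 0"
            using BX(2) vb by (intro orthogonal_span_eq_0[of v "x ` B"]) auto
          then show False using v by (simp add: flat_normal_def)
        qed
        then obtain i where i: "i \<in> X" "x i \<notin> span (x ` (B - {w}))" "\<rho> w < \<rho> i"
          using B by (auto simp: internal_def)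
        have "x i \<in> span (insert (x w) (x ` (B - {w})))"
          using BX(2) \<open>w \<in> B\<close> by (simp add: insert_absorb flip: image_insert)
        then obtain k where k: "x i - k *\<^sub>R x w \<in> span (x ` (B - {w}))" by (auto simp: span_insert)
        have "v \<bullet> (x i - k *\<^sub>R x w) = 0"
          using vb by (intro orthogonal_span_eq_0[OF k]) auto
        moreover have "v \<bullet> x i = 0" using w(2)[of i] i by (auto simp: off_def)
        ultimately have "k = 0" using w(1) by (simp add: off_def inner_diff_right)
        then show False using k i(2) by simp
      qed
      then have "off v X - {w} \<in> int_long r X x"
        by (auto simp: int_long_def bases off_def)
      then show ?thesis using f(1) by (simp add: J pker_span_iff)
    qed
    show "pairing (\<Prod>i\<in>K. lin_form (u i)) f = 0"
      if "internal {} X B" "K \<subseteq> X - B" "\<And>i. i \<in> K \<Longrightarrow> adjusted {} X B i (u i)" for B K u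
    proof (rule f(2))
      show "(\<Prod>i\<in>K. lin_form (u i)) \<in> P"
        using pdiff_adjusted_product[OF assms(1) \<rho>(1) that(1) _ that(2,3)]
        by (simp add: P_iff flat_normal_def)
    qed
  qed simp
  obtain S where S: "finite S" "S \<subseteq> P" "P \<subseteq> cpoly.span S" "card S = cpoly.dim P" "cpoly.independent S"
    using finite_basis[OF fin_P] by metis
  have D_S: "f = 0" if f: "f \<in> D" "\<And>s. s \<in> S \<Longrightarrow> pairing f s = 0" for f
  proof (rule D_P[OF f(1)])
    fix p assume "p \<in> P"
    then have "p \<in> cpoly.span S" using S(3) by blast
    then show "pairing p f = 0"
      by (induction rule: cpoly.span_induct_alt) (use f(2) pairing_commute[of _ f] in auto)
  qed
  have fin_D: "fin_dim D" and dim_D: "cpoly.dim D \<le> cpoly.dim P"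
    using pairing.dim_le_card[OF S(1) D D_S] S(4) by auto

  \<comment> \<open>The least space closes the chain of dimensions\<close>
  define L where "L = least_space V"
  have L: "cpoly.subspace L" by (simp add: L_def least_space_def cpoly.subspace_span)
  have L_D: "L \<subseteq> D"
    unfolding L_def J
  proof (rule least_space_subset_pker)
    fix Y assume Y: "Y \<in> int_long r X x"
    have "\<exists>y\<in>Y. x y \<bullet> a = l y" if a: "a \<in> V" for a
    proof -
      obtain B where B: "internal {} X B" "a = vertex x l B"
        using a by (auto simp: V_def int_vertices_def bases)
      then obtain y where "y \<in> Y" "y \<in> B" using Y by (auto simp: int_long_def bases)
      then show ?thesis using vertex(1)[OF B(1)] B(2) by (auto simp: flat_def)
    qed
    then show "finite Y \<and> (\<forall>a\<in>V. \<exists>y\<in>Y. x y \<bullet> a = l y)"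
      using Y assms(1) finite_subset by (auto simp: int_long_def)
  qed
  have fin_L: "fin_dim L" and dim_LD: "cpoly.dim L \<le> cpoly.dim D"
    using dim_mono_fin_dim[OF L_D fin_D] by auto
  have L_surj: "\<exists>f\<in>L. \<forall>a\<in>V. peval f a = g a" for g
    unfolding L_def by (rule peval_least_space_surj[OF fin_V])
  have dim_L: "card V \<le> cpoly.dim L"
    using peval.surj_dim(1)[OF fin_V L fin_L L_surj] .
  \<comment> \<open>All inequalities in
    \<open>card V \<le> dim L \<le> dim D \<le> dim P \<le> card V\<close> become
    equalities.\<close>
  have dims: "cpoly.dim P = card V" "cpoly.dim D = card V" "cpoly.dim L = card V"
    using dim_P dim_D dim_LD dim_L by auto
  have D_eq: "D = L"
    using subspace_eq_if_dim_eq[OF L L_D fin_D] dims by simp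

  \<comment> \<open>Interpolation at the vertices\<close>
  have correct_D: "correct V D"
  proof (rule correctI[OF D])
    show "f = 0" if "f \<in> D" "\<And>a. a \<in> V \<Longrightarrow> peval f a = 0" for f
      using peval.surj_dim(2)[OF fin_V L fin_L L_surj dims(3), of f] that D_eq by blast
    show "\<exists>f\<in>D. \<forall>a\<in>V. peval f a = g a" for g using L_surj D_eq by simp
  qed
  have correct_P: "correct V P"
    using dims by (intro correctI[OF P P_V] peval.surj_if_inj[OF fin_V P P_V]) auto

  \<comment> \<open>Duality between the two spaces\<close>
  have D_surj: "\<exists>f\<in>D. \<forall>s\<in>S. pairing f s = g s" for g
    using pairing.surj_if_inj[OF S(1) D D_S, of g] dims S(4) by auto
  have P_D: "p = 0" if p: "p \<in> P" "\<And>f. f \<in> D \<Longrightarrow> pairing p f = 0" for p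
  proof -
    have "p \<in> cpoly.span S" using p(1) S(3) by blast
    then obtain u where u: "p = (\<Sum>s\<in>S. cscale (u s) s)"
      unfolding cpoly.span_finite[OF S(1)] by auto
    \<comment> \<open>An element of \<open>D\<close> dual to \<open>s\<close> reads off the
      coefficient of \<open>s\<close> in \<open>p\<close>.\<close>
    have "u s = 0" if s: "s \<in> S" for s
    proof -
      obtain f where f: "f \<in> D" "\<forall>s'\<in>S. pairing f s' = (if s' = s then 1 else 0)"
        using D_surj[of "\<lambda>s'. if s' = s then 1 else 0"] by blast
      have "0 = pairing f p" using p(2)[OF f(1)] by (simp add: pairing_commute)
      also have "\<dots> = (\<Sum>s'\<in>S. if s' = s then u s' else 0)"
        unfolding u pairing_sum_right pairing_cscale_right
        by (intro sum.cong refl) (use f(2) in auto)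
      finally show ?thesis using s S(1) by simp
    qed
    then show ?thesis using u by simp
  qed
  obtain T where T: "finite T" "T \<subseteq> D" "D \<subseteq> cpoly.span T" "card T = cpoly.dim D"
    using finite_basis[OF fin_D] by metis
  have on_T: "pairing p f = 0" if "\<And>s. s \<in> T \<Longrightarrow> pairing p s = 0" "f \<in> D" for p f
  proof -
    have "f \<in> cpoly.span T" using T(3) that(2) by blast
    then show ?thesis
      by (induction rule: cpoly.span_induct_alt) (auto simp: that(1))
  qed
  have P_surj: "\<exists>p\<in>P. \<forall>s\<in>T. pairing p s = g s" for g
    by (rule pairing.surj_if_inj[OF T(1) P]) (use P_D on_T dims T(4) in auto)

  have bij: "bij_betw (\<lambda>p. restrict (pairing p) P) D (dual P)"
  proof (rule bij_betw_imageI)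
    show "inj_on (\<lambda>p. restrict (pairing p) P) D"
    proof (rule inj_onI)
      fix f g assume fg: "f \<in> D" "g \<in> D" "restrict (pairing f) P = restrict (pairing g) P"
      have "pairing p (f - g) = 0" if "p \<in> P" for p
        using fun_cong[OF fg(3), of p] that by (simp add: pairing_commute[of p])
      then have "f - g = 0" using fg D by (intro D_P) (auto intro: cpoly.subspace_diff)
      then show "f = g" by simp
    qed
    show "(\<lambda>p. restrict (pairing p) P) ` D = dual P"
    proof
      show "(\<lambda>p. restrict (pairing p) P) ` D \<subseteq> dual P"
        using P by (auto simp: dual_def cpoly.subspace_add cpoly.subspace_scale)
      show "dual P \<subseteq> (\<lambda>p. restrict (pairing p) P) ` D"
      proof
        fix \<phi> assume \<phi>: "\<phi> \<in> dual P"
        obtain f where f: "f \<in> D" "\<forall>s\<in>S. pairing f s = \<phi> s" using D_surj by blast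
        have add: "\<phi> (p + q) = \<phi> p + \<phi> q" if "p \<in> P" "q \<in> P" for p q
          using \<phi> that by (simp add: dual_def)
        have scale: "\<phi> (cscale c p) = c * \<phi> p" if "p \<in> P" for c p
          using \<phi> that by (simp add: dual_def)
        have zero: "\<phi> 0 = 0"
          using scale[of 0 0] cpoly.subspace_0[OF P] by simp
        have "p \<in> P \<and> \<phi> p = pairing f p" if "p \<in> cpoly.span S" for p
          using that
        proof (induction rule: cpoly.span_induct_alt)
          case base
          show ?case using zero P by (simp add: cpoly.subspace_0)
        next
          case (step c s p)
          then have s: "s \<in> P" "cscale c s \<in> P" using S(2) P by (auto intro: cpoly.subspace_scale)
          then have "cscale c s + p \<in> P" using step.IH P by (auto intro: cpoly.subspace_add)
          moreover have "\<phi> s = pairing f s" using f(2) step.hyps by simp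
          ultimately show ?case using step.IH s by (simp add: add scale)
        qed
        then have "\<phi> p = restrict (pairing f) P p" for p
          using S(3) \<phi> by (cases "p \<in> P") (auto simp: dual_def extensional_def)
        then show "\<phi> \<in> (\<lambda>p. restrict (pairing p) P) ` D" using f(1) by blast
      qed
    qed
  qed

  \<comment> \<open>The direct sum decomposition\<close>
  have J_ann: "q \<in> J \<longleftrightarrow> (\<forall>f\<in>D. pairing q f = 0)" for q
  proof
    assume "\<forall>f\<in>D. pairing q f = 0"
    then show "q \<in> J"
      unfolding J
    proof (intro double_annihilator)
      fix g assume "g \<in> prod_form x ` int_long r X x"
      then obtain Y where Y: "g = prod_form x Y" "Y \<subseteq> X" by (auto simp: int_long_def)
      have "finite Y" using Y(2) assms(1) by (rule finite_subset)
      then show "\<exists>d. homog d g" using homog_prod_form Y(1) by blast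
    qed auto
  qed (auto simp: J pker_span_iff_pairing)
  have P_J: "P \<inter> J = {0}"
  proof
    show "P \<inter> J \<subseteq> {0}" using P_D J_ann by blast
    show "{0} \<subseteq> P \<inter> J" using cpoly.subspace_0[OF P] by (simp add: J_ann)
  qed
  have "q \<in> {p + q | p q. p \<in> P \<and> q \<in> J}" for q
  proof -
    \<comment> \<open>Choosing \<open>p\<close> with the same pairings as \<open>q\<close> on a
      spanning set of \<open>D\<close> makes \<open>q - p\<close> orthogonal to \<open>D\<close>,
      hence a member of the ideal.\<close>
    obtain p where p: "p \<in> P" "\<forall>s\<in>T. pairing p s = pairing q s" using P_surj by blast
    then have "q - p \<in> J" using on_T[of "q - p"] by (simp add: J_ann)
    moreover have "q = p + (q - p)" by simp
    ultimately show ?thesis using p(1) by blast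
  qed
  then have sum: "{p + q | p q. p \<in> P \<and> q \<in> J} = UNIV"
    by (rule UNIV_eq_I[symmetric])

  show ?thesis
    using fin_P fin_D dims card_V bij D_eq J(2) correct_D correct_P P_eq P_J sum
    unfolding P_def[symmetric] D_def[symmetric] J_def[symmetric] V_def[symmetric] L_def
    by (intro conjI) simp_all
qed

end
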